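(* Let $y_0\in\mathcal V$, and assume that for every $u\in U_{ad}$ the discrete (particle) system has a unique solution $(y_h,\Phi)\in (W(V)\cap L^\infty(V))\times P$. Then the discrete optimal control problem $(\mathcal P_h)$, $$\text{minimise } J(y_h,u)=\tfrac12\|y_h(T)-y_d\|_H^2+\tfrac\sigma2\|u\|_{H^1(0,T)}^2\quad\text{over } u\in U_{ad},\ (y_h,\Phi)\ \text{subject to the discrete system},$$ has an optimal solution.
   Context: $T,\nu,\sigma>0$, $\chi_c\in C_0^\infty(\mathbb R)$, $y_d\in L^2(\mathbb R)$ with compact support, $-\infty<u_l\le u_u<\infty$ are fixed. $V:=H^1(\mathbb R)$, $H:=L^2(\mathbb R)$, $L^2(X):=L^2(0,T;X)$, $L^\infty(X):=L^\infty(0,T;X)$, $W(V):=\{y\in L^2(V):\partial_t y\in L^2(V^* )\}$. $\mathcal V\subset V$ is the set of functions in $V$ with support in a bounded interval $[a,b]$, $-\infty<a\le b<\infty$. $U_{ad}:=\{u\in H^1(0,T):u_l\le u(t)\le u_u\text{ a.e.}\}$, $(\mathcal Bu)(x,t)=\chi_c(x)u(t)$. $P:=(H^1(0,T))^N$. Kernel: $r\ge1$ is an integer and $\zeta\in C^\infty(\mathbb R)\cap L^1(\mathbb R)$ satisfies $\int\zeta=1$, $\int x^\alpha\zeta(x)\,dx=0$ for integers $1\le\alpha\le r-1$, $\int|x|^r|\zeta(x)|\,dx<\infty$; $\delta_\varepsilon(x)=\varepsilon^{-1}\zeta(\varepsilon^{-1}x)$, $0<\varepsilon\le1$ fixed.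 Discrete system: $y_h(x,t)=\sum_{i=1}^N\alpha_i(t)\delta_\varepsilon(x-\Phi_i(t))$, where $\Phi=(\Phi_i)_{i=1}^N\in P$ satisfies $\partial_t\Phi_i(t)=y_h(\Phi_i(t),t)$, $\Phi_i(0)=X_i$, the given initial points $X_i$ having point distances $h_i$ and covering the support of $y_0$ plus a small neighbourhood, and for all $\varphi\in V$, $\psi\in H$, a.e. $t$: $\langle\partial_t y_h(t),\varphi\rangle_{V^*,V}+\langle y_h(t)\partial_x y_h(t),\varphi\rangle_H+\nu\langle\partial_x y_h(t),\partial_x\varphi\rangle_H=\langle\mathcal Bu(t),\varphi\rangle_H$, $\langle y_h(0),\psi\rangle_H=\langle y_0,\psi\rangle_H$. *)

theory Defs
  imports "HOL-Analysis.Analysis"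
begin

text \<open>Elements of Lebesgue and Sobolev spaces are represented by functions, not by classes of
  functions modulo equality almost everywhere. All notions below that refer to such an element are
  invariant under changes on null sets, unless a particular representative is mentioned.\<close>

section \<open>Function spaces in one scalar variable\<close>

definition smooth :: "(real \<Rightarrow> real) \<Rightarrow> bool" where
  "smooth f \<longleftrightarrow> (\<forall>k. (deriv ^^ k) f differentiable_on UNIV)"

definition Cc_inf :: "real set \<Rightarrow> (real \<Rightarrow> real) set" where
  "Cc_inf S = {f. smooth f \<and> compact (closure {x. f x \<noteq> 0}) \<and> closure {x. f x \<noteq> 0} \<subseteq> S}"

definition L2 :: "real set \<Rightarrow> (real \<Rightarrow> real) set" where
  "L2 S = {f. f \<in> borel_measurable (lebesgue_on S) \<and> integrable (lebesgue_on S) (\<lambda>x. (f x)\<^sup>2)}"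

definition inner_L2 :: "real set \<Rightarrow> (real \<Rightarrow> real) \<Rightarrow> (real \<Rightarrow> real) \<Rightarrow> real" where
  "inner_L2 S f g = (LINT x|lebesgue_on S. f x * g x)"

definition norm_L2 :: "real set \<Rightarrow> (real \<Rightarrow> real) \<Rightarrow> real" where
  "norm_L2 S f = sqrt (inner_L2 S f f)"

definition is_weak_deriv :: "real set \<Rightarrow> (real \<Rightarrow> real) \<Rightarrow> (real \<Rightarrow> real) \<Rightarrow> bool" where
  "is_weak_deriv S f g \<longleftrightarrow>
     (\<forall>\<phi>\<in>Cc_inf S. (LINT x|lebesgue_on S. f x * deriv \<phi> x) = - (LINT x|lebesgue_on S. g x * \<phi> x))"

definition H1 :: "real set \<Rightarrow> (real \<Rightarrow> real) set" where
  "H1 S = {f \<in> L2 S. \<exists>g\<in>L2 S. is_weak_deriv S f g}"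

text \<open>For \<open>S\<close> open, the weak derivative of a function in \<open>H1 S\<close> is unique up to a null set.\<close>

definition weak_deriv :: "real set \<Rightarrow> (real \<Rightarrow> real) \<Rightarrow> real \<Rightarrow> real" where
  "weak_deriv S f = (SOME g. g \<in> L2 S \<and> is_weak_deriv S f g)"

definition norm_H1 :: "real set \<Rightarrow> (real \<Rightarrow> real) \<Rightarrow> real" where
  "norm_H1 S f = sqrt ((norm_L2 S f)\<^sup>2 + (norm_L2 S (weak_deriv S f))\<^sup>2)"

text \<open>The support of a class of functions modulo equality almost everywhere: the complement of the
  largest open set on which the function vanishes almost everywhere.\<close>

definition ess_support :: "(real \<Rightarrow> real) \<Rightarrow> real set" where
  "ess_support f = - \<Union>{U. open U \<and> (AE x in lebesgue. x \<in> U \<longrightarrow> f x = 0)}"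

section \<open>The Gelfand triple\<close>

abbreviation "H \<equiv> L2 UNIV"
abbreviation "inner_H \<equiv> inner_L2 UNIV"
abbreviation "norm_H \<equiv> norm_L2 UNIV"
abbreviation "V \<equiv> H1 UNIV"
abbreviation "norm_V \<equiv> norm_H1 UNIV"
abbreviation "dx \<equiv> weak_deriv UNIV"

text \<open>The subset of \<open>V\<close> that the context denotes by a calligraphic V.\<close>

definition V_bdd :: "(real \<Rightarrow> real) set" where
  "V_bdd = {f \<in> V. \<exists>a b. a \<le> b \<and> ess_support f \<subseteq> {a..b}}"

text \<open>Functionals are total on \<^typ>\<open>real \<Rightarrow> real\<close>, but only their values on \<open>V\<close> matter. Boundedness
  makes them respect equality almost everywhere.\<close>

definition V_dual :: "((real \<Rightarrow> real) \<Rightarrow> real) set" where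
  "V_dual = {F.
     (\<forall>f\<in>V. \<forall>g\<in>V. F (\<lambda>x. f x + g x) = F f + F g) \<and>
     (\<forall>c. \<forall>f\<in>V. F (\<lambda>x. c * f x) = c * F f) \<and>
     (\<exists>C. \<forall>f\<in>V. \<bar>F f\<bar> \<le> C * norm_V f)}"

definition norm_V_dual :: "((real \<Rightarrow> real) \<Rightarrow> real) \<Rightarrow> real" where
  "norm_V_dual F = (SUP f\<in>{f \<in> V. norm_V f \<le> 1}. \<bar>F f\<bar>)"

section \<open>Bochner spaces on a time interval\<close>

text \<open>\<open>X\<close> is a space of real-valued functions with (semi)norm \<open>nrm\<close>; it is used both for \<open>V\<close> and
  for its dual. A function is strongly measurable if it is almost everywhere the limit in norm of
  simple functions with values in \<open>X\<close>.\<close>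

definition strongly_measurable ::
  "real \<Rightarrow> ('a \<Rightarrow> real) set \<Rightarrow> (('a \<Rightarrow> real) \<Rightarrow> real) \<Rightarrow> (real \<Rightarrow> 'a \<Rightarrow> real) \<Rightarrow> bool" where
  "strongly_measurable T X nrm f \<longleftrightarrow>
     (AE t in lebesgue_on {0<..<T}. f t \<in> X) \<and>
     (\<exists>s. (\<forall>n. simple_function (lebesgue_on {0<..<T}) (s n) \<and> s n ` {0<..<T} \<subseteq> X) \<and>
          (AE t in lebesgue_on {0<..<T}. (\<lambda>n::nat. nrm (\<lambda>z. s n t z - f t z)) \<longlonglongrightarrow> 0))"

definition Bochner_L2 ::
  "real \<Rightarrow> ('a \<Rightarrow> real) set \<Rightarrow> (('a \<Rightarrow> real) \<Rightarrow> real) \<Rightarrow> (real \<Rightarrow> 'a \<Rightarrow> real) set" where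
  "Bochner_L2 T X nrm =
     {f. strongly_measurable T X nrm f \<and> integrable (lebesgue_on {0<..<T}) (\<lambda>t. (nrm (f t))\<^sup>2)}"

definition Bochner_Linf ::
  "real \<Rightarrow> ('a \<Rightarrow> real) set \<Rightarrow> (('a \<Rightarrow> real) \<Rightarrow> real) \<Rightarrow> (real \<Rightarrow> 'a \<Rightarrow> real) set" where
  "Bochner_Linf T X nrm =
     {f. strongly_measurable T X nrm f \<and> (\<exists>C. AE t in lebesgue_on {0<..<T}. nrm (f t) \<le> C)}"

text \<open>The distributional time derivative of a \<open>V\<close>-valued function, as a function with values in the
  dual of \<open>V\<close>. The defining identity in the dual of \<open>V\<close> is tested with the elements \<open>v\<close> of \<open>V\<close>, and
  \<open>V\<close> is embedded into its dual by the inner product of \<open>H\<close>.\<close>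

definition is_time_deriv ::
  "real \<Rightarrow> (real \<Rightarrow> real \<Rightarrow> real) \<Rightarrow> (real \<Rightarrow> (real \<Rightarrow> real) \<Rightarrow> real) \<Rightarrow> bool" where
  "is_time_deriv T y g \<longleftrightarrow>
     (\<forall>\<phi>\<in>Cc_inf {0<..<T}. \<forall>v\<in>V.
        (LINT t|lebesgue_on {0<..<T}. deriv \<phi> t * inner_H (y t) v)
          = - (LINT t|lebesgue_on {0<..<T}. \<phi> t * g t v))"

definition W_V :: "real \<Rightarrow> (real \<Rightarrow> real \<Rightarrow> real) set" where
  "W_V T = {y \<in> Bochner_L2 T V norm_V. \<exists>g\<in>Bochner_L2 T V_dual norm_V_dual. is_time_deriv T y g}"

text \<open>\<open>dt T y t v\<close> is the duality pairing of the time derivative of \<open>y\<close> at time \<open>t\<close> with \<open>v\<close>. The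
  choice is unique up to a null set of times and up to the values outside \<open>V\<close>.\<close>

definition dt :: "real \<Rightarrow> (real \<Rightarrow> real \<Rightarrow> real) \<Rightarrow> real \<Rightarrow> (real \<Rightarrow> real) \<Rightarrow> real" where
  "dt T y = (SOME g. g \<in> Bochner_L2 T V_dual norm_V_dual \<and> is_time_deriv T y g)"

text \<open>\<open>y\<close> is the representative, continuous on the closed time interval with values in \<open>H\<close>, that
  gives the values \<open>y 0\<close> and \<open>y T\<close> of an element of \<open>W_V T\<close> their meaning.\<close>

definition continuous_into_H :: "real \<Rightarrow> (real \<Rightarrow> real \<Rightarrow> real) \<Rightarrow> bool" where
  "continuous_into_H T y \<longleftrightarrow>
     (\<forall>t\<in>{0..T}. y t \<in> H) \<and>
     (\<forall>t\<in>{0..T}. ((\<lambda>s. norm_H (\<lambda>x. y s x - y t x)) \<longlongrightarrow> 0) (at t within {0..T}))"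

section \<open>The discrete optimal control problem\<close>

definition U_ad :: "real \<Rightarrow> real \<Rightarrow> real \<Rightarrow> (real \<Rightarrow> real) set" where
  "U_ad T ul uu = {u \<in> H1 {0<..<T}. AE t in lebesgue_on {0<..<T}. ul \<le> u t \<and> u t \<le> uu}"

definition control_op :: "(real \<Rightarrow> real) \<Rightarrow> (real \<Rightarrow> real) \<Rightarrow> real \<Rightarrow> real \<Rightarrow> real" where
  "control_op \<chi>\<^sub>c u t x = \<chi>\<^sub>c x * u t"

definition smoothing_kernel :: "nat \<Rightarrow> (real \<Rightarrow> real) \<Rightarrow> bool" where
  "smoothing_kernel r \<zeta> \<longleftrightarrow>
     r \<ge> 1 \<and> smooth \<zeta> \<and> integrable lebesgue \<zeta> \<and> (LINT x|lebesgue. \<zeta> x) = 1 \<and>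
     (\<forall>\<alpha>\<in>{1..<r}. (LINT x|lebesgue. x ^ \<alpha> * \<zeta> x) = 0) \<and>
     integrable lebesgue (\<lambda>x. \<bar>x\<bar> ^ r * \<bar>\<zeta> x\<bar>)"

definition mollifier :: "(real \<Rightarrow> real) \<Rightarrow> real \<Rightarrow> real \<Rightarrow> real" where
  "mollifier \<zeta> \<epsilon> x = \<zeta> (x / \<epsilon>) / \<epsilon>"

text \<open>Particles are numbered from \<open>1\<close> to \<open>N\<close>.\<close>

definition initial_points ::
  "nat \<Rightarrow> (nat \<Rightarrow> real) \<Rightarrow> (nat \<Rightarrow> real) \<Rightarrow> (real \<Rightarrow> real) \<Rightarrow> bool" where
  "initial_points N X h y0 \<longleftrightarrow>
     N \<ge> 1 \<and> (\<forall>i\<in>{1..<N}. h i > 0 \<and> X (Suc i) - X i = h i) \<and>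
     (\<exists>\<eta>>0. \<forall>x\<in>ess_support y0. {x - \<eta>..x + \<eta>} \<subseteq> {X 1..X N})"

text \<open>The components of \<open>\<Phi>\<close> are the continuous representatives on the closed time interval. By the
  particle representation, \<open>y t\<close> is a smooth function, so \<open>y t (\<Phi> i t)\<close> is a genuine point value.\<close>

definition discrete_solution ::
  "real \<Rightarrow> real \<Rightarrow> (real \<Rightarrow> real) \<Rightarrow> (real \<Rightarrow> real) \<Rightarrow> real \<Rightarrow> nat \<Rightarrow> (nat \<Rightarrow> real) \<Rightarrow> (real \<Rightarrow> real)
     \<Rightarrow> (real \<Rightarrow> real) \<Rightarrow> (real \<Rightarrow> real \<Rightarrow> real) \<Rightarrow> (nat \<Rightarrow> real \<Rightarrow> real) \<Rightarrow> bool" where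
  "discrete_solution T \<nu> \<chi>\<^sub>c \<zeta> \<epsilon> N X y0 u y \<Phi> \<longleftrightarrow>
     y \<in> W_V T \<and> y \<in> Bochner_Linf T V norm_V \<and> continuous_into_H T y \<and>
     (\<forall>i\<in>{1..N}. \<Phi> i \<in> H1 {0<..<T} \<and> continuous_on {0..T} (\<Phi> i)) \<and>
     (\<exists>\<alpha>. \<forall>t\<in>{0..T}. \<forall>x. y t x = (\<Sum>i=1..N. \<alpha> i t * mollifier \<zeta> \<epsilon> (x - \<Phi> i t))) \<and>
     (\<forall>i\<in>{1..N}. (AE t in lebesgue_on {0<..<T}. weak_deriv {0<..<T} (\<Phi> i) t = y t (\<Phi> i t)) \<and>
                 \<Phi> i 0 = X i) \<and>
     (\<forall>\<phi>\<in>V. AE t in lebesgue_on {0<..<T}.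
        dt T y t \<phi> + inner_H (\<lambda>x. y t x * dx (y t) x) \<phi> + \<nu> * inner_H (dx (y t)) (dx \<phi>)
          = inner_H (control_op \<chi>\<^sub>c u t) \<phi>) \<and>
     (\<forall>\<psi>\<in>H. inner_H (y 0) \<psi> = inner_H y0 \<psi>)"

definition unique_discrete_solution ::
  "real \<Rightarrow> real \<Rightarrow> (real \<Rightarrow> real) \<Rightarrow> (real \<Rightarrow> real) \<Rightarrow> real \<Rightarrow> nat \<Rightarrow> (nat \<Rightarrow> real) \<Rightarrow> (real \<Rightarrow> real)
     \<Rightarrow> (real \<Rightarrow> real) \<Rightarrow> bool" where
  "unique_discrete_solution T \<nu> \<chi>\<^sub>c \<zeta> \<epsilon> N X y0 u \<longleftrightarrow>
     (\<exists>y \<Phi>. discrete_solution T \<nu> \<chi>\<^sub>c \<zeta> \<epsilon> N X y0 u y \<Phi> \<and>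
        (\<forall>z \<Psi>. discrete_solution T \<nu> \<chi>\<^sub>c \<zeta> \<epsilon> N X y0 u z \<Psi> \<longrightarrow>
           (\<forall>t\<in>{0..T}. \<forall>x. z t x = y t x) \<and> (\<forall>i\<in>{1..N}. \<forall>t\<in>{0..T}. \<Psi> i t = \<Phi> i t)))"

definition cost ::
  "real \<Rightarrow> real \<Rightarrow> (real \<Rightarrow> real) \<Rightarrow> (real \<Rightarrow> real \<Rightarrow> real) \<Rightarrow> (real \<Rightarrow> real) \<Rightarrow> real" where
  "cost T \<sigma> yd y u =
     1 / 2 * (norm_H (\<lambda>x. y T x - yd x))\<^sup>2 + \<sigma> / 2 * (norm_H1 {0<..<T} u)\<^sup>2"

definition optimal_solution ::
  "real \<Rightarrow> real \<Rightarrow> real \<Rightarrow> (real \<Rightarrow> real) \<Rightarrow> (real \<Rightarrow> real) \<Rightarrow> real \<Rightarrow> real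
     \<Rightarrow> (real \<Rightarrow> real) \<Rightarrow> real \<Rightarrow> nat \<Rightarrow> (nat \<Rightarrow> real) \<Rightarrow> (real \<Rightarrow> real)
     \<Rightarrow> (real \<Rightarrow> real) \<Rightarrow> (real \<Rightarrow> real \<Rightarrow> real) \<Rightarrow> (nat \<Rightarrow> real \<Rightarrow> real) \<Rightarrow> bool" where
  "optimal_solution T \<nu> \<sigma> \<chi>\<^sub>c yd ul uu \<zeta> \<epsilon> N X y0 u y \<Phi> \<longleftrightarrow>
     u \<in> U_ad T ul uu \<and> discrete_solution T \<nu> \<chi>\<^sub>c \<zeta> \<epsilon> N X y0 u y \<Phi> \<and>
     (\<forall>v z \<Psi>. v \<in> U_ad T ul uu \<and> discrete_solution T \<nu> \<chi>\<^sub>c \<zeta> \<epsilon> N X y0 v z \<Psi> \<longrightarrow>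
        cost T \<sigma> yd y u \<le> cost T \<sigma> yd z v)"

end

theory Submission
  imports Defs "HOL-Complex_Analysis.Great_Picard"
begin

text \<open>The direct method. A minimising sequence of controls is bounded in \<open>H\<^sup>1(0,T)\<close>, so by the
  theorem of Arzela and Ascoli a subsequence converges in \<open>L\<^sup>2(0,T)\<close> to some \<open>U\<close>; the bounds pass to
  \<open>U\<close>, and the norm of the weak derivative is lower semicontinuous. Whatever their particle
  representation, the states solve the viscous Burgers equation tested with all of \<open>V\<close>. Hence the
  state of the \<open>n\<close>-th control can be compared directly with the state of \<open>U\<close>, which exists by
  hypothesis: an energy estimate for the difference gives convergence of the final states in \<open>H\<close>,
  and no compactness of the states is needed. The energy estimate uses that all time derivatives
  are bounded in the dual of \<open>V\<close>, uniformly in time.\<close>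

section \<open>Square integrable functions\<close>

text \<open>The obstacle is the energy estimate for the difference \<open>w\<close> of two states.
  The weak equation holds for each test function outside a null set of times that depends on the
  test function, so \<open>w t\<close> itself cannot be inserted at time \<open>t\<close>. A simple
  function with values in \<open>V\<close> meets only finitely many test functions, hence one common
  null set, and the uniform dual bound turns the error of replacing \<open>w\<close> by it into an
  L1 distance in time. What is left are difference quotients of scalar functions on level sets;
  their integrals converge by a pi-lambda argument from the increments over intervals, without
  differentiating almost everywhere. An inequality suffices, and it comes from
  \<open>w b - w a\<close> having nonnegative square norm. Along the minimising sequence the cost,
  the final states and the L2 norms of the controls all converge. So the norms of the weak
  derivatives converge as well, and it remains to show that the derivative of the limit control does
  not exceed their limit.\<close>

lemma L2I: "f \<in> borel_measurable (lebesgue_on S) \<Longrightarrow> integrable (lebesgue_on S) (\<lambda>x. (f x)\<^sup>2) \<Longrightarrow> f \<in> L2 S"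
  by (simp add: L2_def)

lemma L2_measurable: "f \<in> L2 S \<Longrightarrow> f \<in> borel_measurable (lebesgue_on S)"
  and L2_square_integrable: "f \<in> L2 S \<Longrightarrow> integrable (lebesgue_on S) (\<lambda>x. (f x)\<^sup>2)"
  by (simp_all add: L2_def)

lemma L2_mult_integrable:
  assumes "f \<in> L2 S" "g \<in> L2 S"
  shows "integrable (lebesgue_on S) (\<lambda>x. f x * g x)"
proof (rule Bochner_Integration.integrable_bound)
  show "integrable (lebesgue_on S) (\<lambda>x. (f x)\<^sup>2 + (g x)\<^sup>2)"
    using assms by (simp add: L2_def)
  show "(\<lambda>x. f x * g x) \<in> borel_measurable (lebesgue_on S)"
    using assms by (auto simp: L2_def)
  have "\<bar>a * b\<bar> \<le> a\<^sup>2 + b\<^sup>2" for a b :: real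
  proof -
    have "2 * (\<bar>a\<bar> * \<bar>b\<bar>) \<le> a\<^sup>2 + b\<^sup>2"
      using sum_squares_bound[of "\<bar>a\<bar>" "\<bar>b\<bar>"] by (simp add: mult.assoc)
    then show ?thesis by (simp add: abs_mult) (smt (verit) mult_nonneg_nonneg)
  qed
  then show "AE x in lebesgue_on S. norm (f x * g x) \<le> norm ((f x)\<^sup>2 + (g x)\<^sup>2)"
    by simp
qed

lemma L2_add: assumes "f \<in> L2 S" "g \<in> L2 S" shows "(\<lambda>x. f x + g x) \<in> L2 S"
proof (rule L2I)
  have "integrable (lebesgue_on S) (\<lambda>x. (f x)\<^sup>2 + (g x)\<^sup>2 + 2 * (f x * g x))"
    using assms L2_mult_integrable[OF assms] by (simp add: L2_def)
  then show "integrable (lebesgue_on S) (\<lambda>x. (f x + g x)\<^sup>2)"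
    by (simp add: power2_sum mult.assoc)
qed (use assms in \<open>auto simp: L2_def\<close>)

lemma L2_cmult: "f \<in> L2 S \<Longrightarrow> (\<lambda>x. c * f x) \<in> L2 S"
  by (auto simp: L2_def power_mult_distrib)

lemma L2_zero: "(\<lambda>x. 0) \<in> L2 S"
  by (auto simp: L2_def)

lemma L2_diff: assumes "f \<in> L2 S" "g \<in> L2 S" shows "(\<lambda>x. f x - g x) \<in> L2 S"
  using L2_add[OF assms(1) L2_cmult[OF assms(2), of "-1"]] by simp

lemma L2_bounded_mult:
  assumes "f \<in> borel_measurable (lebesgue_on S)" "AE x in lebesgue_on S. \<bar>f x\<bar> \<le> B" "g \<in> L2 S"
  shows "(\<lambda>x. f x * g x) \<in> L2 S"
proof (rule L2I)
  show m: "(\<lambda>x. f x * g x) \<in> borel_measurable (lebesgue_on S)"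
    using assms by (auto simp: L2_def)
  show "integrable (lebesgue_on S) (\<lambda>x. (f x * g x)\<^sup>2)"
  proof (rule Bochner_Integration.integrable_bound)
    show "integrable (lebesgue_on S) (\<lambda>x. B\<^sup>2 * (g x)\<^sup>2)"
      using assms by (simp add: L2_def)
    show "AE x in lebesgue_on S. norm ((f x * g x)\<^sup>2) \<le> norm (B\<^sup>2 * (g x)\<^sup>2)"
      using assms(2)
    proof eventually_elim
      case (elim x)
      then have "(f x)\<^sup>2 \<le> B\<^sup>2" by (metis abs_ge_zero power2_abs power_mono)
      then show ?case by (simp add: power_mult_distrib mult_right_mono)
    qed
  qed (use m in auto)
qed

lemma inner_L2_cong_AE:
  assumes "AE x in lebesgue_on S. f x = f' x" "AE x in lebesgue_on S. g x = g' x"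
    and "f \<in> borel_measurable (lebesgue_on S)" "f' \<in> borel_measurable (lebesgue_on S)"
    and "g \<in> borel_measurable (lebesgue_on S)" "g' \<in> borel_measurable (lebesgue_on S)"
  shows "inner_L2 S f g = inner_L2 S f' g'"
  unfolding inner_L2_def
proof (rule integral_cong_AE)
  show "AE x in lebesgue_on S. f x * g x = f' x * g' x"
    using assms(1,2) by eventually_elim simp
qed (use assms in auto)

lemma inner_L2_commute: "inner_L2 S f g = inner_L2 S g f"
  by (simp add: inner_L2_def mult.commute)

lemma inner_L2_add_left:
  assumes "f \<in> L2 S" "g \<in> L2 S" "h \<in> L2 S"
  shows "inner_L2 S (\<lambda>x. f x + g x) h = inner_L2 S f h + inner_L2 S g h"
  using assms by (simp add: inner_L2_def distrib_right L2_mult_integrable)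

lemma inner_L2_diff_left:
  assumes "f \<in> L2 S" "g \<in> L2 S" "h \<in> L2 S"
  shows "inner_L2 S (\<lambda>x. f x - g x) h = inner_L2 S f h - inner_L2 S g h"
  using assms by (simp add: inner_L2_def left_diff_distrib L2_mult_integrable)

lemma inner_L2_diff_right:
  assumes "f \<in> L2 S" "g \<in> L2 S" "h \<in> L2 S"
  shows "inner_L2 S h (\<lambda>x. f x - g x) = inner_L2 S h f - inner_L2 S h g"
  using assms by (simp add: inner_L2_def right_diff_distrib L2_mult_integrable)

lemma inner_L2_add_right:
  assumes "f \<in> L2 S" "g \<in> L2 S" "h \<in> L2 S"
  shows "inner_L2 S h (\<lambda>x. f x + g x) = inner_L2 S h f + inner_L2 S h g"
  using assms by (simp add: inner_L2_def distrib_left L2_mult_integrable)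

lemma inner_L2_cmult_left: "inner_L2 S (\<lambda>x. c * f x) g = c * inner_L2 S f g"
  by (simp add: inner_L2_def mult.assoc)

lemma inner_L2_cmult_right: "inner_L2 S f (\<lambda>x. c * g x) = c * inner_L2 S f g"
  by (simp add: inner_L2_def mult.left_commute)

lemma inner_L2_nonneg: "0 \<le> inner_L2 S f f"
  by (simp add: inner_L2_def)

lemma norm_L2_nonneg: "0 \<le> norm_L2 S f"
  by (simp add: norm_L2_def inner_L2_nonneg)

lemma norm_L2_square: "(norm_L2 S f)\<^sup>2 = inner_L2 S f f"
  by (simp add: norm_L2_def inner_L2_nonneg)

lemma norm_L2_cong_AE:
  assumes "AE x in lebesgue_on S. f x = g x"
    and "f \<in> borel_measurable (lebesgue_on S)" "g \<in> borel_measurable (lebesgue_on S)"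
  shows "norm_L2 S f = norm_L2 S g"
  unfolding norm_L2_def using inner_L2_cong_AE[OF assms(1,1)] assms by simp

lemma norm_L2_cmult: "norm_L2 S (\<lambda>x. c * f x) = \<bar>c\<bar> * norm_L2 S f"
  by (simp add: norm_L2_def inner_L2_cmult_left inner_L2_cmult_right real_sqrt_mult
      flip: mult.assoc power2_eq_square)

lemma norm_L2_minus: "norm_L2 S (\<lambda>x. g x - f x) = norm_L2 S (\<lambda>x. f x - g x)"
  by (simp add: norm_L2_def inner_L2_def algebra_simps)

lemma inner_L2_diff_diff:
  assumes "f \<in> L2 S" "g \<in> L2 S"
  shows "inner_L2 S (\<lambda>x. f x - g x) (\<lambda>x. f x - g x)
       = inner_L2 S f f - 2 * inner_L2 S f g + inner_L2 S g g"
  using assms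
  by (simp add: inner_L2_diff_left inner_L2_diff_right L2_diff inner_L2_commute[of S g f])

lemma inner_L2_add_add:
  assumes "f \<in> L2 S" "g \<in> L2 S"
  shows "inner_L2 S (\<lambda>x. f x + g x) (\<lambda>x. f x + g x)
       = inner_L2 S f f + 2 * inner_L2 S f g + inner_L2 S g g"
  using assms
  by (simp add: inner_L2_add_left inner_L2_add_right L2_add inner_L2_commute[of S g f])

text \<open>\<open>norm_L2\<close> is only a seminorm on functions, so nothing is normalised: the
  quadratic form in \<open>s\<close> and \<open>t\<close> is nonnegative, and \<open>s = ?c\<close>,
  \<open>t = ?b\<close> makes it \<open>?c * (?a * ?c - ?b^2)\<close>.\<close>

lemma Cauchy_Schwarz_L2:
  assumes "f \<in> L2 S" "g \<in> L2 S"
  shows "\<bar>inner_L2 S f g\<bar> \<le> norm_L2 S f * norm_L2 S g"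
proof -
  let ?a = "inner_L2 S f f" and ?b = "inner_L2 S f g" and ?c = "inner_L2 S g g"
  have *: "0 \<le> s\<^sup>2 * ?a - 2 * (s * t) * ?b + t\<^sup>2 * ?c" for s t
  proof -
    have "0 \<le> inner_L2 S (\<lambda>x. s * f x - t * g x) (\<lambda>x. s * f x - t * g x)"
      by (rule inner_L2_nonneg)
    then show ?thesis
      using inner_L2_diff_diff[OF L2_cmult[OF assms(1), of s] L2_cmult[OF assms(2), of t]]
      by (simp add: inner_L2_cmult_left inner_L2_cmult_right power2_eq_square mult_ac)
  qed
  have "?b\<^sup>2 \<le> ?a * ?c"
  proof (cases "?c = 0")
    case True
    show ?thesis
    proof (cases "?b = 0")
      case False
      \<comment> \<open>With \<open>?c = 0\<close> and \<open>s = 1\<close> the form is affine in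
        \<open>t\<close>; this \<open>t\<close> makes it equal to -1, so \<open>?b\<close> must
        vanish.\<close>
      have "0 \<le> ?a - 2 * ((?a + 1) / (2 * ?b)) * ?b"
        using *[of 1 "(?a + 1) / (2 * ?b)"] True by simp
      with False show ?thesis by simp
    qed (simp add: inner_L2_nonneg)
  next
    case False
    then have "0 < ?c" using inner_L2_nonneg[of S g] by simp
    have "0 \<le> ?c\<^sup>2 * ?a - 2 * (?c * ?b) * ?b + ?b\<^sup>2 * ?c"
      by (rule *)
    then have "0 \<le> ?c * (?a * ?c - ?b\<^sup>2)"
      by (simp add: algebra_simps power2_eq_square)
    with \<open>0 < ?c\<close> show ?thesis by (simp add: zero_le_mult_iff)
  qed
  then have "sqrt (?b\<^sup>2) \<le> sqrt (?a * ?c)" by (rule real_sqrt_le_mono)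
  then show ?thesis by (simp only: norm_L2_def real_sqrt_mult real_sqrt_abs)
qed

lemma norm_L2_triangle:
  assumes "f \<in> L2 S" "g \<in> L2 S"
  shows "norm_L2 S (\<lambda>x. f x + g x) \<le> norm_L2 S f + norm_L2 S g"
proof (rule power2_le_imp_le)
  have "inner_L2 S f g \<le> norm_L2 S f * norm_L2 S g"
    using Cauchy_Schwarz_L2[OF assms] by simp
  then show "(norm_L2 S (\<lambda>x. f x + g x))\<^sup>2 \<le> (norm_L2 S f + norm_L2 S g)\<^sup>2"
    by (simp add: norm_L2_square inner_L2_add_add[OF assms] power2_sum)
qed (simp add: norm_L2_nonneg)

lemma norm_L2_le_diff:
  assumes "f \<in> L2 S" "g \<in> L2 S"
  shows "norm_L2 S f \<le> norm_L2 S g + norm_L2 S (\<lambda>x. f x - g x)"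
  using norm_L2_triangle[OF assms(2) L2_diff[OF assms]] by simp

lemma abs_norm_L2_diff_le:
  assumes "f \<in> L2 S" "g \<in> L2 S"
  shows "\<bar>norm_L2 S f - norm_L2 S g\<bar> \<le> norm_L2 S (\<lambda>x. f x - g x)"
  using norm_L2_le_diff[OF assms] norm_L2_le_diff[OF assms(2,1)] norm_L2_minus[of S g f] by simp

lemma tendsto_norm_L2:
  assumes "\<And>n. f n \<in> L2 S" "g \<in> L2 S" "((\<lambda>n. norm_L2 S (\<lambda>x. f n x - g x)) \<longlongrightarrow> 0) F"
  shows "((\<lambda>n. norm_L2 S (f n)) \<longlongrightarrow> norm_L2 S g) F"
proof -
  have "((\<lambda>n. norm_L2 S (f n) - norm_L2 S g) \<longlongrightarrow> 0) F"
    by (rule Lim_null_comparison[OF always_eventually assms(3)])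
      (simp add: abs_norm_L2_diff_le assms)
  then show ?thesis by (simp add: LIM_zero_iff)
qed

lemma tendsto_inner_L2:
  assumes "\<And>n. f n \<in> L2 S" "g \<in> L2 S" "((\<lambda>n. norm_L2 S (\<lambda>x. f n x - g x)) \<longlongrightarrow> 0) F" "h \<in> L2 S"
  shows "((\<lambda>n. inner_L2 S (f n) h) \<longlongrightarrow> inner_L2 S g h) F"
proof -
  have "((\<lambda>n. norm_L2 S (\<lambda>x. f n x - g x) * norm_L2 S h) \<longlongrightarrow> 0) F"
    using tendsto_mult_left_zero[OF assms(3)] .
  moreover have "norm (inner_L2 S (f n) h - inner_L2 S g h) \<le> norm_L2 S (\<lambda>x. f n x - g x) * norm_L2 S h" for n
    using Cauchy_Schwarz_L2[OF L2_diff[OF assms(1,2)] assms(4)] assms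
    by (simp add: inner_L2_diff_left)
  ultimately have "((\<lambda>n. inner_L2 S (f n) h - inner_L2 S g h) \<longlongrightarrow> 0) F"
    by (intro Lim_null_comparison[of "\<lambda>n. inner_L2 S (f n) h - inner_L2 S g h"] always_eventually) auto
  then show ?thesis by (simp add: LIM_zero_iff)
qed

lemma L2_bounded:
  assumes "S \<in> lmeasurable" "f \<in> borel_measurable (lebesgue_on S)"
    and "AE x in lebesgue_on S. \<bar>f x\<bar> \<le> B"
  shows "f \<in> L2 S"
proof -
  have "finite_measure (lebesgue_on S)"
    using assms(1) by (simp add: finite_measure_lebesgue_on)
  then have "(\<lambda>x. 1) \<in> L2 S"
    by (auto simp: L2_def finite_measure.integrable_const)
  from L2_bounded_mult[OF assms(2,3) this] show ?thesis by simp
qed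

lemma norm_L2_bounded:
  assumes "S \<in> lmeasurable" "f \<in> borel_measurable (lebesgue_on S)"
    and "AE x in lebesgue_on S. \<bar>f x\<bar> \<le> B" "0 \<le> B"
  shows "norm_L2 S f \<le> B * sqrt (measure lebesgue S)"
proof -
  have "finite_measure (lebesgue_on S)"
    using assms(1) by (simp add: finite_measure_lebesgue_on)
  then interpret finite_measure "lebesgue_on S" .
  have "inner_L2 S f f \<le> (\<integral>x. B\<^sup>2 \<partial>lebesgue_on S)"
    unfolding inner_L2_def
  proof (rule integral_mono_AE)
    show "AE x in lebesgue_on S. f x * f x \<le> B\<^sup>2"
      using assms(3) by eventually_elim (metis abs_ge_zero power2_abs power2_eq_square power_mono)
    show "integrable (lebesgue_on S) (\<lambda>x. f x * f x)"
      using L2_mult_integrable L2_bounded[OF assms(1-3)] by blast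
  qed simp
  also have "\<dots> = B\<^sup>2 * measure lebesgue S"
    using assms(1) by (simp add: measure_restrict_space fmeasurableD)
  finally have "sqrt (inner_L2 S f f) \<le> sqrt (B\<^sup>2 * measure lebesgue S)" by (rule real_sqrt_le_mono)
  then show ?thesis
    using assms(4) by (simp add: norm_L2_def real_sqrt_mult)
qed

text \<open>Cauchy-Schwarz against the constant 1, which is square integrable because
  \<open>S\<close> has finite measure.\<close>

lemma integral_le_norm_L2:
  assumes "S \<in> lmeasurable" "f \<in> L2 S"
  shows "integrable (lebesgue_on S) f" "(\<integral>x. \<bar>f x\<bar> \<partial>lebesgue_on S) \<le> sqrt (measure lebesgue S) * norm_L2 S f"
proof -
  have one: "(\<lambda>x. 1) \<in> L2 S"
    using assms(1) by (intro L2_bounded[where B = 1]) auto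
  show "integrable (lebesgue_on S) f"
    using L2_mult_integrable[OF one assms(2)] by simp
  have abs: "(\<lambda>x. \<bar>f x\<bar>) \<in> L2 S"
    using assms(2) by (auto simp: L2_def)
  have "norm_L2 S (\<lambda>x. 1) \<le> sqrt (measure lebesgue S)"
    using norm_L2_bounded[OF assms(1), of "\<lambda>x. 1" 1] by simp
  then have "norm_L2 S (\<lambda>x. 1) * norm_L2 S f \<le> sqrt (measure lebesgue S) * norm_L2 S f"
    by (simp add: mult_right_mono norm_L2_nonneg)
  with Cauchy_Schwarz_L2[OF one abs]
  show "(\<integral>x. \<bar>f x\<bar> \<partial>lebesgue_on S) \<le> sqrt (measure lebesgue S) * norm_L2 S f"
    by (simp add: inner_L2_def norm_L2_def)
qed

section \<open>Smooth functions and cutoffs\<close>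

text \<open>Asks for some derivative function instead of iterating \<open>deriv\<close>. Closure
  under sums, products and affine substitutions is then an induction in which the derivative is
  exhibited; with \<open>deriv\<close> each step would first have to compute it.\<close>

primrec differentiable_upto :: "nat \<Rightarrow> (real \<Rightarrow> real) \<Rightarrow> bool" where
  "differentiable_upto 0 f \<longleftrightarrow> True"
| "differentiable_upto (Suc n) f \<longleftrightarrow>
     (\<exists>f'. (\<forall>x. (f has_real_derivative f' x) (at x)) \<and> differentiable_upto n f')"

lemma differentiable_upto_SucI:
  "(\<And>x. (f has_real_derivative f' x) (at x)) \<Longrightarrow> differentiable_upto n f' \<Longrightarrow> differentiable_upto (Suc n) f"
  unfolding differentiable_upto.simps by (intro exI[of _ f'] conjI allI)

lemma differentiable_upto_iff:
  "differentiable_upto n f \<longleftrightarrow> (\<forall>k<n. (deriv ^^ k) f differentiable_on UNIV)"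
proof (induction n arbitrary: f)
  case (Suc n)
  have diff: "f differentiable_on UNIV \<longleftrightarrow> (\<forall>x. (f has_real_derivative deriv f x) (at x))"
    unfolding differentiable_on_def
    by (simp add: DERIV_deriv_iff_real_differentiable)
  have eq: "f' = deriv f" if "\<forall>x. (f has_real_derivative f' x) (at x)" for f'
  proof
    show "f' x = deriv f x" for x
      using DERIV_imp_deriv[OF that[rule_format]] by simp
  qed
  have "differentiable_upto (Suc n) f \<longleftrightarrow> f differentiable_on UNIV \<and> differentiable_upto n (deriv f)"
  proof
    assume "differentiable_upto (Suc n) f"
    then obtain f' where f': "\<forall>x. (f has_real_derivative f' x) (at x)" "differentiable_upto n f'"
      unfolding differentiable_upto.simps by (elim exE conjE)
    note e = eq[OF f'(1)]
    show "f differentiable_on UNIV \<and> differentiable_upto n (deriv f)"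
      unfolding diff using f'(1) f'(2) unfolding e by (rule conjI)
  next
    assume "f differentiable_on UNIV \<and> differentiable_upto n (deriv f)"
    then show "differentiable_upto (Suc n) f"
      unfolding diff by (intro differentiable_upto_SucI[of f "deriv f"]) simp_all
  qed
  also have "\<dots> \<longleftrightarrow> f differentiable_on UNIV \<and> (\<forall>k<n. (deriv ^^ Suc k) f differentiable_on UNIV)"
    unfolding Suc.IH by (simp only: funpow_Suc_right o_apply)
  also have "\<dots> \<longleftrightarrow> (\<forall>k<Suc n. (deriv ^^ k) f differentiable_on UNIV)"
    unfolding All_less_Suc2 funpow_0 ..
  finally show ?case .
qed simp

lemma smooth_iff: "smooth f \<longleftrightarrow> (\<forall>n. differentiable_upto n f)"
  unfolding smooth_def differentiable_upto_iff by blast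

lemma smooth_derivD:
  assumes "smooth f"
  shows "(f has_real_derivative deriv f x) (at x)" "smooth (deriv f)"
proof -
  have D: "\<exists>f'. (\<forall>x. (f has_real_derivative f' x) (at x)) \<and> differentiable_upto n f'" for n
    using assms by (simp add: smooth_iff flip: differentiable_upto.simps(2))
  have eq: "f' = deriv f" if "\<forall>x. (f has_real_derivative f' x) (at x)" for f'
  proof
    show "f' x = deriv f x" for x
      using DERIV_imp_deriv[OF that[rule_format]] by simp
  qed
  have D': "(\<forall>x. (f has_real_derivative deriv f x) (at x)) \<and> differentiable_upto n (deriv f)" for n
  proof -
    obtain f' where f': "\<forall>x. (f has_real_derivative f' x) (at x)" "differentiable_upto n f'"
      using D[of n] by (elim exE conjE)
    show ?thesis using f' unfolding eq[OF f'(1)] by (rule conjI)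
  qed
  then show "(f has_real_derivative deriv f x) (at x)" "smooth (deriv f)"
    unfolding smooth_iff by blast+
qed

lemma smoothI_deriv:
  assumes "\<And>x. (f has_real_derivative f' x) (at x)" "smooth f'"
  shows "smooth f"
  unfolding smooth_iff
proof
  fix n show "differentiable_upto n f"
    using assms(2) by (cases n) (auto intro: differentiable_upto_SucI[OF assms(1)] simp: smooth_iff simp del: differentiable_upto.simps(2))
qed

lemma smooth_continuous: "smooth f \<Longrightarrow> continuous_on A f"
  by (meson DERIV_isCont continuous_at_imp_continuous_on smooth_derivD(1))

lemma differentiable_upto_mono: "differentiable_upto (Suc n) f \<Longrightarrow> differentiable_upto n f"
  unfolding differentiable_upto_iff by auto

lemma differentiable_upto_add:
  "differentiable_upto n f \<Longrightarrow> differentiable_upto n g \<Longrightarrow> differentiable_upto n (\<lambda>x. f x + g x)"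
proof (induction n arbitrary: f g)
  case (Suc n)
  then obtain f' g' where "\<forall>x. (f has_real_derivative f' x) (at x)" "differentiable_upto n f'"
    "\<forall>x. (g has_real_derivative g' x) (at x)" "differentiable_upto n g'" by auto
  then show ?case
    using Suc.IH by (intro differentiable_upto_SucI[of _ "\<lambda>x. f' x + g' x"]) (auto intro!: derivative_eq_intros)
qed simp

lemma differentiable_upto_mult:
  "differentiable_upto n f \<Longrightarrow> differentiable_upto n g \<Longrightarrow> differentiable_upto n (\<lambda>x. f x * g x)"
proof (induction n arbitrary: f g)
  case (Suc n)
  then obtain f' g' where *: "\<forall>x. (f has_real_derivative f' x) (at x)" "differentiable_upto n f'"
    "\<forall>x. (g has_real_derivative g' x) (at x)" "differentiable_upto n g'" by auto
  have "differentiable_upto n f" "differentiable_upto n g"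
    by (rule differentiable_upto_mono[OF Suc.prems(1)], rule differentiable_upto_mono[OF Suc.prems(2)])
  with * have "differentiable_upto n (\<lambda>x. f' x * g x + f x * g' x)"
    by (intro differentiable_upto_add Suc.IH)
  moreover have "\<forall>x. ((\<lambda>x. f x * g x) has_real_derivative f' x * g x + f x * g' x) (at x)"
    using * by (auto intro!: derivative_eq_intros)
  ultimately show ?case by (intro differentiable_upto_SucI) auto
qed simp

lemma differentiable_upto_const: "differentiable_upto n (\<lambda>x. c)"
proof (induction n arbitrary: c)
  case (Suc n)
  show ?case by (rule differentiable_upto_SucI[OF _ Suc[of 0]]) simp
qed simp

lemma differentiable_upto_affine:
  "differentiable_upto n f \<Longrightarrow> differentiable_upto n (\<lambda>x. f (p * x + q))"
proof (induction n arbitrary: f)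
  case (Suc n)
  then obtain f' where *: "\<forall>x. (f has_real_derivative f' x) (at x)" "differentiable_upto n f'"
    by auto
  have "((\<lambda>x. f (p * x + q)) has_real_derivative f' (p * x + q) * p) (at x)" for x
    using *(1) by (intro DERIV_chain'[of "\<lambda>x. p * x + q" p x UNIV f]) (auto intro!: derivative_eq_intros)
  moreover have "differentiable_upto n (\<lambda>x. f' (p * x + q) * p)"
    using * Suc.IH by (intro differentiable_upto_mult differentiable_upto_const) auto
  ultimately show ?case by (rule differentiable_upto_SucI)
qed simp

lemma smooth_add: "smooth f \<Longrightarrow> smooth g \<Longrightarrow> smooth (\<lambda>x. f x + g x)"
  and smooth_mult: "smooth f \<Longrightarrow> smooth g \<Longrightarrow> smooth (\<lambda>x. f x * g x)"
  and smooth_const: "smooth (\<lambda>x. c)"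
  and smooth_affine: "smooth f \<Longrightarrow> smooth (\<lambda>x. f (p * x + q))"
  by (simp_all add: smooth_iff differentiable_upto_add differentiable_upto_mult
      differentiable_upto_const differentiable_upto_affine)

text \<open>The flat function exp(-1/x), extended by 0. The powers of \<open>1 / x\<close> are
  included because they make the family closed under differentiation up to linear combinations, so
  that smoothness follows by induction for all \<open>k\<close> at once.\<close>

definition flat_exp :: "nat \<Rightarrow> real \<Rightarrow> real" where
  "flat_exp k x = (if x > 0 then (1 / x) ^ k * exp (- 1 / x) else 0)"

lemma flat_exp_deriv:
  "(flat_exp k has_real_derivative flat_exp (k + 2) x - real k * flat_exp (k + 1) x) (at x)"
proof -
  consider "x > 0" | "x < 0" | "x = 0" by linarith
  then show ?thesis
  proof cases
    case 1
    let ?f = "\<lambda>x::real. (1 / x) ^ k * exp (- 1 / x)"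
    define u where "u = 1 / x"
    have "((\<lambda>u. u ^ k * exp (- u)) has_real_derivative (real k * u ^ (k - 1) - u ^ k) * exp (- u)) (at u)"
      by (auto intro!: derivative_eq_intros simp: algebra_simps)
    moreover have "((\<lambda>x. 1 / x) has_real_derivative - (u\<^sup>2)) (at x)"
      using 1 by (auto intro!: derivative_eq_intros simp: power2_eq_square u_def)
    ultimately have "((\<lambda>x. (1 / x) ^ k * exp (- (1 / x))) has_real_derivative
        ((real k * u ^ (k - 1) - u ^ k) * exp (- u)) * (- (u\<^sup>2))) (at x)"
      unfolding u_def by (intro DERIV_chain'[of "\<lambda>x. 1 / x"])
    moreover have "((real k * u ^ (k - 1) - u ^ k) * exp (- u)) * (- (u\<^sup>2)) =
        u ^ (k + 2) * exp (- u) - real k * (u ^ (k + 1) * exp (- u))"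
      by (cases k) (simp_all add: algebra_simps power2_eq_square)
    ultimately have "(?f has_real_derivative flat_exp (k + 2) x - real k * flat_exp (k + 1) x) (at x)"
      using 1 by (simp add: flat_exp_def u_def)
    then show ?thesis
      by (rule DERIV_cong_ev[THEN iffD1, rotated -1])
        (use 1 in \<open>auto simp: flat_exp_def eventually_nhds intro!: exI[of _ "{0<..}"]\<close>)
  next
    case 2
    have "((\<lambda>x. 0) has_real_derivative flat_exp (k + 2) x - real k * flat_exp (k + 1) x) (at x)"
      using 2 by (simp add: flat_exp_def)
    then show ?thesis
      by (rule DERIV_cong_ev[THEN iffD1, rotated -1])
        (use 2 in \<open>auto simp: flat_exp_def eventually_nhds intro!: exI[of _ "{..<0}"]\<close>)
  next
    case 3
    have "((\<lambda>h. flat_exp k h / h) \<longlongrightarrow> 0) (at 0)"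
    proof (rule filterlim_split_at)
      have "((\<lambda>h. flat_exp k h / h) \<longlongrightarrow> 0) (at_left (0::real)) \<longleftrightarrow> ((\<lambda>h. 0) \<longlongrightarrow> (0::real)) (at_left (0::real))"
        by (rule tendsto_cong) (auto simp: eventually_at_filter flat_exp_def)
      then show "((\<lambda>h. flat_exp k h / h) \<longlongrightarrow> 0) (at_left (0::real))" by simp
      \<comment> \<open>At 0 the difference quotient is u^(k+1) / exp u with u = 1/h, and the
        exponential wins as u tends to infinity.\<close>
      have "((\<lambda>h. (inverse h) ^ Suc k / exp (inverse h)) \<longlongrightarrow> 0) (at_right (0::real))"
        by (rule filterlim_compose[OF tendsto_power_div_exp_0 filterlim_inverse_at_top_right])
      moreover have "((\<lambda>h. flat_exp k h / h) \<longlongrightarrow> 0) (at_right (0::real)) \<longleftrightarrow>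
          ((\<lambda>h. (inverse h) ^ Suc k / exp (inverse h)) \<longlongrightarrow> 0) (at_right (0::real))"
        by (rule tendsto_cong)
          (auto simp: eventually_at_filter flat_exp_def exp_minus field_simps intro!: always_eventually)
      ultimately show "((\<lambda>h. flat_exp k h / h) \<longlongrightarrow> 0) (at_right (0::real))" by simp
    qed
    then show ?thesis
      using 3 by (simp add: DERIV_def) (simp add: flat_exp_def)
  qed
qed

lemma smooth_flat_exp: "smooth (flat_exp k)"
proof -
  have "differentiable_upto n (flat_exp k)" for n
  proof (induction n arbitrary: k)
    case (Suc n)
    have "differentiable_upto n (\<lambda>x. flat_exp (k + 2) x + (- real k) * flat_exp (k + 1) x)"
      by (intro differentiable_upto_add differentiable_upto_mult differentiable_upto_const Suc)
    moreover have "\<forall>x. (flat_exp k has_real_derivative flat_exp (k + 2) x + (- real k) * flat_exp (k + 1) x) (at x)"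
      using flat_exp_deriv[of k] by simp
    ultimately show ?case
      unfolding differentiable_upto.simps by (intro exI conjI)
  qed simp
  then show ?thesis by (simp add: smooth_iff)
qed

text \<open>\<open>n\<close> is a steepness: the support stays in \<open>{a..b}\<close> and the
  values in [0,1], while the functions tend pointwise to the indicator of the open interval.
  Dominated convergence thus turns statements about test functions into statements about integrals
  over intervals.\<close>

definition bump :: "real \<Rightarrow> real \<Rightarrow> nat \<Rightarrow> real \<Rightarrow> real" where
  "bump a b n x = flat_exp 0 (real (Suc n) * (x - a)) * flat_exp 0 (real (Suc n) * (b - x))"

lemma smooth_bump: "smooth (bump a b n)"
proof -
  have "smooth (\<lambda>x. flat_exp 0 (real (Suc n) * x + - real (Suc n) * a) *
      flat_exp 0 (- real (Suc n) * x + real (Suc n) * b))"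
    by (intro smooth_mult smooth_affine smooth_flat_exp)
  moreover have "bump a b n = (\<lambda>x. flat_exp 0 (real (Suc n) * x + - real (Suc n) * a) *
      flat_exp 0 (- real (Suc n) * x + real (Suc n) * b))"
    by (simp add: bump_def fun_eq_iff algebra_simps)
  ultimately show ?thesis by simp
qed

lemma flat_exp_0_bounds: "0 \<le> flat_exp 0 x" "flat_exp 0 x \<le> 1"
  by (auto simp: flat_exp_def)

lemma bump_bounds: "0 \<le> bump a b n x" "bump a b n x \<le> 1"
  by (auto simp: bump_def flat_exp_0_bounds intro: mult_le_one)

lemma bump_pos: "a < x \<Longrightarrow> x < b \<Longrightarrow> 0 < bump a b n x"
  by (simp add: bump_def flat_exp_def)

lemma bump_outside: "x \<notin> {a<..<b} \<Longrightarrow> bump a b n x = 0"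
  by (auto simp: bump_def flat_exp_def zero_less_mult_iff)

lemma flat_exp_0_tendsto: "x > 0 \<Longrightarrow> (\<lambda>n. flat_exp 0 (real (Suc n) * x)) \<longlonglongrightarrow> 1"
proof -
  assume "x > 0"
  have "(\<lambda>n. exp (- ((1 / x) * inverse (real (Suc n))))) \<longlonglongrightarrow> exp (- ((1 / x) * 0))"
    by (intro tendsto_intros LIMSEQ_inverse_real_of_nat)
  moreover have "flat_exp 0 (real (Suc n) * x) = exp (- ((1 / x) * inverse (real (Suc n))))" for n
    using \<open>x > 0\<close> by (simp add: flat_exp_def zero_less_mult_iff field_simps add_pos_nonneg)
  ultimately show ?thesis by simp
qed

lemma bump_tendsto: "(\<lambda>n. bump a b n x) \<longlonglongrightarrow> indicat_real {a<..<b} x"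
proof (cases "x \<in> {a<..<b}")
  case True
  then show ?thesis
    using tendsto_mult[OF flat_exp_0_tendsto[of "x - a"] flat_exp_0_tendsto[of "b - x"]]
    by (simp add: bump_def)
qed (simp add: bump_outside)

section \<open>Test functions with compact support and their supporting intervals\<close>

lemma Cc_infI:
  assumes "smooth f" "\<And>x. x \<notin> {a..b} \<Longrightarrow> f x = 0" "{a..b} \<subseteq> S"
  shows "f \<in> Cc_inf S"
proof -
  have "closure {x. f x \<noteq> 0} \<subseteq> {a..b}"
  proof (rule closure_minimal)
    show "{x. f x \<noteq> 0} \<subseteq> {a..b}" using assms(2) by blast
  qed simp
  moreover have "compact (closure {x. f x \<noteq> 0})"
    using calculation by (meson bounded_closed_interval bounded_subset closed_closure compact_eq_bounded_closed)
  ultimately show ?thesis using assms by (auto simp: Cc_inf_def)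
qed

lemma bump_Cc_inf: "{a..b} \<subseteq> S \<Longrightarrow> bump a b n \<in> Cc_inf S"
  by (rule Cc_infI[OF smooth_bump]) (auto intro!: bump_outside)

text \<open>The support is compact and \<open>S\<close> is open, so the interval spanned by the
  support can be enlarged a little inside \<open>S\<close>. Hence the function already vanishes at
  the end points \<open>a\<close> and \<open>b\<close>, as integration by parts requires.\<close>

lemma Cc_inf_support:
  assumes "f \<in> Cc_inf S" "open S" "is_interval S" "S \<noteq> {}"
  obtains a b where "a < b" "{a..b} \<subseteq> S" "\<And>x. x \<notin> {a<..<b} \<Longrightarrow> f x = 0"
proof -
  let ?K = "closure {x. f x \<noteq> 0}"
  obtain p where p: "p \<in> S" using assms by auto
  \<comment> \<open>The extra point keeps the set nonempty when \<open>f\<close> is the zero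
    function.\<close>
  let ?L = "insert p ?K"
  have L: "compact ?L" "?L \<subseteq> S" "?L \<noteq> {}"
    using assms p by (auto simp: Cc_inf_def)
  obtain l where l: "l \<in> ?L" "\<And>x. x \<in> ?L \<Longrightarrow> l \<le> x"
    using compact_attains_inf[OF L(1,3)] by blast
  obtain u where u: "u \<in> ?L" "\<And>x. x \<in> ?L \<Longrightarrow> x \<le> u"
    using compact_attains_sup[OF L(1,3)] by blast
  obtain d1 where d1: "d1 > 0" "cball l d1 \<subseteq> S" using l L assms(2) open_contains_cball by blast
  obtain d2 where d2: "d2 > 0" "cball u d2 \<subseteq> S" using u L assms(2) open_contains_cball by blast
  have mem: "l - d1 \<in> S" "u + d2 \<in> S"
    using d1 d2 by (auto simp: subset_iff dist_real_def)
  have "l \<le> u" using l u by auto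
  show ?thesis
  proof
    show "l - d1 < u + d2" using \<open>l \<le> u\<close> d1 d2 by simp
    show "{l - d1..u + d2} \<subseteq> S"
    proof
      fix x assume "x \<in> {l - d1..u + d2}"
      then show "x \<in> S"
        using mem assms(3)[unfolded is_interval_1, rule_format, of "l - d1" "u + d2" x] by simp
    qed
    fix x assume "x \<notin> {l - d1<..<u + d2}"
    then have "x \<notin> ?L" using l(2)[of x] u(2)[of x] d1 d2 by auto
    then show "f x = 0" using closure_subset[of "{x. f x \<noteq> 0}"] by blast
  qed
qed

lemma deriv_eq_0_outside:
  assumes "\<And>x. x \<notin> {a..b} \<Longrightarrow> f x = 0" "x \<notin> {a..b}"
  shows "deriv f x = (0::real)"
proof (rule DERIV_imp_deriv)
  have "((\<lambda>x. 0) has_real_derivative 0) (at x)" by simp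
  then show "(f has_real_derivative 0) (at x)"
    by (rule DERIV_cong_ev[THEN iffD1, rotated -1])
      (use assms in \<open>auto simp: eventually_nhds intro!: exI[of _ "- {a..b}"]\<close>)
qed

section \<open>Primitives of locally integrable functions\<close>

text \<open>Pi-lambda argument starting from half-lines. Complements are immediate from the limit
  over the whole line; for countable disjoint unions the common majorant \<open>w\<close> allows the
  limit to be exchanged with the series, by Tannery's theorem.\<close>

lemma set_integral_limit_borel:
  fixes f :: "nat \<Rightarrow> real \<Rightarrow> real"
  assumes f: "\<And>k. integrable lebesgue (f k)" and g: "integrable lebesgue g"
    and w: "integrable lebesgue w"
    and fw: "\<And>k. AE x in lebesgue. \<bar>f k x\<bar> \<le> w x"
    and lim: "\<And>d. (\<lambda>k. LINT x:{..d}|lebesgue. f k x) \<longlonglongrightarrow> (LINT x:{..d}|lebesgue. g x)"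
    and lim_UNIV: "(\<lambda>k. LINT x|lebesgue. f k x) \<longlonglongrightarrow> (LINT x|lebesgue. g x)"
    and E: "E \<in> sets borel"
  shows "(\<lambda>k. LINT x:E|lebesgue. f k x) \<longlonglongrightarrow> (LINT x:E|lebesgue. g x)"
proof -
  have E': "E \<in> sigma_sets UNIV (range atMost)"
    using E by (subst (asm) borel_eq_atMost) simp
  have leb: "A \<in> sets lebesgue" if "A \<in> sigma_sets UNIV (range (atMost :: real \<Rightarrow> _))" for A
  proof -
    have "A \<in> sets borel" using that by (subst borel_eq_atMost) simp
    then show ?thesis by simp
  qed
  have si: "set_integrable lebesgue A h" if "A \<in> sets lebesgue" "integrable lebesgue h" for A and h :: "real \<Rightarrow> real"
    unfolding set_integrable_def using integrable_mult_indicator[OF that] .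
  have w0: "AE x in lebesgue. 0 \<le> w x"
    using fw[of 0] by eventually_elim simp
  have stable: "Int_stable (range (atMost :: real \<Rightarrow> _))"
    by (auto simp: Int_stable_def)
  have Pow: "range atMost \<subseteq> Pow (UNIV :: real set)" by simp
  from stable Pow E' show ?thesis
  proof (induction E rule: sigma_sets_induct_disjoint)
    case (basic A)
    then show ?case using lim by auto
  next
    case empty
    show ?case by (simp add: set_lebesgue_integral_def)
  next
    case (compl A)
    have *: "(LINT x:UNIV - A|lebesgue. h x) = (LINT x|lebesgue. h x) - (LINT x:A|lebesgue. h x)"
      if "integrable lebesgue h" for h :: "real \<Rightarrow> real"
    proof -
      have "(LINT x:UNIV - A|lebesgue. h x) = (LINT x|lebesgue. h x - indicat_real A x * h x)"
        unfolding set_lebesgue_integral_def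
        by (rule Bochner_Integration.integral_cong) (auto simp: indicator_def)
      also have "\<dots> = (LINT x|lebesgue. h x) - (LINT x:A|lebesgue. h x)"
        using that integrable_mult_indicator[OF leb[OF compl(1)] that]
        by (simp add: set_lebesgue_integral_def)
      finally show ?thesis .
    qed
    show ?case unfolding *[OF f] *[OF g] by (intro tendsto_diff lim_UNIV compl)
  next
    case (union A)
    have A: "A i \<in> sets lebesgue" for i using union leb by auto
    have UA: "(\<Union>i. A i) \<in> sets lebesgue" using A by auto
    have cadd: "(LINT x:(\<Union>i. A i)|lebesgue. h x) = (\<Sum>i. LINT x:A i|lebesgue. h x)"
      if "integrable lebesgue h" for h :: "real \<Rightarrow> real"
      by (rule lebesgue_integral_countable_add[OF A])
        (use union(1) si[OF UA that] in \<open>auto simp: disjoint_family_on_def\<close>)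
    let ?M = "\<lambda>i. LINT x:A i|lebesgue. w x"
    have le: "\<bar>LINT x:A i|lebesgue. f k x\<bar> \<le> ?M i" for i k
    proof -
      have "\<bar>LINT x:A i|lebesgue. f k x\<bar> \<le> (LINT x:A i|lebesgue. \<bar>f k x\<bar>)"
        using set_integral_norm_bound[OF si[OF A f], of i k] by simp
      also have "\<dots> \<le> ?M i"
        unfolding set_lebesgue_integral_def
      proof (rule integral_mono_AE)
        show "AE x in lebesgue. indicat_real (A i) x *\<^sub>R \<bar>f k x\<bar> \<le> indicat_real (A i) x *\<^sub>R w x"
          using fw[of k] by eventually_elim (auto simp: indicator_def)
      qed (use integrable_mult_indicator[OF A integrable_abs[OF f]] integrable_mult_indicator[OF A w] in auto)
      finally show ?thesis .
    qed
    \<comment> \<open>The masses of \<open>w\<close> on disjoint sets add up to at most its total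
      mass, which gives the summable majorant of the series.\<close>
    have "summable ?M"
    proof (rule summableI_nonneg_bounded)
      fix i show "0 \<le> ?M i"
        unfolding set_lebesgue_integral_def
        by (rule integral_nonneg_AE, use w0 in eventually_elim) simp
    next
      fix n
      have "(\<Sum>i<n. ?M i) = (LINT x|lebesgue. (\<Sum>i<n. indicat_real (A i) x) * w x)"
        unfolding set_lebesgue_integral_def
        by (subst Bochner_Integration.integral_sum[symmetric])
          (use integrable_mult_indicator[OF A w] in \<open>auto simp: sum_distrib_right\<close>)
      also have "\<dots> = (LINT x:(\<Union>i<n. A i)|lebesgue. w x)"
        unfolding set_lebesgue_integral_def
        by (subst indicator_UN_disjoint) (use union(1) in \<open>auto simp: disjoint_family_on_def\<close>)
      also have "\<dots> \<le> (LINT x|lebesgue. w x)"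
        unfolding set_lebesgue_integral_def
      proof (rule integral_mono_AE)
        show "integrable lebesgue (\<lambda>x. indicat_real (\<Union>i<n. A i) x *\<^sub>R w x)"
          using A by (intro integrable_mult_indicator w) auto
        show "AE x in lebesgue. indicat_real (\<Union>i<n. A i) x *\<^sub>R w x \<le> w x"
          using w0 by eventually_elim (auto simp: indicator_def)
      qed fact
      finally show "(\<Sum>i<n. ?M i) \<le> (LINT x|lebesgue. w x)" .
    qed
    with tannerys_theorem[of "\<lambda>i k. LINT x:A i|lebesgue. f k x" "\<lambda>i. LINT x:A i|lebesgue. g x" sequentially ?M]
    have "(\<lambda>k. \<Sum>i. LINT x:A i|lebesgue. f k x) \<longlonglongrightarrow> (\<Sum>i. LINT x:A i|lebesgue. g x)"
      using union(3) le by (auto simp: always_eventually)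
    then show ?case unfolding cadd[OF f] cadd[OF g] .
  qed
qed

lemma AE_eq_0_if_integrals_atMost:
  fixes h :: "real \<Rightarrow> real"
  assumes h: "integrable lebesgue h"
    and 0: "\<And>d. (LINT x:{..d}|lebesgue. h x) = 0" "(LINT x|lebesgue. h x) = 0"
  shows "AE x in lebesgue. h x = 0"
proof -
  have E0: "(LINT x:E|lebesgue. h x) = 0" if "E \<in> sets borel" for E
  proof -
    \<comment> \<open>The convergence lemma with the zero sequence and with \<open>h\<close> as the
      limit: vanishing on half-lines spreads to all Borel sets.\<close>
    have "(\<lambda>k::nat. LINT x:E|lebesgue. 0 :: real) \<longlonglongrightarrow> (LINT x:E|lebesgue. h x)"
      by (rule set_integral_limit_borel[of _ _ "\<lambda>x. \<bar>h x\<bar>"]) (use h 0 that in auto)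
    then show ?thesis by (simp add: LIMSEQ_const_iff)
  qed
  \<comment> \<open>\<open>h\<close> is only Lebesgue measurable, so the sets where it is positive
    or negative are read off from a Borel representative.\<close>
  obtain h' where h': "h' \<in> borel_measurable borel" "AE x in lebesgue. h x = h' x"
    using completion_ex_borel_measurable_real[of h lborel] h by (auto intro: AE_completion)
  have pos: "AE x in lebesgue. c * h x \<le> 0" if "c = 1 \<or> c = -1" for c
  proof -
    let ?E = "{x. c * h' x > 0}"
    have E: "?E \<in> sets borel"
    proof -
      have "{x \<in> space borel. 0 < c * h' x} \<in> sets borel"
        using h'(1) by measurable
      then show ?thesis by simp
    qed
    have int: "integrable lebesgue (\<lambda>x. indicat_real ?E x * (c * h x))"
      using integrable_mult_indicator[OF _ integrable_mult_right[OF h, of c], of ?E] E by simp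
    have "AE x in lebesgue. 0 \<le> indicat_real ?E x * (c * h x)"
      using h'(2) by eventually_elim (auto simp: indicator_def)
    moreover have "(LINT x|lebesgue. indicat_real ?E x * (c * h x)) = c * (LINT x:?E|lebesgue. h x)"
      by (simp add: set_lebesgue_integral_def mult.left_commute)
    ultimately have "AE x in lebesgue. indicat_real ?E x * (c * h x) = 0"
      using integral_nonneg_eq_0_iff_AE[OF int] E0[OF E] by simp
    with h'(2) show ?thesis
      by eventually_elim (auto simp: indicator_def split: if_splits)
  qed
  from pos[of 1] pos[of "-1"] show ?thesis by (auto elim: eventually_elim2)
qed

section \<open>Absolutely continuous functions and their product rule\<close>

definition locally_integrable :: "real set \<Rightarrow> (real \<Rightarrow> real) \<Rightarrow> bool" where
  "locally_integrable S f \<longleftrightarrow> (\<forall>a b. {a..b} \<subseteq> S \<longrightarrow> f absolutely_integrable_on {a..b})"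

text \<open>\<open>F\<close> is locally absolutely continuous with derivative \<open>f\<close>
  almost everywhere. Stating this through increments keeps pointwise derivatives out of the product
  rule and of integration by parts.\<close>

definition is_primitive :: "real set \<Rightarrow> (real \<Rightarrow> real) \<Rightarrow> (real \<Rightarrow> real) \<Rightarrow> bool" where
  "is_primitive S F f \<longleftrightarrow> locally_integrable S f \<and>
     (\<forall>a b. a \<le> b \<longrightarrow> {a..b} \<subseteq> S \<longrightarrow> F b - F a = integral {a..b} f)"

lemma is_primitiveD:
  "is_primitive S F f \<Longrightarrow> a \<le> b \<Longrightarrow> {a..b} \<subseteq> S \<Longrightarrow> F b - F a = integral {a..b} f"
  "is_primitive S F f \<Longrightarrow> {a..b} \<subseteq> S \<Longrightarrow> f absolutely_integrable_on {a..b}"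
  by (auto simp: is_primitive_def locally_integrable_def)

lemma is_primitive_continuous:
  assumes "is_primitive S F f" "{a..b} \<subseteq> S"
  shows "continuous_on {a..b} F"
proof (cases "a \<le> b")
  case True
  have "continuous_on {a..b} (\<lambda>x. F a + integral {a..x} f)"
    using is_primitiveD(2)[OF assms]
    by (intro continuous_intros indefinite_integral_continuous_1 set_lebesgue_integral_eq_integral)
  moreover have "F x = F a + integral {a..x} f" if "x \<in> {a..b}" for x
  proof -
    have "{a..x} \<subseteq> S" using that assms(2) by fastforce
    then show ?thesis using is_primitiveD(1)[OF assms(1), of a x] that by simp
  qed
  ultimately show ?thesis by (rule continuous_on_eq[OF _ sym])
qed simp

lemma absolutely_integrable_continuous_mult:
  fixes f p :: "real \<Rightarrow> real"
  assumes "f absolutely_integrable_on {a..b}" "continuous_on {a..b} p"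
  shows "(\<lambda>x. f x * p x) absolutely_integrable_on {a..b}"
proof -
  have "bounded (p ` {a..b})"
    using assms(2) by (intro compact_imp_bounded compact_continuous_image) auto
  moreover have "p \<in> borel_measurable (lebesgue_on {a..b})"
    using assms(2) by (intro continuous_imp_measurable_on_sets_lebesgue) auto
  ultimately have "(\<lambda>x. p x * f x) absolutely_integrable_on {a..b}"
    using assms(1) by (intro absolutely_integrable_bounded_measurable_product_real) auto
  then show ?thesis by (simp add: mult.commute)
qed

text \<open>Stands in for a derivative of \<open>D\<close> that vanishes almost everywhere:
  \<open>m\<close> acts as an additive mass, so over a fine partition the bounds telescope to
  \<open>e * (m b - m a)\<close>, with \<open>e\<close> arbitrary.\<close>

lemma constant_if_small_increments:
  fixes D m :: "real \<Rightarrow> real"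
  assumes "a \<le> b"
    and small: "\<And>e. e > 0 \<Longrightarrow> \<exists>d>0. \<forall>s t. a \<le> s \<longrightarrow> s \<le> t \<longrightarrow> t \<le> b \<longrightarrow> t - s < d \<longrightarrow> \<bar>D t - D s\<bar> \<le> e * (m t - m s)"
  shows "D b = D a"
proof -
  have le: "\<bar>D b - D a\<bar> \<le> e * (m b - m a)" if e: "e > 0" for e
  proof -
    obtain d where d: "d > 0" "\<And>s t. a \<le> s \<Longrightarrow> s \<le> t \<Longrightarrow> t \<le> b \<Longrightarrow> t - s < d \<Longrightarrow> \<bar>D t - D s\<bar> \<le> e * (m t - m s)"
      using small[OF e] by blast
    obtain n where n: "(b - a) / d < real n" using reals_Archimedean2 by blast
    have "0 \<le> (b - a) / d" using assms(1) d(1) by simp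
    then have n0: "0 < real n" using n by linarith
    define x where "x i = a + real i * ((b - a) / real n)" for i
    have x0: "x 0 = a" "x n = b" using n0 by (auto simp: x_def)
    have step: "x (Suc i) - x i = (b - a) / real n" for i by (simp add: x_def algebra_simps flip: add_divide_distrib diff_divide_distrib)
    have sd: "(b - a) / real n < d" using n n0 d(1) by (simp add: field_simps)
    have nn: "0 \<le> (b - a) / real n" using assms(1) by simp
    have bnd: "a \<le> x i \<and> x i \<le> b" if "i \<le> n" for i
    proof -
      have "real i * ((b - a) / real n) \<le> real n * ((b - a) / real n)"
        using that nn by (intro mult_right_mono) auto
      moreover have "0 \<le> real i * ((b - a) / real n)" using nn by (intro mult_nonneg_nonneg) auto
      ultimately show ?thesis using n0 by (simp add: x_def)
    qed
    have "\<bar>D b - D a\<bar> = \<bar>\<Sum>i<n. D (x (Suc i)) - D (x i)\<bar>"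
      using x0 by (simp add: sum_lessThan_telescope[of "\<lambda>i. D (x i)"])
    also have "\<dots> \<le> (\<Sum>i<n. \<bar>D (x (Suc i)) - D (x i)\<bar>)" by (rule sum_abs)
    also have "\<dots> \<le> (\<Sum>i<n. e * (m (x (Suc i)) - m (x i)))"
    proof (rule sum_mono)
      fix i assume "i \<in> {..<n}"
      then show "\<bar>D (x (Suc i)) - D (x i)\<bar> \<le> e * (m (x (Suc i)) - m (x i))"
        using bnd[of i] bnd[of "Suc i"] step[of i] sd nn by (intro d(2)) (simp, linarith, simp, linarith)
    qed
    also have "\<dots> = e * (m b - m a)"
      using x0 by (simp add: sum_lessThan_telescope[of "\<lambda>i. m (x i)"] flip: sum_distrib_left)
    finally show ?thesis .
  qed
  have m: "0 \<le> m b - m a" using le[of 1] by simp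
  have "\<bar>D b - D a\<bar> \<le> e" if "e > 0" for e
  proof -
    \<comment> \<open>The \<open>+ 1\<close> covers the case that \<open>m\<close> does not
      grow.\<close>
    have "\<bar>D b - D a\<bar> \<le> e / (m b - m a + 1) * (m b - m a)"
      using that m by (intro le) (simp add: add_nonneg_pos)
    also have "\<dots> \<le> e * 1"
      using that m by (simp add: divide_simps mult_left_mono)
    finally show ?thesis by simp
  qed
  then show ?thesis by (metis abs_le_zero_iff field_le_epsilon add_0 right_minus_eq)
qed

text \<open>The defect, \<open>F * G\<close> minus the integral of the claimed derivative, has small
  increments: on a short interval \<open>F\<close> and \<open>G\<close> oscillate by at most
  \<open>e\<close>, and this is multiplied by the mass of
  \<open>\<bar>f\<bar> + \<bar>g\<bar>\<close>.\<close>

lemma is_primitive_mult: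
  assumes F: "is_primitive S F f" and G: "is_primitive S G g"
  shows "is_primitive S (\<lambda>x. F x * G x) (\<lambda>x. f x * G x + g x * F x)"
  unfolding is_primitive_def locally_integrable_def
proof safe
  fix a b :: real assume S: "{a..b} \<subseteq> S"
  have cF: "continuous_on {a..b} F" and cG: "continuous_on {a..b} G"
    using is_primitive_continuous F G S by blast+
  have f: "f absolutely_integrable_on {a..b}" and g: "g absolutely_integrable_on {a..b}"
    using is_primitiveD F G S by blast+
  show ai: "(\<lambda>x. f x * G x + g x * F x) absolutely_integrable_on {a..b}"
    by (intro set_integral_add absolutely_integrable_continuous_mult f g cF cG)
  assume "a \<le> b"
  let ?p = "\<lambda>x. f x * G x + g x * F x"
  let ?D = "\<lambda>x. F x * G x - integral {a..x} ?p"
  let ?m = "\<lambda>x. integral {a..x} (\<lambda>x. \<bar>f x\<bar> + \<bar>g x\<bar>)"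
  have ai2: "(\<lambda>x. \<bar>f x\<bar> + \<bar>g x\<bar>) absolutely_integrable_on {a..b}"
    using f g by (intro set_integral_add) (auto dest: set_integrable_abs)
  have "?D b = ?D a"
  proof (rule constant_if_small_increments[OF \<open>a \<le> b\<close>])
    fix e :: real assume "e > 0"
    obtain d1 where d1: "d1 > 0" "\<And>x y. x \<in> {a..b} \<Longrightarrow> y \<in> {a..b} \<Longrightarrow> dist x y < d1 \<Longrightarrow> dist (F x) (F y) < e"
      using compact_uniformly_continuous[OF cF compact_Icc] \<open>e > 0\<close>
      unfolding uniformly_continuous_on_def by metis
    obtain d2 where d2: "d2 > 0" "\<And>x y. x \<in> {a..b} \<Longrightarrow> y \<in> {a..b} \<Longrightarrow> dist x y < d2 \<Longrightarrow> dist (G x) (G y) < e"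
      using compact_uniformly_continuous[OF cG compact_Icc] \<open>e > 0\<close>
      unfolding uniformly_continuous_on_def by metis
    show "\<exists>d>0. \<forall>s t. a \<le> s \<longrightarrow> s \<le> t \<longrightarrow> t \<le> b \<longrightarrow> t - s < d \<longrightarrow> \<bar>?D t - ?D s\<bar> \<le> e * (?m t - ?m s)"
    proof (intro exI[of _ "min d1 d2"] conjI allI impI)
      show "0 < min d1 d2" using d1 d2 by simp
      fix s t assume st: "a \<le> s" "s \<le> t" "t \<le> b" "t - s < min d1 d2"
      have sub: "{s..t} \<subseteq> {a..b}" "{a..t} \<subseteq> {a..b}" using st by auto
      have int: "q integrable_on {s..t}" "q integrable_on {a..t}" if "q absolutely_integrable_on {a..b}" for q :: "real \<Rightarrow> real"
        using absolutely_integrable_on_subinterval[OF that] sub set_lebesgue_integral_eq_integral(1) by blast+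
      have diff: "integral {a..t} q - integral {a..s} q = integral {s..t} q"
        if "q absolutely_integrable_on {a..b}" for q :: "real \<Rightarrow> real"
        using Henstock_Kurzweil_Integration.integral_combine[OF st(1,2) int(2)[OF that]] by simp
      \<comment> \<open>Freezing \<open>F\<close> at the right end and \<open>G\<close> at the left
        end gives the exact increment, with no quadratic remainder.\<close>
      have "F t * G t - F s * G s = F t * (G t - G s) + G s * (F t - F s)" by (simp add: algebra_simps)
      also have "\<dots> = F t * integral {s..t} g + G s * integral {s..t} f"
        using is_primitiveD(1)[OF F, of s t] is_primitiveD(1)[OF G, of s t] st(2) subset_trans[OF sub(1) S]
        by simp
      also have "\<dots> = integral {s..t} (\<lambda>r. F t * g r + G s * f r)"
        by (subst Henstock_Kurzweil_Integration.integral_add)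
          (auto intro!: integrable_on_cmult_left int f g)
      finally have "?D t - ?D s = integral {s..t} (\<lambda>r. F t * g r + G s * f r) - integral {s..t} ?p"
        using diff[OF ai] by simp
      also have "\<dots> = integral {s..t} (\<lambda>r. F t * g r + G s * f r - ?p r)"
        by (subst Henstock_Kurzweil_Integration.integral_diff)
          (auto intro!: Henstock_Kurzweil_Integration.integrable_add integrable_on_cmult_left int f g ai)
      finally have eq: "?D t - ?D s = integral {s..t} (\<lambda>r. F t * g r + G s * f r - ?p r)" .
      have "norm (integral {s..t} (\<lambda>r. F t * g r + G s * f r - ?p r)) \<le> integral {s..t} (\<lambda>r. e * (\<bar>f r\<bar> + \<bar>g r\<bar>))"
      proof (rule integral_norm_bound_integral)
        show "(\<lambda>r. F t * g r + G s * f r - ?p r) integrable_on {s..t}"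
          by (rule Henstock_Kurzweil_Integration.integrable_diff[OF _ int(1)[OF ai]])
            (auto intro!: Henstock_Kurzweil_Integration.integrable_add integrable_on_cmult_left int f g)
        show "(\<lambda>r. e * (\<bar>f r\<bar> + \<bar>g r\<bar>)) integrable_on {s..t}"
          using integrable_on_cmult_left[OF int(1)[OF ai2], of e] by simp
        fix r assume r: "r \<in> {s..t}"
        have 1: "\<bar>F t - F r\<bar> \<le> e" "\<bar>G s - G r\<bar> \<le> e"
          using d1(2)[of t r] d2(2)[of s r] r st by (auto simp: dist_real_def)
        have "F t * g r + G s * f r - ?p r = (F t - F r) * g r + (G s - G r) * f r"
          by (simp add: algebra_simps)
        also have "\<bar>\<dots>\<bar> \<le> \<bar>F t - F r\<bar> * \<bar>g r\<bar> + \<bar>G s - G r\<bar> * \<bar>f r\<bar>"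
          by (metis abs_mult abs_triangle_ineq)
        also have "\<dots> \<le> e * \<bar>g r\<bar> + e * \<bar>f r\<bar>"
          using 1 by (intro add_mono mult_right_mono) auto
        finally show "norm (F t * g r + G s * f r - ?p r) \<le> e * (\<bar>f r\<bar> + \<bar>g r\<bar>)"
          by (simp add: algebra_simps)
      qed
      then show "\<bar>?D t - ?D s\<bar> \<le> e * (?m t - ?m s)"
        using diff[OF ai2] by (simp add: eq)
    qed
  qed
  then show "F b * G b - F a * G a = integral {a..b} ?p" by simp
qed

section \<open>Weak derivatives\<close>

lemma is_primitive_smooth: "smooth \<phi> \<Longrightarrow> is_primitive S \<phi> (deriv \<phi>)"
  unfolding is_primitive_def locally_integrable_def
proof safe
  fix a b assume s: "smooth \<phi>"
  show "deriv \<phi> absolutely_integrable_on {a..b}"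
    using s by (intro absolutely_integrable_continuous_real smooth_continuous smooth_derivD(2))
  assume "a \<le> b"
  then have "(deriv \<phi> has_integral \<phi> b - \<phi> a) {a..b}"
    by (intro fundamental_theorem_of_calculus)
      (auto simp flip: has_real_derivative_iff_has_vector_derivative intro: smooth_derivD(1)[OF s] has_field_derivative_at_within)
  then show "\<phi> b - \<phi> a = integral {a..b} (deriv \<phi>)" by (simp add: integral_unique)
qed

lemma primitive_exists:
  assumes "locally_integrable S f" "is_interval S"
  shows "\<exists>F. is_primitive S F f"
proof (cases "S = {}")
  case True
  then have "is_primitive S F f" for F using assms by (auto simp: is_primitive_def)
  then show ?thesis by blast
next
  case False
  then obtain p where p: "p \<in> S" by auto
  have S: "{a..b} \<subseteq> S" if "a \<in> S" "b \<in> S" for a b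
  proof
    fix x assume "x \<in> {a..b}"
    then show "x \<in> S"
      using assms(2)[unfolded is_interval_1, rule_format, of a b x] that by simp
  qed
  have int: "f integrable_on {a..b}" if "a \<in> S" "b \<in> S" for a b
    using S[OF that] assms(1) by (auto simp: locally_integrable_def dest: set_lebesgue_integral_eq_integral(1))
  \<comment> \<open>An integral over an interval with reversed ends is 0, so on each side of
    \<open>p\<close> only one of the two terms is alive.\<close>
  define F where "F x = integral {p..x} f - integral {x..p} f" for x
  have "F b - F a = integral {a..b} f" if "a \<le> b" "{a..b} \<subseteq> S" for a b
  proof -
    have ab: "a \<in> S" "b \<in> S" using that by auto
    consider "p \<le> a" | "a < p" "p \<le> b" | "b < p" by linarith
    then show ?thesis
    proof cases
      case 1
      have "integral {x..p} f = 0" if "x \<ge> p" for x using that by (cases "x = p") auto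
      then show ?thesis
        using Henstock_Kurzweil_Integration.integral_combine[OF 1 that(1) int[OF p ab(2)]] 1 that by (simp add: F_def)
    next
      case 2
      have "integral {b..p} f = 0" using 2 by (cases "b = p") auto
      then show ?thesis
        using Henstock_Kurzweil_Integration.integral_combine[OF less_imp_le[OF 2(1)] 2(2) int[OF ab]] 2 by (simp add: F_def)
    next
      case 3
      then show ?thesis
        using Henstock_Kurzweil_Integration.integral_combine[OF that(1) _ int[OF ab(1) p]] that by (simp add: F_def)
    qed
  qed
  then show ?thesis using assms(1) by (auto simp: is_primitive_def)
qed

lemma integral_lebesgue_on_supported:
  fixes p :: "real \<Rightarrow> real"
  assumes "S \<in> sets lebesgue" "{a..b} \<subseteq> S" "\<And>x. x \<notin> {a..b} \<Longrightarrow> p x = 0" "p absolutely_integrable_on {a..b}"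
  shows "integrable (lebesgue_on S) p" "(LINT x|lebesgue_on S. p x) = integral {a..b} p"
proof -
  have eq: "indicat_real S x *\<^sub>R p x = indicat_real {a..b} x *\<^sub>R p x" for x
    using assms(2) assms(3)[of x] by (auto simp: indicator_def)
  show "integrable (lebesgue_on S) p"
    using assms(1,4) by (simp add: integrable_restrict_space eq set_integrable_def del: real_scaleR_def)
  have "(LINT x|lebesgue_on S. p x) = (LINT x:{a..b}|lebesgue. p x)"
    using assms(1) by (simp add: integral_restrict_space eq set_lebesgue_integral_def del: real_scaleR_def)
  then show "(LINT x|lebesgue_on S. p x) = integral {a..b} p"
    using set_lebesgue_integral_eq_integral(2)[OF assms(4)] by simp
qed

lemma Cc_inf_mult_integral:
  assumes "S \<in> sets lebesgue" "{a..b} \<subseteq> S" "\<And>x. x \<notin> {a..b} \<Longrightarrow> \<phi> x = 0" "continuous_on {a..b} \<phi>"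
    and "locally_integrable S f"
  shows "integrable (lebesgue_on S) (\<lambda>x. f x * \<phi> x)"
    "(LINT x|lebesgue_on S. f x * \<phi> x) = integral {a..b} (\<lambda>x. f x * \<phi> x)"
  using integral_lebesgue_on_supported[OF assms(1,2), of "\<lambda>x. f x * \<phi> x"] assms(2-)
  by (auto simp: locally_integrable_def absolutely_integrable_continuous_mult)

lemma locally_integrable_diff:
  "locally_integrable S f \<Longrightarrow> locally_integrable S g \<Longrightarrow> locally_integrable S (\<lambda>x. f x - g x)"
  by (auto simp: locally_integrable_def intro: set_integral_diff)

lemma locally_integrable_continuous:
  "(\<And>a b. {a..b} \<subseteq> S \<Longrightarrow> continuous_on {a..b} f) \<Longrightarrow> locally_integrable S f"
  by (auto simp: locally_integrable_def intro: absolutely_integrable_continuous_real)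

lemma AE_zero_on_interval:
  fixes h :: "real \<Rightarrow> real"
  assumes h: "h absolutely_integrable_on {A..B}"
    and 0: "\<And>a b. {a..b} \<subseteq> {A..B} \<Longrightarrow> integral {a..b} h = 0"
  shows "AE x in lebesgue. x \<in> {A..B} \<longrightarrow> h x = 0"
proof -
  let ?h = "\<lambda>x. indicat_real {A..B} x * h x"
  have "AE x in lebesgue. ?h x = 0"
  proof (rule AE_eq_0_if_integrals_atMost)
    show "integrable lebesgue ?h"
      using h by (simp add: set_integrable_def)
    have eq: "indicat_real {..d} x * ?h x = indicat_real {A..min d B} x * h x" for d x
      by (auto simp: indicator_def)
    show "(LINT x:{..d}|lebesgue. ?h x) = 0" for d
    proof -
      have "h absolutely_integrable_on {A..min d B}"
        by (rule absolutely_integrable_on_subinterval[OF h]) auto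
      then have "(LINT x:{A..min d B}|lebesgue. h x) = 0"
        using set_lebesgue_integral_eq_integral(2) 0[of A "min d B"] by fastforce
      then show ?thesis by (simp add: set_lebesgue_integral_def eq)
    qed
    show "(LINT x|lebesgue. ?h x) = 0"
      using set_lebesgue_integral_eq_integral(2)[OF h] 0[of A B] by (simp add: set_lebesgue_integral_def)
  qed
  then show ?thesis by eventually_elim (auto simp: indicator_def)
qed

text \<open>An open set is a countable union of closed intervals, so only countably many null sets
  are collected.\<close>

lemma AE_open_if_AE_intervals:
  fixes S :: "real set"
  assumes "open S" "\<And>a b. {a..b} \<subseteq> S \<Longrightarrow> AE x in lebesgue. x \<in> {a..b} \<longrightarrow> P x"
  shows "AE x in lebesgue_on S. P x"
proof -
  obtain D where D: "countable D" "D \<subseteq> Pow S" "\<And>X. X \<in> D \<Longrightarrow> \<exists>a b. X = cbox a b" "\<Union>D = S"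
    using open_countable_Union_open_cbox[OF assms(1)] by blast
  have "\<forall>X\<in>D. AE x in lebesgue. x \<in> X \<longrightarrow> P x"
  proof
    fix X assume X: "X \<in> D"
    then obtain a b where "X = {a..b}" using D(3) by force
    then show "AE x in lebesgue. x \<in> X \<longrightarrow> P x" using assms(2)[of a b] X D(2) by auto
  qed
  then have "AE x in lebesgue. \<forall>X\<in>D. x \<in> X \<longrightarrow> P x"
    using AE_ball_countable[OF D(1), of "\<lambda>x X. x \<in> X \<longrightarrow> P x" lebesgue] by simp
  then have "AE x in lebesgue. x \<in> S \<longrightarrow> P x"
    by (rule eventually_mono) (use D(4) in blast)
  then show ?thesis using assms(1) by (simp add: AE_restrict_space_iff)
qed

text \<open>Bumps on \<open>{a..b}\<close> are admissible and converge boundedly to the indicator,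
  so \<open>h\<close> has integral 0 over every compact subinterval.\<close>

lemma fundamental_lemma:
  assumes "open S" "locally_integrable S h"
    and 0: "\<And>\<phi>. \<phi> \<in> Cc_inf S \<Longrightarrow> (LINT x|lebesgue_on S. h x * \<phi> x) = 0"
  shows "AE x in lebesgue_on S. h x = 0"
proof (rule AE_open_if_AE_intervals[OF assms(1)])
  have SL: "S \<in> sets lebesgue" using assms(1) by auto
  fix A B assume AB: "{A..B} \<subseteq> S"
  show "AE x in lebesgue. x \<in> {A..B} \<longrightarrow> h x = 0"
  proof (rule AE_zero_on_interval)
    show "h absolutely_integrable_on {A..B}" using assms(2) AB by (simp add: locally_integrable_def)
    fix a b assume "{a..b} \<subseteq> {A..B}"
    then have ab: "{a..b} \<subseteq> S" using AB by (rule subset_trans)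
    have h: "h absolutely_integrable_on {a..b}" using assms(2) ab by (simp add: locally_integrable_def)
    have cb: "continuous_on {a..b} (bump a b n)" for n by (intro smooth_continuous smooth_bump)
    have "(\<lambda>n. integral {a..b} (\<lambda>x. h x * bump a b n x)) \<longlonglongrightarrow> integral {a..b} (\<lambda>x. h x * indicat_real {a<..<b} x)"
    proof (rule dominated_convergence(2))
      show "(\<lambda>x. h x * bump a b n x) integrable_on {a..b}" for n
        using absolutely_integrable_continuous_mult[OF h cb] set_lebesgue_integral_eq_integral(1) by blast
      show "(\<lambda>x. \<bar>h x\<bar>) integrable_on {a..b}"
        using set_integrable_abs[OF h] set_lebesgue_integral_eq_integral(1) by blast
      show "norm (h x * bump a b n x) \<le> \<bar>h x\<bar>" for n x
        using bump_bounds[of a b n x] by (simp add: abs_mult mult_left_le)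
      show "(\<lambda>n. h x * bump a b n x) \<longlonglongrightarrow> h x * indicat_real {a<..<b} x" for x
        by (intro tendsto_intros bump_tendsto)
    qed
    moreover have "integral {a..b} (\<lambda>x. h x * bump a b n x) = 0" for n
    proof -
      have "bump a b n x = 0" if "x \<notin> {a..b}" for x using that by (intro bump_outside) auto
      from 0[OF bump_Cc_inf[OF ab, of n]] Cc_inf_mult_integral(2)[OF SL ab this cb assms(2)]
      show ?thesis by simp
    qed
    moreover have "integral {a..b} (\<lambda>x. h x * indicat_real {a<..<b} x) = integral {a..b} h"
      by (rule integral_spike[of "{a, b}"]) auto
    ultimately show "integral {a..b} h = 0" by (simp add: LIMSEQ_const_iff)
  qed
qed

text \<open>The product \<open>F * \<phi>\<close> vanishes at both ends of an interval around the
  support, so its product rule integrates to 0.\<close>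

lemma is_weak_deriv_primitive:
  assumes "open S" "is_interval S" "is_primitive S F f"
  shows "is_weak_deriv S F f"
  unfolding is_weak_deriv_def
proof
  fix \<phi> assume \<phi>: "\<phi> \<in> Cc_inf S"
  have SL: "S \<in> sets lebesgue" using assms(1) by auto
  have sm: "smooth \<phi>" using \<phi> by (simp add: Cc_inf_def)
  show "(LINT x|lebesgue_on S. F x * deriv \<phi> x) = - (LINT x|lebesgue_on S. f x * \<phi> x)"
  proof (cases "S = {}")
    case False
    obtain a b where ab: "a < b" "{a..b} \<subseteq> S" "\<And>x. x \<notin> {a<..<b} \<Longrightarrow> \<phi> x = 0"
      using Cc_inf_support[OF \<phi> assms(1,2) False] by metis
    have out: "\<phi> x = 0" "deriv \<phi> x = 0" if "x \<notin> {a..b}" for x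
      using ab(3) that deriv_eq_0_outside[of a b \<phi> x] by (auto simp: less_eq_real_def)
    have c: "continuous_on {a..b} \<phi>" "continuous_on {a..b} (deriv \<phi>)"
      using sm by (auto intro: smooth_continuous smooth_derivD)
    have lf: "locally_integrable S f" and lF: "locally_integrable S F"
      using assms(3) is_primitive_continuous by (auto simp: is_primitive_def intro: locally_integrable_continuous)
    have "is_primitive S (\<lambda>x. F x * \<phi> x) (\<lambda>x. f x * \<phi> x + deriv \<phi> x * F x)"
      by (intro is_primitive_mult assms is_primitive_smooth sm)
    from is_primitiveD(1)[OF this, of a b] ab
    have "0 = integral {a..b} (\<lambda>x. f x * \<phi> x + deriv \<phi> x * F x)" by simp
    also have "\<dots> = integral {a..b} (\<lambda>x. f x * \<phi> x) + integral {a..b} (\<lambda>x. F x * deriv \<phi> x)"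
    proof (subst Henstock_Kurzweil_Integration.integral_add)
      show "(\<lambda>x. f x * \<phi> x) integrable_on {a..b}" "(\<lambda>x. deriv \<phi> x * F x) integrable_on {a..b}"
        using absolutely_integrable_continuous_mult[where f = f and p = \<phi> and a = a and b = b]
          absolutely_integrable_continuous_mult[where f = F and p = "deriv \<phi>" and a = a and b = b]
          lf lF ab(2) c set_lebesgue_integral_eq_integral(1)
        by (auto simp: locally_integrable_def mult.commute)
    qed (simp add: mult.commute)
    finally show ?thesis
      using Cc_inf_mult_integral(2)[OF SL ab(2) out(1) c(1) lf] Cc_inf_mult_integral(2)[OF SL ab(2) out(2) c(2) lF]
      by simp
  qed simp
qed

lemma antiderivative_Cc_inf:
  assumes "smooth \<theta>" "a \<le> b" "\<And>x. x \<notin> {a<..<b} \<Longrightarrow> \<theta> x = 0" "integral {a..b} \<theta> = 0" "{a..b} \<subseteq> S"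
  shows "\<exists>\<phi>\<in>Cc_inf S. deriv \<phi> = \<theta>"
proof -
  have c: "continuous_on A \<theta>" for A by (rule smooth_continuous[OF assms(1)])
  have int: "\<theta> integrable_on {l..u}" for l u by (intro integrable_continuous_real c)
  define \<phi> where "\<phi> x = integral {a..x} \<theta>" for x
  have left: "\<phi> x = 0" if "x \<le> a" for x using that by (cases "x = a") (auto simp: \<phi>_def)
  have eq: "\<phi> x = integral {l..x} \<theta>" if "l \<le> a" for l x
  proof (cases "a \<le> x")
    case True
    have "integral {l..a} \<theta> = 0"
      by (rule integral_unique, rule has_integral_is_0) (use assms(3) in auto)
    then show ?thesis
      using Henstock_Kurzweil_Integration.integral_combine[OF that True int] by (simp add: \<phi>_def)
  next
    case False
    have "integral {l..x} \<theta> = 0"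
      by (rule integral_unique, rule has_integral_is_0) (use assms(3) False in auto)
    then show ?thesis using left[of x] False by simp
  qed
  have right: "\<phi> x = 0" if "b \<le> x" for x
  proof -
    have "integral {b..x} \<theta> = 0"
      by (rule integral_unique, rule has_integral_is_0) (use assms(3) in auto)
    then show ?thesis
      using Henstock_Kurzweil_Integration.integral_combine[OF assms(2) that int] assms(4) by (simp add: \<phi>_def)
  qed
  have deriv: "(\<phi> has_real_derivative \<theta> x) (at x)" for x
  proof -
    \<comment> \<open>A base point to the left of both \<open>a\<close> and \<open>x\<close> makes
      \<open>x\<close> interior to the interval of integration; \<open>\<phi>\<close> does not
      change because \<open>\<theta>\<close> vanishes to the left of \<open>a\<close>.\<close>
    let ?l = "min a x - 1"
    have "((\<lambda>u. integral {?l..u} \<theta>) has_vector_derivative \<theta> x) (at x within {?l..x + 1})"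
      by (rule integral_has_vector_derivative[OF c]) auto
    then have "((\<lambda>u. integral {?l..u} \<theta>) has_real_derivative \<theta> x) (at x within {?l..x + 1})"
      by (simp add: has_real_derivative_iff_has_vector_derivative)
    moreover have "at x within {?l..x + 1} = at x"
      by (rule at_within_interior) auto
    moreover have "\<phi> = (\<lambda>u. integral {?l..u} \<theta>)" using eq[of ?l] by auto
    ultimately show ?thesis by simp
  qed
  have "smooth \<phi>" by (rule smoothI_deriv[OF deriv assms(1)])
  then have "\<phi> \<in> Cc_inf S"
    by (rule Cc_infI[OF _ _ assms(5)]) (use left right in auto)
  moreover have "deriv \<phi> = \<theta>" using DERIV_imp_deriv[OF deriv] by auto
  ultimately show ?thesis by blast
qed

text \<open>A test function is the derivative of a test function exactly when its integral is 0.
  Subtracting a multiple of a fixed bump \<open>?\<psi>\<close> from \<open>\<eta>\<close> achieves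
  this, and the constant \<open>c\<close> is the average of \<open>h\<close> weighted by
  \<open>?\<psi>\<close>.\<close>

lemma constant_if_weak_deriv_0:
  assumes "open S" "is_interval S" "locally_integrable S h" "is_weak_deriv S h (\<lambda>x. 0)"
  shows "\<exists>c. AE x in lebesgue_on S. h x = c"
proof (cases "S = {}")
  case False
  have SL: "S \<in> sets lebesgue" using assms(1) by auto
  obtain p where "p \<in> S" using False by auto
  then obtain d where d: "d > 0" "cball p d \<subseteq> S" using assms(1) open_contains_cball by blast
  let ?\<psi> = "bump (p - d) (p + d) 0"
  have sub: "{p - d..p + d} \<subseteq> S" using d by (simp add: cball_eq_atLeastAtMost)
  define m where "m = integral {p - d..p + d} ?\<psi>"
  have cb: "continuous_on A ?\<psi>" for A by (intro smooth_continuous smooth_bump)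
  have "m \<noteq> 0"
  proof
    assume "m = 0"
    then have "\<forall>x\<in>{p - d..p + d}. ?\<psi> x = 0"
      using integral_eq_0_iff[OF cb, of "p - d" "p + d"] bump_bounds d(1) by (simp add: m_def)
    then have "?\<psi> p = 0" using d(1) by simp
    then show False using bump_pos[of "p - d" p "p + d" 0] d by simp
  qed
  define c where "c = (LINT x|lebesgue_on S. h x * ?\<psi> x) / m"
  have "AE x in lebesgue_on S. h x - c = 0"
  proof (rule fundamental_lemma[OF assms(1)])
    have lc: "locally_integrable S (\<lambda>x. c)" by (intro locally_integrable_continuous) auto
    show l: "locally_integrable S (\<lambda>x. h x - c)"
      by (intro locally_integrable_diff assms(3) lc)
    fix \<eta> assume \<eta>: "\<eta> \<in> Cc_inf S"
    obtain a0 b0 where ab0: "a0 < b0" "{a0..b0} \<subseteq> S" "\<And>x. x \<notin> {a0<..<b0} \<Longrightarrow> \<eta> x = 0"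
      using Cc_inf_support[OF \<eta> assms(1,2) False] by metis
    define a where "a = min a0 (p - d)" define b where "b = max b0 (p + d)"
    have ab: "a \<le> b" "{a..b} \<subseteq> S"
    proof -
      show "a \<le> b" using ab0(1) by (simp add: a_def b_def)
      have "a \<in> S" "b \<in> S" using ab0 sub d(1) by (auto simp: a_def b_def min_def max_def subset_iff)
      then show "{a..b} \<subseteq> S"
        using assms(2)[unfolded is_interval_1, rule_format, of a b] by fastforce
    qed
    have out: "\<eta> x = 0" "?\<psi> x = 0" if "x \<notin> {a<..<b}" for x
    proof -
      have "x \<notin> {a0<..<b0}" "x \<notin> {p - d<..<p + d}" using that by (auto simp: a_def b_def)
      then show "\<eta> x = 0" "?\<psi> x = 0" using ab0(3) bump_outside by blast+
    qed
    have out': "\<eta> x = 0" "?\<psi> x = 0" if "x \<notin> {a..b}" for x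
      using that out[of x] by auto
    have sm: "smooth \<eta>" using \<eta> by (simp add: Cc_inf_def)
    have ce: "continuous_on A \<eta>" for A by (intro smooth_continuous sm)
    define k where "k = integral {a..b} \<eta> / m"
    let ?\<theta> = "\<lambda>x. \<eta> x + (- k) * ?\<psi> x"
    have m': "integral {a..b} ?\<psi> = m"
    proof -
      have "(?\<psi> has_integral m) {p - d..p + d}"
        unfolding m_def by (intro integrable_integral integrable_continuous_real cb)
      then have "(?\<psi> has_integral m) {a..b}"
        by (rule has_integral_on_superset) (auto simp: a_def b_def intro!: bump_outside)
      then show ?thesis by (rule integral_unique)
    qed
    have "integral {a..b} ?\<theta> = integral {a..b} \<eta> - k * m"
      by (subst Henstock_Kurzweil_Integration.integral_add)
        (auto simp: m' intro!: integrable_continuous_real continuous_intros cb ce)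
    also have "\<dots> = 0" using \<open>m \<noteq> 0\<close> by (simp add: k_def)
    finally have "\<exists>\<phi>\<in>Cc_inf S. deriv \<phi> = ?\<theta>"
      using out by (intro antiderivative_Cc_inf[OF _ ab(1) _ _ ab(2)] smooth_add smooth_mult smooth_const sm smooth_bump) auto
    then obtain \<phi> where \<phi>: "\<phi> \<in> Cc_inf S" "deriv \<phi> = ?\<theta>" by blast
    have 0: "(LINT x|lebesgue_on S. h x * ?\<theta> x) = 0"
      using assms(4) \<phi> unfolding is_weak_deriv_def by fastforce
    note I = Cc_inf_mult_integral[OF SL ab(2)]
    have hi: "integrable (lebesgue_on S) (\<lambda>x. h x * \<eta> x)" "integrable (lebesgue_on S) (\<lambda>x. h x * ?\<psi> x)"
      "integrable (lebesgue_on S) (\<lambda>x. c * \<eta> x)"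
      using I(1)[OF out'(1) ce assms(3)] I(1)[OF out'(2) cb assms(3)] I(1)[OF out'(1) ce lc] by auto
    have ce_int: "(LINT x|lebesgue_on S. c * \<eta> x) = c * (k * m)"
      using I(2)[OF out'(1) ce lc] \<open>m \<noteq> 0\<close> by (simp add: k_def)
    have "(LINT x|lebesgue_on S. h x * ?\<theta> x) = (LINT x|lebesgue_on S. h x * \<eta> x + (- k) * (h x * ?\<psi> x))"
      by (rule Bochner_Integration.integral_cong) (auto simp: algebra_simps)
    also have "\<dots> = (LINT x|lebesgue_on S. h x * \<eta> x) - k * (c * m)"
      using hi \<open>m \<noteq> 0\<close> by (simp add: c_def)
    finally have "(LINT x|lebesgue_on S. h x * \<eta> x) = c * (k * m)" using 0 by simp
    then show "(LINT x|lebesgue_on S. (h x - c) * \<eta> x) = 0"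
      using hi ce_int by (auto simp: left_diff_distrib)
  qed
  then show ?thesis by auto
qed (simp add: AE_restrict_space_iff)

text \<open>Subtracting any primitive \<open>G\<close> of \<open>g\<close> leaves a function with
  weak derivative 0, hence a constant, which is absorbed into the primitive.\<close>

lemma weak_deriv_representation:
  assumes "open S" "is_interval S" "locally_integrable S f" "locally_integrable S g" "is_weak_deriv S f g"
  shows "\<exists>F. is_primitive S F g \<and> (AE x in lebesgue_on S. f x = F x)"
proof (cases "S = {}")
  case True
  then have "is_primitive S F g" for F using assms by (auto simp: is_primitive_def)
  moreover have "AE x in lebesgue_on S. f x = F x" for F :: "real \<Rightarrow> real"
    using True by (simp add: AE_restrict_space_iff)
  ultimately show ?thesis by blast
next
  case False
  have SL: "S \<in> sets lebesgue" using assms(1) by auto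
  obtain G where G: "is_primitive S G g" using primitive_exists[OF assms(4,2)] by blast
  have lG: "locally_integrable S G"
    using G is_primitive_continuous by (intro locally_integrable_continuous) auto
  have "is_weak_deriv S (\<lambda>x. f x - G x) (\<lambda>x. 0)"
    unfolding is_weak_deriv_def
  proof
    fix \<phi> assume \<phi>: "\<phi> \<in> Cc_inf S"
    have sm: "smooth \<phi>" using \<phi> by (simp add: Cc_inf_def)
    obtain a b where ab: "a < b" "{a..b} \<subseteq> S" "\<And>x. x \<notin> {a<..<b} \<Longrightarrow> \<phi> x = 0"
      using Cc_inf_support[OF \<phi> assms(1,2) False] by metis
    have out: "deriv \<phi> x = 0" if "x \<notin> {a..b}" for x
      using ab(3) that deriv_eq_0_outside[of a b \<phi> x] by (auto simp: less_eq_real_def)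
    have c: "continuous_on {a..b} (deriv \<phi>)" using sm by (auto intro: smooth_continuous smooth_derivD)
    have "integrable (lebesgue_on S) (\<lambda>x. f x * deriv \<phi> x)" "integrable (lebesgue_on S) (\<lambda>x. G x * deriv \<phi> x)"
      using Cc_inf_mult_integral(1)[OF SL ab(2) out c] assms(3) lG by auto
    moreover have "(LINT x|lebesgue_on S. f x * deriv \<phi> x) = (LINT x|lebesgue_on S. G x * deriv \<phi> x)"
      using assms(5) is_weak_deriv_primitive[OF assms(1,2) G] \<phi> by (simp add: is_weak_deriv_def)
    ultimately show "(LINT x|lebesgue_on S. (f x - G x) * deriv \<phi> x) = - (LINT x|lebesgue_on S. 0 * \<phi> x)"
      by (simp add: left_diff_distrib)
  qed
  then obtain c where c: "AE x in lebesgue_on S. f x - G x = c"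
    using constant_if_weak_deriv_0[OF assms(1,2) locally_integrable_diff[OF assms(3) lG]] by blast
  have "is_primitive S (\<lambda>x. G x + c) g" using G by (simp add: is_primitive_def)
  moreover have "AE x in lebesgue_on S. f x = G x + c" using c by eventually_elim simp
  ultimately show ?thesis by blast
qed

lemma weak_deriv_unique_AE:
  assumes "open S" "is_interval S" "locally_integrable S g" "locally_integrable S g'"
    and "is_weak_deriv S f g" "is_weak_deriv S f g'"
  shows "AE x in lebesgue_on S. g x = g' x"
proof (cases "S = {}")
  case False
  have SL: "S \<in> sets lebesgue" using assms(1) by auto
  have "AE x in lebesgue_on S. g x - g' x = 0"
  proof (rule fundamental_lemma[OF assms(1) locally_integrable_diff[OF assms(3,4)]])
    fix \<phi> assume \<phi>: "\<phi> \<in> Cc_inf S"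
    have sm: "smooth \<phi>" using \<phi> by (simp add: Cc_inf_def)
    obtain a b where ab: "a < b" "{a..b} \<subseteq> S" "\<And>x. x \<notin> {a<..<b} \<Longrightarrow> \<phi> x = 0"
      using Cc_inf_support[OF \<phi> assms(1,2) False] by metis
    have out: "\<phi> x = 0" if "x \<notin> {a..b}" for x using that ab(3)[of x] by auto
    have "integrable (lebesgue_on S) (\<lambda>x. g x * \<phi> x)" "integrable (lebesgue_on S) (\<lambda>x. g' x * \<phi> x)"
      using Cc_inf_mult_integral(1)[OF SL ab(2) out smooth_continuous[OF sm]] assms(3,4) by auto
    moreover have "(LINT x|lebesgue_on S. g x * \<phi> x) = (LINT x|lebesgue_on S. g' x * \<phi> x)"
      using assms(5,6) \<phi> by (simp add: is_weak_deriv_def)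
    ultimately show "(LINT x|lebesgue_on S. (g x - g' x) * \<phi> x) = 0" by (simp add: left_diff_distrib)
  qed
  then show ?thesis by simp
qed (simp add: AE_restrict_space_iff)

lemma L2_locally_integrable:
  assumes "S \<in> sets lebesgue" "f \<in> L2 S"
  shows "locally_integrable S f"
  unfolding locally_integrable_def
proof safe
  fix a b assume ab: "{a..b} \<subseteq> S"
  have m: "f \<in> borel_measurable (lebesgue_on {a..b})"
    using L2_measurable[OF assms(2)] ab by (rule measurable_restrict_mono)
  have "integrable lebesgue (\<lambda>x. indicat_real S x *\<^sub>R (f x)\<^sup>2)"
    using L2_square_integrable[OF assms(2)] assms(1) by (simp add: integrable_restrict_space)
  from integrable_mult_indicator[OF _ this, of "{a..b}"]
  have "integrable lebesgue (\<lambda>x. indicat_real {a..b} x *\<^sub>R (f x)\<^sup>2)"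
    using ab by (simp add: indicator_inter_arith[symmetric] mult.assoc[symmetric] Int_absorb2)
  then have sq: "integrable (lebesgue_on {a..b}) (\<lambda>x. (f x)\<^sup>2)"
    by (simp add: integrable_restrict_space)
  have "f \<in> L2 {a..b}" using m sq by (rule L2I)
  then have "integrable (lebesgue_on {a..b}) f"
    by (intro integral_le_norm_L2(1)) auto
  then show "f absolutely_integrable_on {a..b}"
    by (simp add: set_integrable_def integrable_restrict_space)
qed

section \<open>Sobolev spaces of order one\<close>

lemma norm_L2_bounded_mult:
  assumes "f \<in> borel_measurable (lebesgue_on S)" "AE x in lebesgue_on S. \<bar>f x\<bar> \<le> B" "0 \<le> B" "g \<in> L2 S"
  shows "norm_L2 S (\<lambda>x. f x * g x) \<le> B * norm_L2 S g"
proof -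
  have "inner_L2 S (\<lambda>x. f x * g x) (\<lambda>x. f x * g x) \<le> (LINT x|lebesgue_on S. B\<^sup>2 * (g x)\<^sup>2)"
    unfolding inner_L2_def
  proof (rule integral_mono_AE)
    show "integrable (lebesgue_on S) (\<lambda>x. f x * g x * (f x * g x))"
      by (rule L2_mult_integrable; rule L2_bounded_mult; fact)
    show "integrable (lebesgue_on S) (\<lambda>x. B\<^sup>2 * (g x)\<^sup>2)"
      using L2_square_integrable[OF assms(4)] by simp
    show "AE x in lebesgue_on S. f x * g x * (f x * g x) \<le> B\<^sup>2 * (g x)\<^sup>2"
      using assms(2)
    proof eventually_elim
      case (elim x)
      then have "(f x)\<^sup>2 \<le> B\<^sup>2" by (metis abs_ge_zero power2_abs power_mono)
      then have "(f x)\<^sup>2 * (g x)\<^sup>2 \<le> B\<^sup>2 * (g x)\<^sup>2" by (rule mult_right_mono) simp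
      then show ?case by (simp add: power2_eq_square mult_ac)
    qed
  qed
  also have "\<dots> = B\<^sup>2 * inner_L2 S g g" by (simp add: inner_L2_def power2_eq_square)
  finally have "sqrt (inner_L2 S (\<lambda>x. f x * g x) (\<lambda>x. f x * g x)) \<le> sqrt (B\<^sup>2 * inner_L2 S g g)"
    by (rule real_sqrt_le_mono)
  then show ?thesis using assms(3) by (simp add: norm_L2_def real_sqrt_mult)
qed

lemma Cc_inf_L2:
  assumes "\<phi> \<in> Cc_inf S" "open S" "is_interval S"
  shows "\<phi> \<in> L2 S" "deriv \<phi> \<in> L2 S"
proof -
  have SL: "S \<in> sets lebesgue" using assms(2) by auto
  have sm: "smooth \<phi>" using assms(1) by (simp add: Cc_inf_def)
  have *: "f \<in> L2 S" if ab: "{a..b} \<subseteq> S" "\<And>x. x \<notin> {a..b} \<Longrightarrow> f x = 0" and c: "\<And>A. continuous_on A f" for a b f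
  proof (rule L2I)
    show "f \<in> borel_measurable (lebesgue_on S)"
      by (rule continuous_imp_measurable_on_sets_lebesgue[OF c SL])
    show "integrable (lebesgue_on S) (\<lambda>x. (f x)\<^sup>2)"
      by (rule integral_lebesgue_on_supported(1)[OF SL ab(1)])
        (use ab c in \<open>auto intro!: absolutely_integrable_continuous_real continuous_intros\<close>)
  qed
  have "\<phi> \<in> L2 S \<and> deriv \<phi> \<in> L2 S"
  proof (cases "S = {}")
    case True
    then show ?thesis by (auto simp: L2_def measurable_def space_restrict_space)
  next
    case False
    obtain a b where ab: "a < b" "{a..b} \<subseteq> S" "\<And>x. x \<notin> {a<..<b} \<Longrightarrow> \<phi> x = 0"
      using Cc_inf_support[OF assms False] by metis
    have out: "\<phi> x = 0" if "x \<notin> {a..b}" for x using that ab(3)[of x] by auto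
    show ?thesis
      using *[OF ab(2) out smooth_continuous[OF sm]]
        *[OF ab(2) deriv_eq_0_outside[OF out] smooth_continuous[OF smooth_derivD(2)[OF sm]]] by simp
  qed
  then show "\<phi> \<in> L2 S" "deriv \<phi> \<in> L2 S" by simp_all
qed

lemma is_weak_deriv_inner:
  "is_weak_deriv S f g \<longleftrightarrow> (\<forall>\<phi>\<in>Cc_inf S. inner_L2 S f (deriv \<phi>) = - inner_L2 S g \<phi>)"
  by (simp add: is_weak_deriv_def inner_L2_def)

lemma weak_deriv_H1:
  assumes "f \<in> H1 S"
  shows "weak_deriv S f \<in> L2 S" "is_weak_deriv S f (weak_deriv S f)"
proof -
  have "\<exists>g. g \<in> L2 S \<and> is_weak_deriv S f g" using assms by (auto simp: H1_def)
  then have "weak_deriv S f \<in> L2 S \<and> is_weak_deriv S f (weak_deriv S f)"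
    unfolding weak_deriv_def by (rule someI_ex)
  then show "weak_deriv S f \<in> L2 S" "is_weak_deriv S f (weak_deriv S f)" by simp_all
qed

lemma H1_L2: "f \<in> H1 S \<Longrightarrow> f \<in> L2 S"
  by (simp add: H1_def)

text \<open>Serves the real line, for the states, and the time interval, for the controls.
  Connectedness matters: a function with weak derivative 0 has to be one constant on the whole
  set.\<close>

locale open_interval =
  fixes S :: "real set"
  assumes open_S: "open S" and interval_S: "is_interval S"
begin

lemma sets_S: "S \<in> sets lebesgue"
  using open_S by auto

text \<open>\<open>weak_deriv\<close> is an arbitrary choice within its class, so its linearity
  holds only almost everywhere and is obtained below by comparison with explicit candidates.\<close>

lemma weak_deriv_AE_eq:
  assumes "f \<in> H1 S" "g \<in> L2 S" "is_weak_deriv S f g"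
  shows "AE x in lebesgue_on S. weak_deriv S f x = g x"
  using assms weak_deriv_H1[OF assms(1)] L2_locally_integrable[OF sets_S]
  by (intro weak_deriv_unique_AE[OF open_S interval_S]) auto

lemma is_weak_deriv_add:
  assumes "f \<in> L2 S" "g \<in> L2 S" "f' \<in> L2 S" "g' \<in> L2 S" "is_weak_deriv S f f'" "is_weak_deriv S g g'"
  shows "is_weak_deriv S (\<lambda>x. f x + g x) (\<lambda>x. f' x + g' x)"
  using assms Cc_inf_L2[OF _ open_S interval_S]
  by (auto simp: is_weak_deriv_inner inner_L2_add_left)

lemma is_weak_deriv_cmult:
  assumes "is_weak_deriv S f f'"
  shows "is_weak_deriv S (\<lambda>x. c * f x) (\<lambda>x. c * f' x)"
  using assms by (auto simp: is_weak_deriv_inner inner_L2_cmult_left)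

lemma H1_add:
  assumes "f \<in> H1 S" "g \<in> H1 S"
  shows "(\<lambda>x. f x + g x) \<in> H1 S"
    "AE x in lebesgue_on S. weak_deriv S (\<lambda>x. f x + g x) x = weak_deriv S f x + weak_deriv S g x"
proof -
  have d: "is_weak_deriv S (\<lambda>x. f x + g x) (\<lambda>x. weak_deriv S f x + weak_deriv S g x)"
    by (intro is_weak_deriv_add H1_L2 weak_deriv_H1 assms)
  have L: "(\<lambda>x. weak_deriv S f x + weak_deriv S g x) \<in> L2 S"
    by (intro L2_add weak_deriv_H1 assms)
  show H: "(\<lambda>x. f x + g x) \<in> H1 S"
    using d L L2_add[of f S g] assms by (auto simp: H1_def)
  show "AE x in lebesgue_on S. weak_deriv S (\<lambda>x. f x + g x) x = weak_deriv S f x + weak_deriv S g x"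
    by (rule weak_deriv_AE_eq[OF H L d])
qed

lemma H1_cmult:
  assumes "f \<in> H1 S"
  shows "(\<lambda>x. c * f x) \<in> H1 S"
    "AE x in lebesgue_on S. weak_deriv S (\<lambda>x. c * f x) x = c * weak_deriv S f x"
proof -
  have d: "is_weak_deriv S (\<lambda>x. c * f x) (\<lambda>x. c * weak_deriv S f x)"
    by (intro is_weak_deriv_cmult weak_deriv_H1 assms)
  have L: "(\<lambda>x. c * weak_deriv S f x) \<in> L2 S"
    by (intro L2_cmult weak_deriv_H1 assms)
  show H: "(\<lambda>x. c * f x) \<in> H1 S"
    using d L L2_cmult[of f S] assms by (auto simp: H1_def)
  show "AE x in lebesgue_on S. weak_deriv S (\<lambda>x. c * f x) x = c * weak_deriv S f x"
    by (rule weak_deriv_AE_eq[OF H L d])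
qed

lemma H1_diff:
  assumes "f \<in> H1 S" "g \<in> H1 S"
  shows "(\<lambda>x. f x - g x) \<in> H1 S"
    "AE x in lebesgue_on S. weak_deriv S (\<lambda>x. f x - g x) x = weak_deriv S f x - weak_deriv S g x"
proof -
  have "(\<lambda>x. f x - g x) = (\<lambda>x. f x + - 1 * g x)" by auto
  then show "(\<lambda>x. f x - g x) \<in> H1 S"
    "AE x in lebesgue_on S. weak_deriv S (\<lambda>x. f x - g x) x = weak_deriv S f x - weak_deriv S g x"
    using H1_add[OF assms(1) H1_cmult(1)[OF assms(2), of "-1"]] H1_cmult(2)[OF assms(2), of "-1"]
    by (auto elim!: eventually_elim2)
qed

lemma H1_zero: "(\<lambda>x. 0) \<in> H1 S"
  by (auto simp: H1_def is_weak_deriv_def intro!: bexI[of _ "\<lambda>x. 0"] L2_zero)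

lemma norm_H1_square: "(norm_H1 S f)\<^sup>2 = (norm_L2 S f)\<^sup>2 + (norm_L2 S (weak_deriv S f))\<^sup>2"
  by (simp add: norm_H1_def)

lemma norm_H1_nonneg: "0 \<le> norm_H1 S f"
  by (simp add: norm_H1_def)

lemma norm_L2_le_norm_H1: "norm_L2 S f \<le> norm_H1 S f" "norm_L2 S (weak_deriv S f) \<le> norm_H1 S f"
  by (auto simp: norm_H1_def norm_L2_nonneg intro: real_le_rsqrt)

lemma norm_H1_triangle:
  assumes "f \<in> H1 S" "g \<in> H1 S"
  shows "norm_H1 S (\<lambda>x. f x + g x) \<le> norm_H1 S f + norm_H1 S g"
proof -
  have "norm_L2 S (weak_deriv S (\<lambda>x. f x + g x)) = norm_L2 S (\<lambda>x. weak_deriv S f x + weak_deriv S g x)"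
    by (rule norm_L2_cong_AE[OF H1_add(2)[OF assms]]) (intro L2_measurable L2_add weak_deriv_H1 H1_add assms)+
  then have "norm_H1 S (\<lambda>x. f x + g x) \<le> sqrt ((norm_L2 S f + norm_L2 S g)\<^sup>2 + (norm_L2 S (weak_deriv S f) + norm_L2 S (weak_deriv S g))\<^sup>2)"
    unfolding norm_H1_def
    by (intro real_sqrt_le_mono add_mono power_mono norm_L2_nonneg)
      (simp_all add: norm_L2_triangle H1_L2 weak_deriv_H1 assms)
  also have "\<dots> \<le> norm_H1 S f + norm_H1 S g"
    unfolding norm_H1_def by (rule real_sqrt_sum_squares_triangle_ineq)
  finally show ?thesis .
qed

lemma norm_H1_cmult:
  assumes "f \<in> H1 S"
  shows "norm_H1 S (\<lambda>x. c * f x) = \<bar>c\<bar> * norm_H1 S f"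
proof -
  have "norm_L2 S (weak_deriv S (\<lambda>x. c * f x)) = norm_L2 S (\<lambda>x. c * weak_deriv S f x)"
    by (rule norm_L2_cong_AE[OF H1_cmult(2)[OF assms]]) (intro L2_measurable L2_cmult weak_deriv_H1 H1_cmult assms)+
  then have "norm_H1 S (\<lambda>x. c * f x) = sqrt (c\<^sup>2 * ((norm_L2 S f)\<^sup>2 + (norm_L2 S (weak_deriv S f))\<^sup>2))"
    by (simp add: norm_H1_def norm_L2_cmult power_mult_distrib distrib_left)
  then show ?thesis by (simp add: norm_H1_def real_sqrt_mult)
qed

lemma norm_H1_minus:
  assumes "f \<in> H1 S" "g \<in> H1 S"
  shows "norm_H1 S (\<lambda>x. f x - g x) = norm_H1 S (\<lambda>x. g x - f x)"
  using norm_H1_cmult[OF H1_diff(1)[OF assms], of "-1"] by simp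

lemma norm_H1_zero: "norm_H1 S (\<lambda>x. 0) = 0"
  using norm_H1_cmult[OF H1_zero, of 0] by simp

lemma norm_H1_diff_triangle:
  assumes "f \<in> H1 S" "g \<in> H1 S" "h \<in> H1 S"
  shows "norm_H1 S (\<lambda>x. f x - h x) \<le> norm_H1 S (\<lambda>x. f x - g x) + norm_H1 S (\<lambda>x. g x - h x)"
  using norm_H1_triangle[OF H1_diff(1)[OF assms(1,2)] H1_diff(1)[OF assms(2,3)]] by simp

lemma norm_H1_le_diff:
  assumes "f \<in> H1 S" "g \<in> H1 S"
  shows "norm_H1 S f \<le> norm_H1 S g + norm_H1 S (\<lambda>x. f x - g x)"
  using norm_H1_triangle[OF assms(2) H1_diff(1)[OF assms]] by simp

lemma H1_representation:
  assumes "f \<in> H1 S"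
  obtains F where "is_primitive S F (weak_deriv S f)" "AE x in lebesgue_on S. f x = F x"
  using weak_deriv_representation[OF open_S interval_S _ _ weak_deriv_H1(2)[OF assms]]
    L2_locally_integrable[OF sets_S] H1_L2[OF assms] weak_deriv_H1(1)[OF assms] by blast

end

section \<open>Sobolev functions on the line: supremum bound, decay at infinity, integration by
  parts\<close>

interpretation V: open_interval UNIV
  by unfold_locales auto

lemma V_representation:
  assumes "f \<in> V"
  obtains F where "is_primitive UNIV F (dx f)" "AE x in lebesgue. f x = F x"
proof -
  obtain F where "is_primitive UNIV F (dx f)" "AE x in lebesgue_on UNIV. f x = F x"
    by (rule V.H1_representation[OF assms])
  then show ?thesis by (intro that) (simp_all only: lebesgue_on_UNIV_eq)
qed

lemma is_primitive_continuous_UNIV: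
  assumes "is_primitive UNIV F f"
  shows "continuous_on UNIV F"
proof (rule continuous_at_imp_continuous_on, rule ballI)
  fix x
  show "isCont F x"
    by (rule continuous_on_interior[OF is_primitive_continuous[OF assms, of "x - 1" "x + 1"]]) auto
qed

text \<open>\<open>\<bar>F x\<bar>\<close> is at most \<open>\<bar>F y\<bar>\<close> plus the
  integral of \<open>\<bar>g\<bar>\<close>, and this is averaged over \<open>y\<close>. The
  right-hand side is kept local on purpose: enlarging it to the line gives the supremum bound, and
  moving the interval to infinity gives decay.\<close>

lemma sup_bound_on_unit_interval:
  assumes f: "f \<in> H" "g \<in> H" and F: "is_primitive UNIV F g" and ae: "AE y in lebesgue. f y = F y"
  shows "(F x)\<^sup>2 \<le> (LINT y:{x..x+1}|lebesgue. 2 * ((f y)\<^sup>2 + (g y)\<^sup>2))"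
proof -
  have g: "g absolutely_integrable_on {x..x+1}" and cF: "continuous_on {x..x+1} F"
    using is_primitiveD(2)[OF F] is_primitive_continuous[OF F] by auto
  have ag: "(\<lambda>y. \<bar>g y\<bar>) integrable_on {x..x+1}"
    using set_integrable_abs[OF g] set_lebesgue_integral_eq_integral(1) by blast
  have aF: "(\<lambda>y. \<bar>F y\<bar>) integrable_on {x..x+1}"
    by (intro integrable_continuous_real continuous_intros cF)
  have gL: "g \<in> borel_measurable (lebesgue_on {x..x+1})"
    using L2_measurable[OF f(2)] by (rule measurable_restrict_mono) simp
  let ?G = "integral {x..x+1} (\<lambda>y. \<bar>g y\<bar>)"
  have 1: "\<bar>F x\<bar> \<le> \<bar>F y\<bar> + ?G" if "y \<in> {x..x+1}" for y
  proof -
    have i: "g integrable_on {x..y}" "(\<lambda>y. \<bar>g y\<bar>) integrable_on {x..y}"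
      using absolutely_integrable_on_subinterval[OF g, of x y] that set_integrable_abs set_lebesgue_integral_eq_integral(1)
      by (fastforce)+
    have "\<bar>F y - F x\<bar> = norm (integral {x..y} g)" using is_primitiveD(1)[OF F, of x y] that by simp
    also have "\<dots> \<le> integral {x..y} (\<lambda>y. \<bar>g y\<bar>)"
      by (rule integral_norm_bound_integral[OF i]) simp
    also have "\<dots> \<le> ?G"
      using that by (intro integral_subset_le i ag) auto
    finally show ?thesis by simp
  qed
  \<comment> \<open>The interval has length 1, so averaging costs no factor.\<close>
  have "\<bar>F x\<bar> = integral {x..x+1} (\<lambda>y. \<bar>F x\<bar>)" by simp
  also have "\<dots> \<le> integral {x..x+1} (\<lambda>y. \<bar>F y\<bar> + ?G)"
    by (rule integral_le) (use 1 aF in \<open>auto intro!: Henstock_Kurzweil_Integration.integrable_add\<close>)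
  also have "\<dots> = integral {x..x+1} (\<lambda>y. \<bar>F y\<bar> + \<bar>g y\<bar>)"
    using Henstock_Kurzweil_Integration.integral_add[OF aF integrable_const_ivl, of ?G]
      Henstock_Kurzweil_Integration.integral_add[OF aF ag] by simp
  finally have 2: "\<bar>F x\<bar> \<le> integral {x..x+1} (\<lambda>y. \<bar>F y\<bar> + \<bar>g y\<bar>)" .
  let ?k = "\<lambda>y. \<bar>F y\<bar> + \<bar>g y\<bar>"
  have F2: "F \<in> L2 {x..x+1}"
  proof -
    have "bounded (F ` {x..x+1})" by (intro compact_imp_bounded compact_continuous_image cF) auto
    then obtain B where "\<And>y. y \<in> {x..x+1} \<Longrightarrow> \<bar>F y\<bar> \<le> B" by (fastforce simp: bounded_iff)
    then show ?thesis
      by (intro L2_bounded[of _ _ B] continuous_imp_measurable_on_sets_lebesgue cF) (auto intro!: AE_I2)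
  qed
  have g2: "g \<in> L2 {x..x+1}"
  proof (rule L2I[OF gL])
    show "integrable (lebesgue_on {x..x+1}) (\<lambda>x. (g x)\<^sup>2)"
      using L2_square_integrable[OF f(2)] integrable_mult_indicator[of "{x..x+1}" lebesgue "\<lambda>x. (g x)\<^sup>2"]
      by (simp add: integrable_restrict_space lebesgue_on_UNIV_eq)
  qed
  have abs: "(\<lambda>y. \<bar>h y\<bar>) \<in> L2 A" if "h \<in> L2 A" for h A using that by (auto simp: L2_def)
  have k: "?k \<in> L2 {x..x+1}" by (intro L2_add abs F2 g2)
  have "\<bar>F x\<bar> \<le> (LINT y|lebesgue_on {x..x+1}. \<bar>?k y\<bar>)"
    using 2 lebesgue_integral_eq_integral[OF integral_le_norm_L2(1)[OF _ k]] by simp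
  also have "\<dots> \<le> norm_L2 {x..x+1} ?k"
    using integral_le_norm_L2(2)[OF _ k] by simp
  finally have "(F x)\<^sup>2 \<le> (norm_L2 {x..x+1} ?k)\<^sup>2" by (metis abs_ge_zero power2_abs power_mono)
  also have "\<dots> \<le> (LINT y|lebesgue_on {x..x+1}. 2 * ((F y)\<^sup>2 + (g y)\<^sup>2))"
    unfolding norm_L2_square unfolding inner_L2_def
  proof (rule integral_mono)
    show "integrable (lebesgue_on {x..x+1}) (\<lambda>y. ?k y * ?k y)" by (intro L2_mult_integrable k)
    show "integrable (lebesgue_on {x..x+1}) (\<lambda>y. 2 * ((F y)\<^sup>2 + (g y)\<^sup>2))"
      using F2 g2 by (simp add: L2_def)
    fix y
    \<comment> \<open>Source of the factor 2, and hence of \<open>sqrt 2\<close> in the supremum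
      bound.\<close>
    have "0 \<le> (\<bar>F y\<bar> - \<bar>g y\<bar>)\<^sup>2" by simp
    then show "?k y * ?k y \<le> 2 * ((F y)\<^sup>2 + (g y)\<^sup>2)" by (simp add: power2_eq_square algebra_simps)
  qed
  also have "\<dots> = (LINT y:{x..x+1}|lebesgue. 2 * ((F y)\<^sup>2 + (g y)\<^sup>2))"
    by (simp add: integral_restrict_space set_lebesgue_integral_def)
  also have "\<dots> = (LINT y:{x..x+1}|lebesgue. 2 * ((f y)\<^sup>2 + (g y)\<^sup>2))"
    unfolding set_lebesgue_integral_def
  proof (rule integral_cong_AE)
    have FM: "F \<in> borel_measurable lebesgue"
      using continuous_imp_measurable_on_sets_lebesgue[OF is_primitive_continuous_UNIV[OF F]]
      by (simp add: lebesgue_on_UNIV_eq)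
    show "AE y in lebesgue. indicat_real {x..x + 1} y *\<^sub>R (2 * ((F y)\<^sup>2 + (g y)\<^sup>2)) = indicat_real {x..x + 1} y *\<^sub>R (2 * ((f y)\<^sup>2 + (g y)\<^sup>2))"
      using ae by eventually_elim simp
    show "(\<lambda>y. indicat_real {x..x + 1} y *\<^sub>R (2 * ((F y)\<^sup>2 + (g y)\<^sup>2))) \<in> borel_measurable lebesgue"
      using FM L2_measurable[OF f(2)] 
      by (intro borel_measurable_scaleR borel_measurable_indicator borel_measurable_times
          borel_measurable_add borel_measurable_power borel_measurable_const) (auto simp: lebesgue_on_UNIV_eq)
    show "(\<lambda>y. indicat_real {x..x + 1} y *\<^sub>R (2 * ((f y)\<^sup>2 + (g y)\<^sup>2))) \<in> borel_measurable lebesgue"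
      using L2_measurable[OF f(1)] L2_measurable[OF f(2)] 
      by (intro borel_measurable_scaleR borel_measurable_indicator borel_measurable_times
          borel_measurable_add borel_measurable_power borel_measurable_const) (auto simp: lebesgue_on_UNIV_eq)
  qed
  finally show ?thesis .
qed

lemma V_sup_bound:
  assumes "f \<in> V" "is_primitive UNIV F (dx f)" "AE y in lebesgue. f y = F y"
  shows "\<bar>F x\<bar> \<le> sqrt 2 * norm_V f"
proof -
  let ?q = "\<lambda>y. 2 * ((f y)\<^sup>2 + (dx f y)\<^sup>2)"
  have q: "integrable lebesgue ?q"
    using L2_square_integrable[OF H1_L2[OF assms(1)]] L2_square_integrable[OF weak_deriv_H1(1)[OF assms(1)]]
    by (simp add: lebesgue_on_UNIV_eq)
  have "(F x)\<^sup>2 \<le> (LINT y:{x..x+1}|lebesgue. ?q y)"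
    using assms by (intro sup_bound_on_unit_interval H1_L2 weak_deriv_H1)
  also have "\<dots> \<le> (LINT y|lebesgue. ?q y)"
    unfolding set_lebesgue_integral_def
    by (rule integral_mono[OF integrable_mult_indicator[OF _ q] q]) (auto simp: indicator_def)
  also have "\<dots> = 2 * (norm_V f)\<^sup>2"
    using L2_square_integrable[OF H1_L2[OF assms(1)]] L2_square_integrable[OF weak_deriv_H1(1)[OF assms(1)]]
    by (simp add: V.norm_H1_square norm_L2_square inner_L2_def lebesgue_on_UNIV_eq flip: power2_eq_square)
  finally have "sqrt ((F x)\<^sup>2) \<le> sqrt (2 * (norm_V f)\<^sup>2)" by (rule real_sqrt_le_mono)
  then show ?thesis by (simp add: real_sqrt_mult V.norm_H1_nonneg)
qed

lemma V_bounded: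
  assumes "f \<in> V"
  shows "AE x in lebesgue. \<bar>f x\<bar> \<le> sqrt 2 * norm_V f"
proof -
  obtain F where F: "is_primitive UNIV F (dx f)" "AE x in lebesgue. f x = F x"
    by (rule V_representation[OF assms])
  from F(2) show ?thesis by eventually_elim (use V_sup_bound[OF assms F] in simp)
qed

text \<open>Keeps the convection term \<open>f * dx f\<close> in \<open>H\<close>, so that its
  pairing with test functions is an inner product.\<close>

lemma V_mult_L2:
  assumes "f \<in> V" "g \<in> H"
  shows "(\<lambda>x. f x * g x) \<in> H" "norm_H (\<lambda>x. f x * g x) \<le> sqrt 2 * norm_V f * norm_H g"
proof -
  have b: "AE x in lebesgue_on UNIV. \<bar>f x\<bar> \<le> sqrt 2 * norm_V f"
    using V_bounded[OF assms(1)] by (simp only: lebesgue_on_UNIV_eq)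
  show "(\<lambda>x. f x * g x) \<in> H"
    by (rule L2_bounded_mult[OF L2_measurable[OF H1_L2[OF assms(1)]] b assms(2)])
  show "norm_H (\<lambda>x. f x * g x) \<le> sqrt 2 * norm_V f * norm_H g"
    by (rule norm_L2_bounded_mult[OF L2_measurable[OF H1_L2[OF assms(1)]] b _ assms(2)])
      (simp add: V.norm_H1_nonneg)
qed

lemma tendsto_indicator_integral_0:
  fixes q :: "real \<Rightarrow> real"
  assumes "integrable lebesgue q" "\<And>x. eventually (\<lambda>n. x \<notin> A n) sequentially" "\<And>n. A n \<in> sets lebesgue"
  shows "(\<lambda>n. LINT y:A n|lebesgue. q y) \<longlonglongrightarrow> 0"
proof -
  have "(\<lambda>n. LINT y|lebesgue. indicat_real (A n) y *\<^sub>R q y) \<longlonglongrightarrow> (LINT y::real|lebesgue. 0 :: real)"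
  proof (rule integral_dominated_convergence[where w = "\<lambda>y. \<bar>q y\<bar>"])
    show "(\<lambda>x. indicat_real (A i) x *\<^sub>R q x) \<in> borel_measurable lebesgue" for i
      using assms(1,3) by auto
    show "AE x in lebesgue. (\<lambda>i. indicat_real (A i) x *\<^sub>R q x) \<longlonglongrightarrow> 0"
    proof (rule AE_I2)
      fix x
      have "eventually (\<lambda>n. indicat_real (A n) x *\<^sub>R q x = 0) sequentially"
        using assms(2)[of x] by eventually_elim simp
      then show "(\<lambda>i. indicat_real (A i) x *\<^sub>R q x) \<longlonglongrightarrow> 0" by (rule tendsto_eventually)
    qed
    show "AE x in lebesgue. norm (indicat_real (A i) x *\<^sub>R q x) \<le> \<bar>q x\<bar>" for i
      by (rule AE_I2) (auto simp: indicator_def)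
  qed (use assms(1) in auto)
  then show ?thesis by (simp add: set_lebesgue_integral_def)
qed

text \<open>The unit intervals at \<open>n\<close> and at \<open>- n\<close> eventually leave every
  point, so the local bound for \<open>F\<close> tends to 0 by dominated convergence.\<close>

lemma V_vanishes_at_infinity:
  assumes "f \<in> V" "is_primitive UNIV F (dx f)" "AE y in lebesgue. f y = F y"
  shows "(\<lambda>n. F (real n)) \<longlonglongrightarrow> 0" "(\<lambda>n. F (- real n)) \<longlonglongrightarrow> 0"
proof -
  let ?q = "\<lambda>y. 2 * ((f y)\<^sup>2 + (dx f y)\<^sup>2)"
  have q: "integrable lebesgue ?q"
    using L2_square_integrable[OF H1_L2[OF assms(1)]] L2_square_integrable[OF weak_deriv_H1(1)[OF assms(1)]]
    by (simp add: lebesgue_on_UNIV_eq)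
  have le: "(F x)\<^sup>2 \<le> (LINT y:{x..x+1}|lebesgue. ?q y)" for x
    using assms by (intro sup_bound_on_unit_interval H1_L2 weak_deriv_H1)
  have *: "(\<lambda>n. F (p n)) \<longlonglongrightarrow> 0" if "\<And>x. eventually (\<lambda>n. x \<notin> {p n..p n + 1}) sequentially" for p
  proof -
    have "(\<lambda>n. LINT y:{p n..p n + 1}|lebesgue. ?q y) \<longlonglongrightarrow> 0"
      by (rule tendsto_indicator_integral_0[OF q that]) auto
    then have "(\<lambda>n. (F (p n))\<^sup>2) \<longlonglongrightarrow> 0"
      by (rule Lim_null_comparison[OF always_eventually, rotated]) (use le in auto)
    then have "(\<lambda>n. sqrt ((F (p n))\<^sup>2)) \<longlonglongrightarrow> sqrt 0" by (rule tendsto_real_sqrt)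
    then show ?thesis by (simp add: tendsto_rabs_zero_iff)
  qed
  show "(\<lambda>n. F (real n)) \<longlonglongrightarrow> 0"
  proof (rule *)
    fix x :: real
    obtain m where "x < real m" using reals_Archimedean2 by blast
    then show "eventually (\<lambda>n. x \<notin> {real n..real n + 1}) sequentially"
      by (intro eventually_sequentiallyI[of m]) auto
  qed
  show "(\<lambda>n. F (- real n)) \<longlonglongrightarrow> 0"
  proof (rule *)
    fix x :: real
    obtain m where "1 - x < real m" using reals_Archimedean2 by blast
    then show "eventually (\<lambda>n. x \<notin> {- real n..- real n + 1}) sequentially"
      by (intro eventually_sequentiallyI[of m]) auto
  qed
qed

text \<open>The left-hand side is the integral of the derivative of \<open>f\<^sup>2 g\<close>.\<close>

lemma V_cubic_identity:
  assumes f: "f \<in> V" and g: "g \<in> V"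
  shows "2 * inner_H (\<lambda>x. f x * dx f x) g + inner_H (\<lambda>x. f x * f x) (dx g) = 0"
proof -
  obtain F where F: "is_primitive UNIV F (dx f)" "AE x in lebesgue. f x = F x"
    by (rule V_representation[OF f])
  obtain G where G: "is_primitive UNIV G (dx g)" "AE x in lebesgue. g x = G x"
    by (rule V_representation[OF g])
  \<comment> \<open>\<open>?P\<close> uses the continuous representatives, for which boundary values
    make sense; \<open>?r\<close> is its derivative written with \<open>f\<close> and
    \<open>g\<close>, whose integrability over the line follows from the products in
    \<open>H\<close>.\<close>
  let ?P = "\<lambda>x. F x * F x * G x"
  let ?p = "\<lambda>x. (dx f x * F x + dx f x * F x) * G x + dx g x * (F x * F x)"
  let ?r = "\<lambda>x. 2 * (f x * dx f x * g x) + f x * f x * dx g x"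
  have P: "is_primitive UNIV ?P ?p" by (intro is_primitive_mult F G)
  have i1: "integrable lebesgue (\<lambda>x. f x * dx f x * g x)"
    using L2_mult_integrable[OF V_mult_L2(1)[OF f weak_deriv_H1(1)[OF f]] H1_L2[OF g]] by (simp add: lebesgue_on_UNIV_eq)
  have i2: "integrable lebesgue (\<lambda>x. f x * f x * dx g x)"
    using L2_mult_integrable[OF V_mult_L2(1)[OF f H1_L2[OF f]] weak_deriv_H1(1)[OF g]] by (simp add: lebesgue_on_UNIV_eq)
  have r: "integrable lebesgue ?r" using i1 i2 by simp
  have ae: "AE x in lebesgue. ?r x = ?p x" using F(2) G(2) by eventually_elim (simp add: algebra_simps)
  have int: "integral {- real n..real n} ?p = (LINT x:{- real n..real n}|lebesgue. ?r x)" for n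
  proof -
    have p: "?p absolutely_integrable_on {- real n..real n}" using is_primitiveD(2)[OF P] by auto
    have "integral {- real n..real n} ?p = (LINT x:{- real n..real n}|lebesgue. ?p x)"
      using set_lebesgue_integral_eq_integral(2)[OF p] by simp
    also have "\<dots> = (LINT x:{- real n..real n}|lebesgue. ?r x)"
      unfolding set_lebesgue_integral_def
    proof (rule integral_cong_AE)
      show "AE x in lebesgue. indicat_real {- real n..real n} x *\<^sub>R ?p x = indicat_real {- real n..real n} x *\<^sub>R ?r x"
        using ae by eventually_elim simp
      show "(\<lambda>x. indicat_real {- real n..real n} x *\<^sub>R ?p x) \<in> borel_measurable lebesgue"
        using p by (simp add: set_integrable_def)
      show "(\<lambda>x. indicat_real {- real n..real n} x *\<^sub>R ?r x) \<in> borel_measurable lebesgue"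
        using integrable_mult_indicator[OF _ r, of "{- real n..real n}"] by simp
    qed
    finally show ?thesis .
  qed
  have "(\<lambda>n. LINT x:- {- real n..real n}|lebesgue. ?r x) \<longlonglongrightarrow> 0"
  proof (rule tendsto_indicator_integral_0[OF r])
    fix x :: real
    obtain m where "\<bar>x\<bar> < real m" using reals_Archimedean2 by blast
    then show "eventually (\<lambda>n. x \<notin> - {- real n..real n}) sequentially"
      by (intro eventually_sequentiallyI[of m]) auto
  qed auto
  moreover have "(LINT x:- {- real n..real n}|lebesgue. ?r x) = (LINT x|lebesgue. ?r x) - (LINT x:{- real n..real n}|lebesgue. ?r x)" for n
  proof -
    have "(LINT x:- {- real n..real n}|lebesgue. ?r x) = (LINT x|lebesgue. ?r x - indicat_real {- real n..real n} x *\<^sub>R ?r x)"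
      unfolding set_lebesgue_integral_def by (rule Bochner_Integration.integral_cong) (auto simp: indicator_def)
    also have "\<dots> = (LINT x|lebesgue. ?r x) - (LINT x:{- real n..real n}|lebesgue. ?r x)"
      unfolding set_lebesgue_integral_def
      by (rule Bochner_Integration.integral_diff[OF r]) (rule integrable_mult_indicator[OF _ r], simp)
    finally show ?thesis .
  qed
  \<comment> \<open>The truncated integral is a difference of boundary values of \<open>?P\<close>,
    and these decay.\<close>
  moreover have "(\<lambda>n. LINT x:{- real n..real n}|lebesgue. ?r x) \<longlonglongrightarrow> 0"
  proof -
    have "(LINT x:{- real n..real n}|lebesgue. ?r x) = ?P (real n) - ?P (- real n)" for n
      using is_primitiveD(1)[OF P, of "- real n" "real n"] int[of n] by simp
    moreover have "(\<lambda>n. ?P (real n) - ?P (- real n)) \<longlonglongrightarrow> 0 * 0 * 0 - 0 * 0 * 0"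
      by (intro tendsto_intros V_vanishes_at_infinity[OF f F] V_vanishes_at_infinity[OF g G])
    ultimately show ?thesis by simp
  qed
  ultimately have "(\<lambda>n. (LINT x|lebesgue. ?r x) - (LINT x:{- real n..real n}|lebesgue. ?r x)) \<longlonglongrightarrow> 0"
    "(\<lambda>n. (LINT x|lebesgue. ?r x) - (LINT x:{- real n..real n}|lebesgue. ?r x)) \<longlonglongrightarrow> (LINT x|lebesgue. ?r x) - 0"
    by (simp, intro tendsto_intros)
  then have "(LINT x|lebesgue. ?r x) = 0" using LIMSEQ_unique by fastforce
  moreover have "(LINT x|lebesgue. ?r x) = 2 * inner_H (\<lambda>x. f x * dx f x) g + inner_H (\<lambda>x. f x * f x) (dx g)"
    using i1 i2 by (simp add: inner_L2_def lebesgue_on_UNIV_eq)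
  ultimately show ?thesis by simp
qed

section \<open>Duality pairings and time derivatives\<close>

lemma V_dual_bound:
  assumes F: "F \<in> V_dual" and v: "v \<in> V"
  shows "\<bar>F v\<bar> \<le> norm_V_dual F * norm_V v"
proof -
  obtain C where C: "\<And>f. f \<in> V \<Longrightarrow> \<bar>F f\<bar> \<le> C * norm_V f" using F unfolding V_dual_def by blast
  have bdd: "bdd_above ((\<lambda>f. \<bar>F f\<bar>) ` {f \<in> V. norm_V f \<le> 1})"
  proof (rule bdd_aboveI2)
    fix f assume "f \<in> {f \<in> V. norm_V f \<le> 1}"
    then have f: "f \<in> V" "norm_V f \<le> 1" by auto
    have "C * norm_V f \<le> \<bar>C\<bar> * norm_V f" by (intro mult_right_mono V.norm_H1_nonneg) simp
    also have "\<dots> \<le> \<bar>C\<bar> * 1" using f(2) by (intro mult_left_mono) auto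
    finally show "\<bar>F f\<bar> \<le> \<bar>C\<bar>" using C[OF f(1)] by simp
  qed
  show ?thesis
  proof (cases "norm_V v = 0")
    \<comment> \<open>A function of norm 0 need not vanish at every point; the bound
      \<open>C\<close> then forces \<open>F v\<close> to be 0, so nothing has to be divided by the
      norm.\<close>
    case True
    then show ?thesis using C[OF v] by simp
  next
    case False
    then have n: "0 < norm_V v" using V.norm_H1_nonneg[of v] by simp
    let ?u = "\<lambda>x. 1 / norm_V v * v x"
    have "?u \<in> V" by (rule V.H1_cmult(1)[OF v])
    moreover have "norm_V ?u = 1" unfolding V.norm_H1_cmult[OF v] using n by simp
    ultimately have "\<bar>F ?u\<bar> \<le> norm_V_dual F"
      unfolding norm_V_dual_def by (intro cSUP_upper[OF _ bdd]) auto
    moreover have "F ?u = 1 / norm_V v * F v"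
      using F v unfolding V_dual_def by blast
    ultimately have le: "\<bar>1 / norm_V v * F v\<bar> \<le> norm_V_dual F" by (simp only:)
    have "\<bar>F v\<bar> = norm_V v * \<bar>1 / norm_V v * F v\<bar>" using n by (simp add: abs_mult)
    also have "\<dots> \<le> norm_V v * norm_V_dual F" using le n by (intro mult_left_mono) auto
    finally show ?thesis by (simp add: mult.commute)
  qed
qed

lemma V_dual_diff:
  assumes F: "F \<in> V_dual" and G: "G \<in> V_dual"
  shows "(\<lambda>v. F v - G v) \<in> V_dual"
proof -
  obtain C where C: "\<And>f. f \<in> V \<Longrightarrow> \<bar>F f\<bar> \<le> C * norm_V f" using F unfolding V_dual_def by blast
  obtain D where D: "\<And>f. f \<in> V \<Longrightarrow> \<bar>G f\<bar> \<le> D * norm_V f" using G unfolding V_dual_def by blast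
  have bd: "\<bar>F f - G f\<bar> \<le> (C + D) * norm_V f" if "f \<in> V" for f
    using C[OF that] D[OF that] by (simp add: distrib_right)
  have F': "F (\<lambda>x. f x + g x) = F f + F g" "G (\<lambda>x. f x + g x) = G f + G g"
    if "f \<in> V" "g \<in> V" for f g
    using F G that by (simp_all add: V_dual_def)
  have F'': "F (\<lambda>x. c * f x) = c * F f" "G (\<lambda>x. c * f x) = c * G f"
    if "f \<in> V" for f c
    using F G that by (simp_all add: V_dual_def)
  show ?thesis
    unfolding V_dual_def mem_Collect_eq
    using bd by (intro conjI allI ballI exI[of _ "C + D"]) (simp_all add: F' F'' right_diff_distrib)
qed

section \<open>Scalar functions of time obtained by pairing with a fixed test function\<close>

lemma measurable_lebesgue_on_AE_cong:
  fixes f g :: "real \<Rightarrow> real"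
  assumes "S \<in> sets lebesgue" "f \<in> borel_measurable (lebesgue_on S)" "AE x in lebesgue_on S. f x = g x"
  shows "g \<in> borel_measurable (lebesgue_on S)"
proof -
  have "(\<lambda>x. if x \<in> S then f x else 0) \<in> borel_measurable lebesgue"
    using assms(1,2) by (simp add: borel_measurable_if)
  moreover have "AE x in lebesgue. (if x \<in> S then f x else 0) = (if x \<in> S then g x else 0)"
    using assms(1,3) by (simp add: AE_restrict_space_iff)
  ultimately have "(\<lambda>x. if x \<in> S then g x else 0) \<in> borel_measurable lebesgue"
    by (rule borel_measurable_AE)
  then show ?thesis using assms(1) by (simp add: borel_measurable_if)
qed

lemma measurable_lebesgue_on_AE_limit:
  fixes f :: "nat \<Rightarrow> real \<Rightarrow> real"
  assumes "S \<in> sets lebesgue" "\<And>n. f n \<in> borel_measurable (lebesgue_on S)"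
    and "AE x in lebesgue_on S. (\<lambda>n. f n x) \<longlonglongrightarrow> g x"
  shows "g \<in> borel_measurable (lebesgue_on S)"
proof (rule measurable_lebesgue_on_AE_cong[OF assms(1)])
  show "(\<lambda>x. lim (\<lambda>n. f n x)) \<in> borel_measurable (lebesgue_on S)"
    using assms(2) by (rule borel_measurable_lim_metric)
  show "AE x in lebesgue_on S. lim (\<lambda>n. f n x) = g x"
    using assms(3) by eventually_elim (rule limI)
qed

text \<open>Evaluation at \<open>v\<close> is continuous in the dual norm, so the values at
  \<open>v\<close> of the approximating simple functions converge almost everywhere.\<close>

lemma dual_pairing_measurable:
  assumes "strongly_measurable T V_dual norm_V_dual g" "v \<in> V"
  shows "(\<lambda>t. g t v) \<in> borel_measurable (lebesgue_on {0<..<T})"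
proof -
  from assms(1) obtain s where
    V: "AE t in lebesgue_on {0<..<T}. g t \<in> V_dual" and
    s: "\<And>n. simple_function (lebesgue_on {0<..<T}) (s n)" "\<And>n. s n ` {0<..<T} \<subseteq> V_dual" and
    lim: "AE t in lebesgue_on {0<..<T}. (\<lambda>n::nat. norm_V_dual (\<lambda>z. s n t z - g t z)) \<longlonglongrightarrow> 0"
    unfolding strongly_measurable_def by auto
  have "AE t in lebesgue_on {0<..<T}. t \<in> {0<..<T}" by (rule AE_I2) simp
  with V lim have conv: "AE t in lebesgue_on {0<..<T}. (\<lambda>n. s n t v) \<longlonglongrightarrow> g t v"
  proof eventually_elim
    case (elim t)
    have "(\<lambda>n. norm_V_dual (\<lambda>z. s n t z - g t z) * norm_V v) \<longlonglongrightarrow> 0"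
      by (rule tendsto_mult_left_zero[OF elim(2)])
    moreover have "norm (s n t v - g t v) \<le> norm_V_dual (\<lambda>z. s n t z - g t z) * norm_V v" for n
    proof -
      have "s n t \<in> V_dual" using s(2)[of n] elim(3) by blast
      from V_dual_bound[OF V_dual_diff[OF this elim(1)] assms(2)] show ?thesis by simp
    qed
    ultimately have "(\<lambda>n. s n t v - g t v) \<longlonglongrightarrow> 0"
      by (intro Lim_null_comparison[of "\<lambda>n. s n t v - g t v"] always_eventually) auto
    then show ?case by (simp add: LIM_zero_iff)
  qed
  have "(\<lambda>t. s n t v) \<in> borel_measurable (lebesgue_on {0<..<T})" for n
    by (rule borel_measurable_simple_function[OF simple_function_compose1[OF s(1), of "\<lambda>F. F v" n]])
  from measurable_lebesgue_on_AE_limit[OF _ this conv] show ?thesis by simp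
qed

lemma dual_pairing_integrable:
  assumes "g \<in> Bochner_L2 T V_dual norm_V_dual" "v \<in> V"
  shows "integrable (lebesgue_on {0<..<T}) (\<lambda>t. g t v)"
proof (rule Bochner_Integration.integrable_bound)
  have sm: "strongly_measurable T V_dual norm_V_dual g"
    and sq: "integrable (lebesgue_on {0<..<T}) (\<lambda>t. (norm_V_dual (g t))\<^sup>2)"
    using assms(1) by (auto simp: Bochner_L2_def)
  have fin: "finite_measure (lebesgue_on {0<..<T})"
    by (intro finite_measure_lebesgue_on) auto
  show "integrable (lebesgue_on {0<..<T}) (\<lambda>t. (1 + (norm_V_dual (g t))\<^sup>2) * norm_V v)"
    by (intro integrable_mult_left Bochner_Integration.integrable_add sq finite_measure.integrable_const[OF fin])
  show "(\<lambda>t. g t v) \<in> borel_measurable (lebesgue_on {0<..<T})"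
    by (rule dual_pairing_measurable[OF sm assms(2)])
  have "AE t in lebesgue_on {0<..<T}. g t \<in> V_dual"
    using sm by (simp add: strongly_measurable_def)
  then show "AE t in lebesgue_on {0<..<T}. norm (g t v) \<le> norm ((1 + (norm_V_dual (g t))\<^sup>2) * norm_V v)"
  proof eventually_elim
    case (elim t)
    \<comment> \<open>On a bounded interval square integrability in time gives integrability; this
      is the majorant.\<close>
    have "norm_V_dual (g t) \<le> 1 + (norm_V_dual (g t))\<^sup>2"
    proof -
      have "2 * norm_V_dual (g t) * 1 \<le> (norm_V_dual (g t))\<^sup>2 + 1\<^sup>2"
        by (rule sum_squares_bound)
      moreover have "0 \<le> (norm_V_dual (g t))\<^sup>2" by simp
      ultimately show ?thesis unfolding power_one by linarith
    qed
    then have "norm_V_dual (g t) * norm_V v \<le> (1 + (norm_V_dual (g t))\<^sup>2) * norm_V v"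
      by (intro mult_right_mono V.norm_H1_nonneg)
    with V_dual_bound[OF elim assms(2)] show ?case by (simp add: abs_le_iff)
  qed
qed

text \<open>The set where \<open>h\<close> is nonzero is open, and a nonempty open set is not
  negligible.\<close>

lemma AE_zero_continuous:
  fixes h :: "real \<Rightarrow> real"
  assumes "open S" "continuous_on S h" "AE x in lebesgue_on S. h x = 0" "x \<in> S"
  shows "h x = 0"
proof (rule ccontr)
  assume nz: "h x \<noteq> 0"
  let ?U = "S \<inter> h -` (- {0})"
  have "open ?U"
    using assms(1,2) by (intro continuous_open_preimage) auto
  moreover have "x \<in> ?U" using nz assms(4) by simp
  moreover have "negligible ?U"
  proof -
    have "AE x in lebesgue. x \<in> S \<longrightarrow> h x = 0"
      using assms(1,3) by (simp add: AE_restrict_space_iff)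
    then have "AE x in lebesgue. x \<notin> ?U" by eventually_elim auto
    then have "?U \<in> null_sets lebesgue"
      using \<open>open ?U\<close> by (subst AE_iff_null_sets) auto
    then show ?thesis by (simp add: negligible_iff_null_sets)
  qed
  ultimately show False using open_not_negligible by blast
qed

lemma continuous_into_H_inner:
  assumes "continuous_into_H T y" "v \<in> H"
  shows "continuous_on {0..T} (\<lambda>t. inner_H (y t) v)"
  unfolding continuous_on_def
proof
  fix t assume t: "t \<in> {0..T}"
  have yH: "\<And>t. t \<in> {0..T} \<Longrightarrow> y t \<in> H" using assms(1) by (simp add: continuous_into_H_def)
  have "((\<lambda>s. norm_H (\<lambda>x. y s x - y t x) * norm_H v) \<longlongrightarrow> 0) (at t within {0..T})"
    using assms(1) t by (intro tendsto_mult_left_zero) (auto simp: continuous_into_H_def)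
  moreover have "\<forall>\<^sub>F s in at t within {0..T}. norm (inner_H (y s) v - inner_H (y t) v) \<le> norm_H (\<lambda>x. y s x - y t x) * norm_H v"
    unfolding eventually_at_filter
  proof (rule always_eventually, safe)
    fix s assume "s \<in> {0..T}"
    then show "norm (inner_H (y s) v - inner_H (y t) v) \<le> norm_H (\<lambda>x. y s x - y t x) * norm_H v"
      using Cauchy_Schwarz_L2[OF L2_diff[OF yH yH] assms(2), of s t] t yH assms(2)
      by (simp add: inner_L2_diff_left)
  qed
  ultimately have "((\<lambda>s. inner_H (y s) v - inner_H (y t) v) \<longlongrightarrow> 0) (at t within {0..T})"
    by (rule Lim_null_comparison[rotated])
  then show "((\<lambda>s. inner_H (y s) v) \<longlongrightarrow> inner_H (y t) v) (at t within {0..T})"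
    by (simp add: LIM_zero_iff)
qed

text \<open>End points are null sets. Used to pass between the spaces over the open time interval
  and integrals over closed intervals.\<close>

lemma absolutely_integrable_Icc_iff:
  fixes f :: "real \<Rightarrow> real"
  shows "f absolutely_integrable_on {a..b} \<longleftrightarrow> integrable (lebesgue_on {a<..<b}) f"
proof -
  have "f absolutely_integrable_on {a..b} \<longleftrightarrow> f absolutely_integrable_on {a<..<b}"
    by (rule absolutely_integrable_spike_set_eq; rule negligible_subset[of "{a, b}"]) auto
  then show ?thesis by (simp add: set_integrable_def integrable_restrict_space)
qed

text \<open>A primitive on the open interval says nothing about the end points; integrability of
  \<open>g\<close> up to 0 and \<open>T\<close> provides the continuous extension.\<close>

lemma primitive_extends_to_Icc:
  assumes T: "0 < T" and g: "g absolutely_integrable_on {0..T}" and F: "is_primitive {0<..<T} F g"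
  obtains E where "continuous_on {0..T} E" "\<And>t. t \<in> {0<..<T} \<Longrightarrow> E t = F t"
    "\<And>s t. 0 \<le> s \<Longrightarrow> s \<le> t \<Longrightarrow> t \<le> T \<Longrightarrow> E t - E s = integral {s..t} g"
proof -
  let ?m = "T / 2"
  \<comment> \<open>Anchored at the midpoint, where \<open>F\<close> is known to be a primitive; 0
    lies outside the open interval.\<close>
  define E where "E t = F ?m - integral {0..?m} g + integral {0..t} g" for t
  have comb: "E t - E s = integral {s..t} g" if "0 \<le> s" "s \<le> t" "t \<le> T" for s t
  proof -
    have "g integrable_on {0..t}"
      using absolutely_integrable_on_subinterval[OF g, of 0 t] that set_lebesgue_integral_eq_integral(1) by auto
    from Henstock_Kurzweil_Integration.integral_combine[OF that(1,2) this] show ?thesis by (simp add: E_def)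
  qed
  have Em: "E ?m = F ?m" by (simp add: E_def)
  have EF: "E t = F t" if "t \<in> {0<..<T}" for t
  proof (cases "t \<le> ?m")
    case True
    have "{t..?m} \<subseteq> {0<..<T}" using that True T by auto
    with is_primitiveD(1)[OF F True] comb[of t ?m] Em that True T show ?thesis by simp
  next
    case False
    have "{?m..t} \<subseteq> {0<..<T}" using that False T by auto
    with is_primitiveD(1)[OF F, of ?m t] comb[of ?m t] Em that False T show ?thesis by simp
  qed
  have "continuous_on {0..T} E"
    unfolding E_def using g
    by (intro continuous_intros indefinite_integral_continuous_1 set_lebesgue_integral_eq_integral)
  then show ?thesis using that EF comb by blast
qed

text \<open>For fixed \<open>v\<close> the time derivative becomes a scalar weak derivative, so the
  pairing of \<open>y\<close> with \<open>v\<close> is almost everywhere a primitive of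
  \<open>g t v\<close>. Continuity into \<open>H\<close> removes the null set and carries the
  identity to the end points, where the initial and final values live.\<close>

lemma time_deriv_increment:
  assumes "T > 0" "continuous_into_H T y" "is_time_deriv T y g" "g \<in> Bochner_L2 T V_dual norm_V_dual"
    and v: "v \<in> V" and ab: "0 \<le> a" "a \<le> b" "b \<le> T"
  shows "inner_H (y b) v - inner_H (y a) v = integral {a..b} (\<lambda>t. g t v)"
proof -
  let ?I = "{0<..<T}"
  let ?f = "\<lambda>t. inner_H (y t) v" and ?g = "\<lambda>t. g t v"
  have cf: "continuous_on {0..T} ?f" by (rule continuous_into_H_inner[OF assms(2) H1_L2[OF v]])
  have gi: "?g absolutely_integrable_on {0..T}"
    using dual_pairing_integrable[OF assms(4) v] by (simp add: absolutely_integrable_Icc_iff)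
  have lg: "locally_integrable ?I ?g"
    unfolding locally_integrable_def
  proof safe
    fix c d assume "{c..d} \<subseteq> ?I"
    then have "{c..d} \<subseteq> {0..T}" by fastforce
    then show "?g absolutely_integrable_on {c..d}" by (rule absolutely_integrable_on_subinterval[OF gi])
  qed
  have lf: "locally_integrable ?I ?f"
    by (intro locally_integrable_continuous continuous_on_subset[OF cf]) (auto simp: subset_iff)
  have "is_weak_deriv ?I ?f ?g"
    using assms(3) v unfolding is_time_deriv_def is_weak_deriv_def by (simp add: mult.commute)
  then obtain F where F: "is_primitive ?I F ?g" "AE t in lebesgue_on ?I. ?f t = F t"
    using weak_deriv_representation[OF _ _ lf lg] by (auto simp: is_interval_1)
  obtain E where E: "continuous_on {0..T} E" "\<And>t. t \<in> ?I \<Longrightarrow> E t = F t"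
    "\<And>s t. 0 \<le> s \<Longrightarrow> s \<le> t \<Longrightarrow> t \<le> T \<Longrightarrow> E t - E s = integral {s..t} ?g"
    using primitive_extends_to_Icc[OF assms(1) gi F(1)] by blast
  have cfE: "continuous_on {0..T} (\<lambda>t. ?f t - E t)" by (intro continuous_intros cf E(1))
  have "AE t in lebesgue_on ?I. t \<in> ?I" by (rule AE_I2) simp
  with F(2) have "AE t in lebesgue_on ?I. ?f t - E t = 0" by eventually_elim (simp add: E(2))
  then have eq: "?f t - E t = 0" if "t \<in> ?I" for t
    by (rule AE_zero_continuous[rotated 2]) (use that in \<open>auto intro: continuous_on_subset[OF cfE]\<close>)
  have cl: "closure ?I = {0..T}" using assms(1) by simp
  have "?f t - E t = 0" if "t \<in> {0..T}" for t
    using continuous_constant_on_closure[OF cfE[folded cl] eq] that unfolding cl by blast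
  from this[of a] this[of b] E(3)[OF ab] ab show ?thesis by simp
qed

section \<open>Difference quotients in time\<close>

lemma AE_lebesgue_not_eq: "AE x in lebesgue. x \<noteq> (c :: real)"
  by (rule AE_completion[OF AE_lborel_singleton])

lemma AE_lebesgue_on_Ioo_imp_Icc:
  fixes T :: real
  assumes "AE t in lebesgue_on {0<..<T}. P t"
  shows "AE t in lebesgue. t \<in> {0..T} \<longrightarrow> t \<in> {0<..<T} \<and> P t"
proof -
  have "{0<..<T} \<inter> space lebesgue \<in> sets lebesgue" by simp
  from AE_restrict_space_iff[OF this, of P] assms
  have "AE t in lebesgue. t \<in> {0<..<T} \<longrightarrow> P t" by simp
  with AE_lebesgue_not_eq[of 0] AE_lebesgue_not_eq[of T] show ?thesis
    by eventually_elim (auto simp: less_le)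
qed

lemma abs_integral_le_AE:
  fixes m :: "real \<Rightarrow> real"
  assumes "a \<le> b" "m absolutely_integrable_on {a..b}" "AE x in lebesgue. x \<in> {a..b} \<longrightarrow> \<bar>m x\<bar> \<le> L"
  shows "\<bar>integral {a..b} m\<bar> \<le> L * (b - a)"
proof -
  have "\<bar>integral {a..b} m\<bar> = \<bar>LINT x:{a..b}|lebesgue. m x\<bar>"
    using set_lebesgue_integral_eq_integral(2)[OF assms(2)] by simp
  also have "\<dots> \<le> (LINT x:{a..b}|lebesgue. \<bar>m x\<bar>)"
    using set_integral_norm_bound[OF assms(2)] by simp
  also have "\<dots> \<le> (LINT x:{a..b}|lebesgue. L)"
    unfolding set_lebesgue_integral_def
  proof (rule integral_mono_AE)
    show "integrable lebesgue (\<lambda>x. indicat_real {a..b} x *\<^sub>R \<bar>m x\<bar>)"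
      using set_integrable_abs[OF assms(2)] by (simp add: set_integrable_def)
    show "integrable lebesgue (\<lambda>x. indicat_real {a..b} x *\<^sub>R L)"
      by (rule integrable_scaleR_left) (simp add: integrable_indicator_iff emeasure_lborel_Icc_eq)
    show "AE x in lebesgue. indicat_real {a..b} x *\<^sub>R \<bar>m x\<bar> \<le> indicat_real {a..b} x *\<^sub>R L"
      using assms(3) by eventually_elim (auto simp: indicator_def)
  qed
  also have "\<dots> = L * (b - a)" using assms(1) by (simp add: set_lebesgue_integral_def)
  finally show ?thesis .
qed

lemma integral_shift_real:
  fixes \<beta> :: "real \<Rightarrow> real"
  assumes "continuous_on UNIV \<beta>"
  shows "integral {a..b} (\<lambda>x. \<beta> (x - h)) = integral {a - h..b - h} \<beta>"
proof (rule integral_unique)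
  have "(\<beta> has_integral integral {a - h..b - h} \<beta>) (cbox (a - h) (b - h))"
    using assms by (auto intro!: integrable_integral integrable_continuous_real intro: continuous_on_subset)
  from has_integral_affinity'[OF this, of 1 "- h"]
  show "((\<lambda>x. \<beta> (x - h)) has_integral integral {a - h..b - h} \<beta>) {a..b}" by simp
qed

text \<open>A change of variable turns the averaged backward quotients into backward quotients of an
  antiderivative of \<open>\<beta>\<close> at the two ends, so continuity of \<open>\<beta>\<close>
  is enough.\<close>

lemma integral_difference_quotient_tendsto:
  fixes \<beta> :: "real \<Rightarrow> real"
  assumes c: "continuous_on UNIV \<beta>" and t: "0 \<le> t"
  shows "(\<lambda>k. integral {0..t} (\<lambda>b. (\<beta> b - \<beta> (b - 1 / real (Suc k))) / (1 / real (Suc k)))) \<longlonglongrightarrow> \<beta> t - \<beta> 0"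
proof -
  let ?h = "\<lambda>k. 1 / real (Suc k)"
  \<comment> \<open>The antiderivative starts at -1 because the steps reach back to
    \<open>0 - ?h k\<close>, with \<open>?h k \<le> 1\<close>.\<close>
  define B where "B x = integral {-1..x} \<beta>" for x
  have c': "continuous_on A \<beta>" for A using c continuous_on_subset by blast
  have int: "\<beta> integrable_on {x..y}" for x y by (intro integrable_continuous_real c')
  have hlim: "filterlim (\<lambda>k. - ?h k) (at 0) sequentially"
  proof (rule filterlim_atI)
    have "(\<lambda>k. - inverse (real (Suc k))) \<longlonglongrightarrow> - 0"
      by (intro tendsto_minus LIMSEQ_inverse_real_of_nat)
    then show "(\<lambda>k. - ?h k) \<longlonglongrightarrow> 0" by (simp add: inverse_eq_divide)
  qed simp
  have quot: "(\<lambda>k. (B x - B (x - ?h k)) / ?h k) \<longlonglongrightarrow> \<beta> x" if "0 \<le> x" for x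
  proof -
    have "(B has_real_derivative \<beta> x) (at x within {-1..x + 1})"
      unfolding B_def has_real_derivative_iff_has_vector_derivative
      by (rule integral_has_vector_derivative[OF c']) (use that in auto)
    moreover have "at x within {-1..x + 1} = at x"
      by (rule at_within_interior) (use that in auto)
    ultimately have "((\<lambda>h. (B (x + h) - B x) / h) \<longlongrightarrow> \<beta> x) (at 0)" by (simp add: DERIV_def)
    from filterlim_compose[OF this hlim] show ?thesis by (simp add: field_simps)
  qed
  have eq: "integral {0..t} (\<lambda>b. (\<beta> b - \<beta> (b - ?h k)) / ?h k) = (B t - B (t - ?h k)) / ?h k - (B 0 - B (0 - ?h k)) / ?h k" for k
  proof -
    have h: "0 < ?h k" "?h k \<le> 1" by simp_all
    have comb: "integral {x..y} \<beta> = B y - B x" if "-1 \<le> x" "x \<le> y" for x y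
      using Henstock_Kurzweil_Integration.integral_combine[OF that int] by (simp add: B_def)
    have "integral {0..t} (\<lambda>b. (\<beta> b - \<beta> (b - ?h k)) / ?h k) = integral {0..t} (\<lambda>b. \<beta> b - \<beta> (b - ?h k)) / ?h k"
      by (rule integral_divide)
    also have "integral {0..t} (\<lambda>b. \<beta> b - \<beta> (b - ?h k)) = integral {0..t} \<beta> - integral {0..t} (\<lambda>b. \<beta> (b - ?h k))"
      by (rule Henstock_Kurzweil_Integration.integral_diff[OF int])
        (intro integrable_continuous_real continuous_on_compose2[OF c] continuous_intros, rule subset_UNIV)
    also have "\<dots> = (B t - B 0) - (B (t - ?h k) - B (0 - ?h k))"
      using comb[of 0 t] comb[of "0 - ?h k" "t - ?h k"] h t
      unfolding integral_shift_real[OF c] by simp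
    finally show ?thesis by (simp only: diff_divide_distrib)
  qed
  show ?thesis unfolding eq by (intro tendsto_diff quot t order_refl)
qed

lemma difference_quotient_tendsto:
  fixes \<beta> m :: "real \<Rightarrow> real"
  assumes t: "0 \<le> t" and lip: "\<And>a b. \<bar>\<beta> b - \<beta> a\<bar> \<le> L * \<bar>b - a\<bar>"
    and m: "m absolutely_integrable_on {0..t}"
    and inc: "\<And>d. 0 \<le> d \<Longrightarrow> d \<le> t \<Longrightarrow> \<beta> d - \<beta> 0 = integral {0..d} m"
    and E: "E \<in> sets lebesgue"
  shows "(\<lambda>k. LINT b:{0..t}|lebesgue. indicat_real E b * ((\<beta> b - \<beta> (b - 1 / real (Suc k))) / (1 / real (Suc k))))
    \<longlonglongrightarrow> (LINT b:{0..t}|lebesgue. indicat_real E b * m b)"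
proof -
  let ?h = "\<lambda>k. 1 / real (Suc k)"
  let ?q = "\<lambda>k b. (\<beta> b - \<beta> (b - ?h k)) / ?h k"
  let ?f = "\<lambda>k b. indicat_real {0..t} b * ?q k b" and ?g = "\<lambda>b. indicat_real {0..t} b * m b"
  have L: "0 \<le> L" using lip[of 1 0] by simp
  have c: "continuous_on UNIV \<beta>"
  proof (rule continuous_onI)
    fix x e :: real assume e: "0 < e"
    show "\<exists>d>0. \<forall>x'\<in>UNIV. dist x' x < d \<longrightarrow> dist (\<beta> x') (\<beta> x) \<le> e"
    proof (intro exI[of _ "e / (L + 1)"] conjI ballI impI)
      show "0 < e / (L + 1)" using e L by simp
      fix x' assume "dist x' x < e / (L + 1)"
      then have "L * \<bar>x' - x\<bar> \<le> L * (e / (L + 1))" using L by (intro mult_left_mono) (auto simp: dist_real_def)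
      also have "\<dots> \<le> e" using L e by (simp add: field_simps)
      finally show "dist (\<beta> x') (\<beta> x) \<le> e" using lip[of x' x] by (simp add: dist_real_def)
    qed
  qed
  have cq: "continuous_on A (?q k)" for A k
    by (intro continuous_intros continuous_on_compose2[OF c]) auto
  have aq: "?q k absolutely_integrable_on {0..d}" for d k
    by (intro absolutely_integrable_continuous_real cq)
  have am: "m absolutely_integrable_on {0..d}" if "d \<le> t" for d
    by (rule absolutely_integrable_on_subinterval[OF m]) (use that in auto)
  have fi: "integrable lebesgue (?f k)" for k using aq[of t k] by (simp add: set_integrable_def)
  have gi: "integrable lebesgue ?g" using m by (simp add: set_integrable_def)
  have wi: "integrable lebesgue (\<lambda>b. L * indicat_real {0..t} b)"
    by (rule integrable_mult_right) (simp add: integrable_indicator_iff emeasure_lborel_Icc_eq)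
  have bound: "\<bar>?f k b\<bar> \<le> L * indicat_real {0..t} b" for k b
  proof -
    have "\<bar>\<beta> b - \<beta> (b - ?h k)\<bar> \<le> L * ?h k" using lip[of b "b - ?h k"] by simp
    then have "\<bar>\<beta> b - \<beta> (b - ?h k)\<bar> / ?h k \<le> (L * ?h k) / ?h k" by (rule divide_right_mono) simp
    moreover have "\<bar>?q k b\<bar> = \<bar>\<beta> b - \<beta> (b - ?h k)\<bar> / ?h k" by (subst abs_divide) simp
    moreover have "(L * ?h k) / ?h k = L" by simp
    ultimately have "\<bar>?q k b\<bar> \<le> L" by linarith
    then show ?thesis by (simp add: indicator_def)
  qed
  have int: "(LINT x:{0..d}|lebesgue. p x) = integral {0..d} p" if "p absolutely_integrable_on {0..d}" for p :: "real \<Rightarrow> real" and d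
    using set_lebesgue_integral_eq_integral(2)[OF that] .
  have lim0: "(\<lambda>k. LINT x:{0..d}|lebesgue. ?q k x) \<longlonglongrightarrow> (LINT x:{0..d}|lebesgue. m x)" if "0 \<le> d" "d \<le> t" for d
    unfolding int[OF aq] int[OF am[OF that(2)]]
    using integral_difference_quotient_tendsto[OF c that(1)] inc[OF that] by simp
  have lim: "(\<lambda>k. LINT x:{..d}|lebesgue. ?f k x) \<longlonglongrightarrow> (LINT x:{..d}|lebesgue. ?g x)" for d
  proof (cases "0 \<le> d")
    case True
    have "(LINT x:{..d}|lebesgue. indicat_real {0..t} x * p x) = (LINT x:{0..min d t}|lebesgue. p x)" for p :: "real \<Rightarrow> real"
      unfolding set_lebesgue_integral_def
      by (rule Bochner_Integration.integral_cong) (auto simp: indicator_def)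
    then show ?thesis using lim0[of "min d t"] True t by simp
  next
    case False
    have "(LINT x:{..d}|lebesgue. indicat_real {0..t} x * p x) = 0" for p :: "real \<Rightarrow> real"
      unfolding set_lebesgue_integral_def
      by (rule integral_eq_zero_AE, rule AE_I2) (use False in \<open>auto simp: indicator_def\<close>)
    then show ?thesis by simp
  qed
  have lim_UNIV: "(\<lambda>k. LINT x|lebesgue. ?f k x) \<longlonglongrightarrow> (LINT x|lebesgue. ?g x)"
    using lim0[OF t order_refl] unfolding set_lebesgue_integral_def real_scaleR_def .
  \<comment> \<open>\<open>E\<close> is Lebesgue measurable, so it is first replaced by a Borel set
    that agrees with it up to a null set.\<close>
  obtain i where i: "i \<in> borel_measurable lborel" "AE x in lebesgue. indicat_real E x = i x"
    using completion_ex_borel_measurable_real[of "indicat_real E" lborel] E by (auto intro: AE_completion)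
  let ?E = "{x. i x = 1}"
  have Eb: "?E \<in> sets borel"
  proof -
    have "{x \<in> space lborel. i x = 1} \<in> sets lborel" using i(1) by measurable
    then show ?thesis by simp
  qed
  have Eeq: "(LINT x:?E|lebesgue. indicat_real {0..t} x * p x) = (LINT x:{0..t}|lebesgue. indicat_real E x * p x)"
    if "integrable lebesgue (\<lambda>x. indicat_real {0..t} x * p x)" for p
    unfolding set_lebesgue_integral_def
  proof (rule integral_cong_AE)
    show "AE x in lebesgue. indicat_real ?E x *\<^sub>R (indicat_real {0..t} x * p x) = indicat_real {0..t} x *\<^sub>R (indicat_real E x * p x)"
      using i(2)
    proof eventually_elim
      case (elim x)
      then show ?case by (cases "x \<in> E") (auto simp: indicator_def)
    qed
    show "(\<lambda>x. indicat_real ?E x *\<^sub>R (indicat_real {0..t} x * p x)) \<in> borel_measurable lebesgue"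
      using integrable_mult_indicator[OF _ that, of ?E] Eb by simp
    have "(\<lambda>x. indicat_real {0..t} x *\<^sub>R (indicat_real E x * p x)) = (\<lambda>x. indicat_real E x *\<^sub>R (indicat_real {0..t} x * p x))"
      by auto
    then show "(\<lambda>x. indicat_real {0..t} x *\<^sub>R (indicat_real E x * p x)) \<in> borel_measurable lebesgue"
      using integrable_mult_indicator[OF E that] by simp
  qed
  have "(\<lambda>k. LINT x:?E|lebesgue. ?f k x) \<longlonglongrightarrow> (LINT x:?E|lebesgue. ?g x)"
    by (rule set_integral_limit_borel[OF fi gi wi AE_I2[OF bound] lim lim_UNIV Eb])
  then show ?thesis unfolding Eeq[OF fi] Eeq[OF gi] .
qed

section \<open>The energy estimate\<close>

lemma continuous_into_H_norm:
  assumes "continuous_into_H T y"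
  shows "continuous_on {0..T} (\<lambda>t. inner_H (y t) (y t))"
proof -
  have "continuous_on {0..T} (\<lambda>t. norm_H (y t))"
    unfolding continuous_on_def
  proof
    fix t assume t: "t \<in> {0..T}"
    have yH: "\<And>t. t \<in> {0..T} \<Longrightarrow> y t \<in> H" using assms(1) by (simp add: continuous_into_H_def)
    have "((\<lambda>s. norm_H (\<lambda>x. y s x - y t x)) \<longlongrightarrow> 0) (at t within {0..T})"
      using assms(1) t by (auto simp: continuous_into_H_def)
    moreover have "\<forall>\<^sub>F s in at t within {0..T}. norm (norm_H (y s) - norm_H (y t)) \<le> norm_H (\<lambda>x. y s x - y t x)"
      unfolding eventually_at_filter
      by (rule always_eventually) (simp add: abs_norm_L2_diff_le yH[OF t] yH)
    ultimately have "((\<lambda>s. norm_H (y s) - norm_H (y t)) \<longlongrightarrow> 0) (at t within {0..T})"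
      by (rule Lim_null_comparison[rotated])
    then show "((\<lambda>s. norm_H (y s)) \<longlongrightarrow> norm_H (y t)) (at t within {0..T})"
      by (simp add: LIM_zero_iff)
  qed
  then have "continuous_on {0..T} (\<lambda>t. (norm_H (y t))\<^sup>2)" by (intro continuous_intros)
  then show ?thesis by (simp add: norm_L2_square)
qed

text \<open>\<open>w\<close> is the difference of two states, \<open>G\<close> its time derivative
  and \<open>A\<close> the difference of the right-hand sides. \<open>G\<close> and \<open>A\<close>
  are kept apart because they agree only for one test function at a time: \<open>G\<close> is
  integrable in time and yields increments, whereas \<open>A\<close> is bounded and respects
  differences for all test functions simultaneously. \<open>M\<close> dominates the pairing with
  \<open>w\<close> itself.\<close>

locale weak_evolution =
  fixes T C K :: real and w :: "real \<Rightarrow> real \<Rightarrow> real"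
    and G A :: "real \<Rightarrow> (real \<Rightarrow> real) \<Rightarrow> real" and M :: "real \<Rightarrow> real"
  assumes T: "0 < T" and K: "0 \<le> K"
    and cont: "continuous_into_H T w"
    and meas: "strongly_measurable T V norm_V w"
    and bound: "AE t in lebesgue_on {0<..<T}. norm_V (w t) \<le> C"
    and G_integrable: "\<And>v. v \<in> V \<Longrightarrow> (\<lambda>t. G t v) absolutely_integrable_on {0..T}"
    and increment: "\<And>v a b. v \<in> V \<Longrightarrow> 0 \<le> a \<Longrightarrow> a \<le> b \<Longrightarrow> b \<le> T \<Longrightarrow>
        inner_H (w b) v - inner_H (w a) v = integral {a..b} (\<lambda>t. G t v)"
    and G_eq_A: "\<And>v. v \<in> V \<Longrightarrow> AE t in lebesgue_on {0<..<T}. G t v = A t v"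
    and A_bound: "AE t in lebesgue_on {0<..<T}. \<forall>v\<in>V. \<bar>A t v\<bar> \<le> K * norm_V v"
    and A_diff: "AE t in lebesgue_on {0<..<T}. \<forall>u\<in>V. \<forall>v\<in>V. A t (\<lambda>x. u x - v x) = A t u - A t v"
    and M_integrable: "M absolutely_integrable_on {0..T}"
    and A_le_M: "AE t in lebesgue_on {0<..<T}. A t (w t) \<le> M t"
begin

lemma w_H: "t \<in> {0..T} \<Longrightarrow> w t \<in> H"
  using cont by (simp add: continuous_into_H_def)

lemma w_V: "AE t in lebesgue_on {0<..<T}. w t \<in> V"
  using meas by (simp add: strongly_measurable_def)

text \<open>Lipschitz continuity of \<open>w\<close> as a map into the dual of \<open>V\<close>,
  with one constant for all times and test functions.\<close>

lemma increment_bound: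
  assumes v: "v \<in> V" and ab: "0 \<le> a" "a \<le> b" "b \<le> T"
  shows "\<bar>inner_H (w b) v - inner_H (w a) v\<bar> \<le> K * norm_V v * (b - a)"
  unfolding increment[OF v ab]
proof (rule abs_integral_le_AE[OF ab(2)])
  show "(\<lambda>t. G t v) absolutely_integrable_on {a..b}"
    by (rule absolutely_integrable_on_subinterval[OF G_integrable[OF v]]) (use ab in auto)
  have "AE t in lebesgue_on {0<..<T}. \<bar>G t v\<bar> \<le> K * norm_V v"
    using G_eq_A[OF v] A_bound by eventually_elim (use v in auto)
  from AE_lebesgue_on_Ioo_imp_Icc[OF this]
  show "AE t in lebesgue. t \<in> {a..b} \<longrightarrow> \<bar>G t v\<bar> \<le> K * norm_V v"
    by eventually_elim (use ab in auto)
qed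

text \<open>The constant extension of \<open>w\<close> to the whole line makes all difference quotients meaningful.\<close>

definition clamp_T :: "real \<Rightarrow> real" where "clamp_T b = max 0 (min T b)"
definition W :: "real \<Rightarrow> real \<Rightarrow> real" where "W b = w (clamp_T b)"

lemma clamp_T: "clamp_T b \<in> {0..T}" "b \<in> {0..T} \<Longrightarrow> clamp_T b = b" "\<bar>clamp_T b - clamp_T a\<bar> \<le> \<bar>b - a\<bar>"
  "continuous_on UNIV clamp_T"
  using T unfolding clamp_T_def by (auto intro!: continuous_intros)

lemma W_H: "W b \<in> H"
  unfolding W_def by (rule w_H[OF clamp_T(1)])

lemma W_lipschitz:
  assumes v: "v \<in> V"
  shows "\<bar>inner_H (W b) v - inner_H (W a) v\<bar> \<le> K * norm_V v * \<bar>b - a\<bar>"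
proof -
  have Kv: "0 \<le> K * norm_V v" using K V.norm_H1_nonneg by simp
  have *: "\<bar>inner_H (W b) v - inner_H (W a) v\<bar> \<le> K * norm_V v * \<bar>b - a\<bar>" if "clamp_T a \<le> clamp_T b" for a b
  proof -
    have "\<bar>inner_H (W b) v - inner_H (W a) v\<bar> \<le> K * norm_V v * (clamp_T b - clamp_T a)"
      unfolding W_def by (rule increment_bound[OF v]) (use clamp_T(1)[of a] clamp_T(1)[of b] that in auto)
    also have "\<dots> \<le> K * norm_V v * \<bar>b - a\<bar>"
      using clamp_T(3)[of b a] that by (intro mult_left_mono Kv) auto
    finally show ?thesis .
  qed
  show ?thesis
    using *[of a b] *[of b a] by (cases "clamp_T a \<le> clamp_T b") (auto simp: abs_minus_commute)
qed

text \<open>The square norm of \<open>w b - W (b - h)\<close> is nonnegative, which bounds the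
  energy increment by twice the pairing of the increment with \<open>w b\<close>. The quotient is
  taken backwards because \<open>b\<close> is the time at which the state is known to lie in
  \<open>V\<close>. Exchanging \<open>w b\<close> for \<open>v\<close> costs one Lipschitz
  bound.\<close>

lemma energy_difference_le:
  assumes b: "b \<in> {0..T}" "w b \<in> V" and v: "v \<in> V" and h: "0 < h"
  shows "(inner_H (W b) (W b) - inner_H (W (b - h)) (W (b - h))) / h
    \<le> 2 * ((inner_H (W b) v - inner_H (W (b - h)) v) / h) + 2 * K * norm_V (\<lambda>x. v x - w b x)"
proof -
  let ?a = "W (b - h)"
  have Wb: "W b = w b" using b(1) clamp_T(2) by (simp add: W_def)
  have u: "(\<lambda>x. w b x - v x) \<in> V" by (rule V.H1_diff(1)[OF b(2) v])
  have bH: "w b \<in> H" and vH: "v \<in> H" using b(2) v H1_L2 by auto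
  have "0 \<le> inner_H (\<lambda>x. w b x - ?a x) (\<lambda>x. w b x - ?a x)" by (rule inner_L2_nonneg)
  then have "inner_H (w b) (w b) - inner_H ?a ?a \<le> 2 * (inner_H (w b) (w b) - inner_H ?a (w b))"
    by (simp add: inner_L2_diff_diff[OF bH W_H] inner_L2_commute[of UNIV ?a "w b"])
  also have "inner_H (w b) (w b) - inner_H ?a (w b)
      = (inner_H (w b) v - inner_H ?a v) + (inner_H (w b) (\<lambda>x. w b x - v x) - inner_H ?a (\<lambda>x. w b x - v x))"
    by (simp add: inner_L2_diff_right[OF bH vH bH] inner_L2_diff_right[OF bH vH W_H])
  also have "inner_H (w b) (\<lambda>x. w b x - v x) - inner_H ?a (\<lambda>x. w b x - v x) \<le> K * norm_V (\<lambda>x. w b x - v x) * h"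
    using W_lipschitz[OF u, of b "b - h"] h by (simp add: Wb)
  finally have "inner_H (w b) (w b) - inner_H ?a ?a
      \<le> 2 * (inner_H (w b) v - inner_H ?a v) + 2 * K * norm_V (\<lambda>x. v x - w b x) * h"
    by (simp add: V.norm_H1_minus[OF b(2) v])
  then have "(inner_H (w b) (w b) - inner_H ?a ?a) / h
      \<le> (2 * (inner_H (w b) v - inner_H ?a v) + 2 * K * norm_V (\<lambda>x. v x - w b x) * h) / h"
    using h by (intro divide_right_mono) auto
  also have "\<dots> = 2 * ((inner_H (w b) v - inner_H ?a v) / h) + 2 * K * norm_V (\<lambda>x. v x - w b x)"
    using h by (simp add: add_divide_distrib)
  finally show ?thesis by (simp add: Wb)
qed

text \<open>The difference quotients of the energy are averaged over time, and \<open>w\<close> as a test function is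
  replaced by a simple function. Then only difference quotients of the finitely many scalar functions
  \<open>\<beta> v\<close> remain, which converge on every measurable set.\<close>

lemma energy_estimate_simple:
  assumes s: "simple_function (lebesgue_on {0<..<T}) s" "s ` {0<..<T} \<subseteq> V"
    and e: "(\<lambda>b. norm_V (\<lambda>x. s b x - w b x)) absolutely_integrable_on {0..T}"
    and t: "t \<in> {0..T}"
  shows "inner_H (w t) (w t) - inner_H (w 0) (w 0)
    \<le> 2 * integral {0..t} M + 4 * K * integral {0..t} (\<lambda>b. norm_V (\<lambda>x. s b x - w b x))"
proof -
  let ?I = "{0<..<T}"
  let ?h = "\<lambda>k. 1 / real (Suc k)"
  let ?e = "\<lambda>b. norm_V (\<lambda>x. s b x - w b x)"
  define R where "R = s ` ?I"
  define E where "E v = {b \<in> ?I. s b = v}" for v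
  define \<beta> where "\<beta> v b = inner_H (W b) v" for v b
  define N where "N b = inner_H (W b) (W b)" for b
  define q where "q v k b = (\<beta> v b - \<beta> v (b - ?h k)) / ?h k" for v k b
  have RV: "v \<in> V" if "v \<in> R" for v using s(2) that by (auto simp: R_def)
  have fin: "finite R" using simple_functionD(1)[OF s(1)] by (simp add: R_def)
  have E_sets: "E v \<in> sets lebesgue" for v
  proof -
    have "s -` {v} \<inter> space (lebesgue_on ?I) \<in> sets (lebesgue_on ?I)" by (rule simple_functionD(2)[OF s(1)])
    then have "s -` {v} \<inter> ?I \<in> sets lebesgue" by (simp add: sets_restrict_space_iff)
    moreover have "E v = s -` {v} \<inter> ?I" by (auto simp: E_def)
    ultimately show ?thesis by simp
  qed
  have t0: "0 \<le> t" "t \<le> T" using t by auto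
  have lip: "\<bar>\<beta> v b - \<beta> v a\<bar> \<le> (K * norm_V v) * \<bar>b - a\<bar>" if "v \<in> V" for v a b
    unfolding \<beta>_def by (rule W_lipschitz[OF that])
  have contN: "continuous_on UNIV N"
    unfolding N_def W_def
    by (rule continuous_on_compose2[OF continuous_into_H_norm[OF cont] clamp_T(4)]) (use clamp_T(1) in auto)
  have cont\<beta>: "continuous_on UNIV (\<beta> v)" if "v \<in> V" for v
    unfolding \<beta>_def W_def
    by (rule continuous_on_compose2[OF continuous_into_H_inner[OF cont H1_L2[OF that]] clamp_T(4)]) (use clamp_T(1) in auto)
  have aN: "(\<lambda>b. (N b - N (b - ?h k)) / ?h k) absolutely_integrable_on {0..t}" for k
    by (intro absolutely_integrable_continuous_real continuous_intros continuous_on_compose2[OF contN]) auto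
  have aq: "q v k absolutely_integrable_on {0..t}" if "v \<in> V" for v k
    unfolding q_def
    by (intro absolutely_integrable_continuous_real continuous_intros continuous_on_compose2[OF cont\<beta>[OF that]]) auto
  have aE: "(\<lambda>b. indicat_real (E v) b * p b) absolutely_integrable_on {0..t}" if "p absolutely_integrable_on {0..t}" for v p
    using integrable_mult_indicator[OF E_sets that[unfolded set_integrable_def], of v]
    by (simp add: set_integrable_def mult.left_commute)
  have ae: "?e absolutely_integrable_on {0..t}"
    by (rule absolutely_integrable_on_subinterval[OF e]) (use t0 in auto)
  have aM: "M absolutely_integrable_on {0..t}"
    by (rule absolutely_integrable_on_subinterval[OF M_integrable]) (use t0 in auto)
  have aG: "(\<lambda>b. G b v) absolutely_integrable_on {0..t}" if "v \<in> V" for v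
    by (rule absolutely_integrable_on_subinterval[OF G_integrable[OF that]]) (use t0 in auto)
  have LI: "(LINT b:{0..t}|lebesgue. p b) = integral {0..t} p" if "p absolutely_integrable_on {0..t}" for p :: "real \<Rightarrow> real"
    by (rule set_lebesgue_integral_eq_integral(2)[OF that])
  have mono: "(LINT b:{0..t}|lebesgue. p b) \<le> (LINT b:{0..t}|lebesgue. p' b)"
    if "p absolutely_integrable_on {0..t}" "p' absolutely_integrable_on {0..t}"
      "AE b in lebesgue_on ?I. p b \<le> p' b" for p p' :: "real \<Rightarrow> real"
    unfolding set_lebesgue_integral_def
  proof (rule integral_mono_AE)
    show "AE b in lebesgue. indicat_real {0..t} b *\<^sub>R p b \<le> indicat_real {0..t} b *\<^sub>R p' b"
      using AE_lebesgue_on_Ioo_imp_Icc[OF that(3)] by eventually_elim (use t0 in \<open>auto simp: indicator_def\<close>)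
  qed (use that(1,2) in \<open>simp_all add: set_integrable_def\<close>)
  \<comment> \<open>Exactly one level set contains \<open>b\<close>, so the sum selects the test
    function \<open>s b\<close> in use at time \<open>b\<close>.\<close>
  have pick: "(\<Sum>v\<in>R. indicat_real (E v) b * p v) = p (s b)" if "b \<in> ?I" for b and p :: "(real \<Rightarrow> real) \<Rightarrow> real"
  proof -
    have "(\<Sum>v\<in>R. indicat_real (E v) b * p v) = (\<Sum>v\<in>R. if v = s b then p v else 0)"
      by (rule sum.cong) (use that in \<open>auto simp: E_def indicator_def\<close>)
    also have "\<dots> = p (s b)" using fin that by (simp add: R_def)
    finally show ?thesis .
  qed
  have inI: "AE b in lebesgue_on ?I. b \<in> ?I" by (rule AE_I2) simp
  have asum: "(\<lambda>b. \<Sum>v\<in>R. indicat_real (E v) b * p v b) absolutely_integrable_on {0..t}"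
    if "\<And>v. v \<in> V \<Longrightarrow> p v absolutely_integrable_on {0..t}" for p
    using RV fin by (intro absolutely_integrable_sum aE that) auto
  have LIsum: "(LINT b:{0..t}|lebesgue. \<Sum>v\<in>R. indicat_real (E v) b * p v b) = (\<Sum>v\<in>R. LINT b:{0..t}|lebesgue. indicat_real (E v) b * p v b)"
    if "\<And>v. v \<in> V \<Longrightarrow> p v absolutely_integrable_on {0..t}" for p
    unfolding set_lebesgue_integral_def scaleR_sum_right
    by (rule Bochner_Integration.integral_sum) (use aE[OF that[OF RV]] in \<open>simp add: set_integrable_def\<close>)
  let ?r = "\<lambda>k b. 2 * (\<Sum>v\<in>R. indicat_real (E v) b * q v k b) + 2 * K * ?e b"
  have ar: "?r k absolutely_integrable_on {0..t}" for k
    by (intro set_integral_add set_integrable_mult_right asum aq ae) 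
  have le: "integral {0..t} (\<lambda>b. (N b - N (b - ?h k)) / ?h k)
      \<le> 2 * (\<Sum>v\<in>R. LINT b:{0..t}|lebesgue. indicat_real (E v) b * q v k b) + 2 * K * integral {0..t} ?e" for k
  proof -
    have "(LINT b:{0..t}|lebesgue. (N b - N (b - ?h k)) / ?h k) \<le> (LINT b:{0..t}|lebesgue. ?r k b)"
    proof (rule mono[OF aN ar])
      show "AE b in lebesgue_on ?I. (N b - N (b - ?h k)) / ?h k \<le> ?r k b"
        using w_V inI
      proof eventually_elim
        case (elim b)
        then have "b \<in> {0..T}" "s b \<in> V" using s(2) by auto
        from energy_difference_le[OF this(1) elim(1) this(2), of "?h k"] pick[OF elim(2), of "\<lambda>v. q v k b"]
        show ?case by (simp add: N_def q_def \<beta>_def)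
      qed
    qed
    also have "(LINT b:{0..t}|lebesgue. ?r k b) = 2 * (LINT b:{0..t}|lebesgue. \<Sum>v\<in>R. indicat_real (E v) b * q v k b) + 2 * K * (LINT b:{0..t}|lebesgue. ?e b)"
      using asum[of "\<lambda>v. q v k", OF aq] ae by (simp add: set_integral_add)
    finally show ?thesis by (simp only: LI[OF aN] LI[OF ae] LIsum[of "\<lambda>v. q v k", OF aq])
  qed
  \<comment> \<open>The averaged quotients of the energy tend to its increment; continuity of the
    energy is enough for this.\<close>
  have "(\<lambda>k. integral {0..t} (\<lambda>b. (N b - N (b - ?h k)) / ?h k)) \<longlonglongrightarrow> N t - N 0"
    by (rule integral_difference_quotient_tendsto[OF contN t0(1)])
  moreover have "(\<lambda>k. 2 * (\<Sum>v\<in>R. LINT b:{0..t}|lebesgue. indicat_real (E v) b * q v k b) + 2 * K * integral {0..t} ?e)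
      \<longlonglongrightarrow> 2 * (\<Sum>v\<in>R. LINT b:{0..t}|lebesgue. indicat_real (E v) b * G b v) + 2 * K * integral {0..t} ?e"
  proof (intro tendsto_add tendsto_mult tendsto_const tendsto_sum)
    fix v assume "v \<in> R"
    then have v: "v \<in> V" by (rule RV)
    have inc: "\<beta> v d - \<beta> v 0 = integral {0..d} (\<lambda>b. G b v)" if "0 \<le> d" "d \<le> t" for d
      using increment[OF v _ that(1)] that t0 clamp_T(2)[of d] clamp_T(2)[of 0] T by (simp add: \<beta>_def W_def)
    show "(\<lambda>k. LINT b:{0..t}|lebesgue. indicat_real (E v) b * q v k b) \<longlonglongrightarrow> (LINT b:{0..t}|lebesgue. indicat_real (E v) b * G b v)"
      unfolding q_def by (rule difference_quotient_tendsto[OF t0(1) lip[OF v] aG[OF v] inc E_sets])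
  qed
  ultimately have "N t - N 0 \<le> 2 * (\<Sum>v\<in>R. LINT b:{0..t}|lebesgue. indicat_real (E v) b * G b v) + 2 * K * integral {0..t} ?e"
    by (rule LIMSEQ_le) (use le in blast)
  also have "(\<Sum>v\<in>R. LINT b:{0..t}|lebesgue. indicat_real (E v) b * G b v) = (LINT b:{0..t}|lebesgue. \<Sum>v\<in>R. indicat_real (E v) b * G b v)"
    by (rule LIsum[of "\<lambda>v b. G b v", OF aG, symmetric])
  also have "\<dots> \<le> (LINT b:{0..t}|lebesgue. M b + K * ?e b)"
  proof (rule mono)
    show "(\<lambda>b. \<Sum>v\<in>R. indicat_real (E v) b * G b v) absolutely_integrable_on {0..t}" by (rule asum[OF aG])
    show "(\<lambda>b. M b + K * ?e b) absolutely_integrable_on {0..t}"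
      by (intro set_integral_add set_integrable_mult_right aM ae)
    \<comment> \<open>Finitely many values, hence finitely many exceptional null sets: here the
      simple function pays off.\<close>
    have "AE b in lebesgue_on ?I. \<forall>v\<in>R. G b v = A b v"
      using G_eq_A RV fin by (intro AE_finite_allI) auto
    then show "AE b in lebesgue_on ?I. (\<Sum>v\<in>R. indicat_real (E v) b * G b v) \<le> M b + K * ?e b"
      using A_bound A_diff A_le_M w_V inI
    proof eventually_elim
      case (elim b)
      have sb: "s b \<in> R" "s b \<in> V" using elim(6) s(2) by (auto simp: R_def)
      have "(\<Sum>v\<in>R. indicat_real (E v) b * G b v) = A b (s b)"
        using pick[OF elim(6), of "G b"] elim(1) sb by simp
      also have "\<dots> = A b (w b) + A b (\<lambda>x. s b x - w b x)"
        using elim(3,5) sb by simp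
      also have "\<dots> \<le> M b + K * ?e b"
        using elim(2,4) V.H1_diff(1)[OF sb(2) elim(5)] by (intro add_mono) (auto simp: abs_le_iff)
      finally show ?case .
    qed
  qed
  also have "\<dots> = integral {0..t} M + K * integral {0..t} ?e"
    using aM ae LI[OF aM] LI[OF ae] by (simp add: set_integral_add)
  \<comment> \<open>Twice \<open>2 * K\<close>: once for exchanging \<open>w b\<close> in the
    quotients and once for exchanging it in \<open>A b\<close>.\<close>
  finally have "N t - N 0 \<le> 2 * integral {0..t} M + 4 * K * integral {0..t} ?e" by (simp add: algebra_simps)
  then show ?thesis using clamp_T(2)[of t] clamp_T(2)[of 0] t T by (simp add: N_def W_def)
qed

text \<open>Simple functions that approximate \<open>w\<close> in \<open>V\<close> at almost every
  time make the error term vanish: after truncation the errors are bounded, so dominated convergence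
  applies.\<close>

theorem energy_estimate:
  assumes t: "t \<in> {0..T}"
  shows "inner_H (w t) (w t) - inner_H (w 0) (w 0) \<le> 2 * integral {0..t} M"
proof -
  let ?I = "{0<..<T}"
  let ?L = "lebesgue_on ?I"
  from meas obtain s where s: "\<And>n. simple_function ?L (s n)" "\<And>n. s n ` ?I \<subseteq> V"
    and lim: "AE t in ?L. (\<lambda>n::nat. norm_V (\<lambda>z. s n t z - w t z)) \<longlonglongrightarrow> 0"
    unfolding strongly_measurable_def by auto
  \<comment> \<open>Values of norm above \<open>C + 1\<close> are reset to 0. Since \<open>w\<close>
    is bounded by \<open>C\<close>, this eventually changes nothing at almost every time.\<close>
  define s' where "s' n b = (if norm_V (s n b) \<le> C + 1 then s n b else (\<lambda>x. 0))" for n b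
  have s': "simple_function ?L (s' n)" "s' n ` ?I \<subseteq> V" for n
    unfolding s'_def
    using simple_function_compose1[OF s(1), of "\<lambda>f. if norm_V f \<le> C + 1 then f else (\<lambda>x. 0)"] s(2) V.H1_zero by auto
  have s'V: "s' n b \<in> V" if "b \<in> ?I" for n b using s'(2) that by blast
  have inI: "AE b in ?L. b \<in> ?I" by (rule AE_I2) simp
  let ?e = "\<lambda>n b. norm_V (\<lambda>x. s' n b x - w b x)"
  have elim: "AE b in ?L. (\<lambda>n. ?e n b) \<longlonglongrightarrow> 0"
    using lim bound w_V inI
  proof eventually_elim
    case (elim b)
    have sV: "s n b \<in> V" for n using s(2) elim(4) by blast
    have "\<forall>\<^sub>F n in sequentially. norm_V (\<lambda>z. s n b z - w b z) < 1"
      using elim(1) by (rule order_tendstoD) simp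
    then have "\<forall>\<^sub>F n in sequentially. norm_V (\<lambda>z. s n b z - w b z) = ?e n b"
    proof eventually_elim
      case (elim n)
      have "norm_V (s n b) \<le> C + 1"
        using V.norm_H1_le_diff[OF sV \<open>w b \<in> V\<close>, of n] elim \<open>norm_V (w b) \<le> C\<close> by simp
      then show ?case by (simp add: s'_def)
    qed
    from tendsto_cong[OF this] elim(1) show ?case by simp
  qed
  have ebound: "AE b in ?L. norm (?e n b) \<le> 2 * \<bar>C\<bar> + 1" for n
    using bound w_V inI
  proof eventually_elim
    case (elim b)
    have "norm_V (s' n b) \<le> \<bar>C\<bar> + 1" by (auto simp: s'_def V.norm_H1_zero)
    moreover have "?e n b \<le> norm_V (s' n b) + norm_V (w b)"
      using V.norm_H1_diff_triangle[OF s'V[OF elim(3)] V.H1_zero elim(2), of n]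
        V.norm_H1_cmult[OF elim(2), of "-1"] by simp
    ultimately show ?case using elim(1) V.norm_H1_nonneg by simp
  qed
  \<comment> \<open>With \<open>s' m\<close> in place of \<open>w\<close> the function takes
    finitely many values; the error is its limit as \<open>m\<close> grows, hence
    measurable.\<close>
  have emeas: "?e n \<in> borel_measurable ?L" for n
  proof (rule measurable_lebesgue_on_AE_limit)
    show "(\<lambda>b. norm_V (\<lambda>x. s' n b x - s' m b x)) \<in> borel_measurable ?L" for m
      by (rule borel_measurable_simple_function, rule simple_function_compose2[OF s'(1) s'(1)])
    show "AE b in ?L. (\<lambda>m. norm_V (\<lambda>x. s' n b x - s' m b x)) \<longlonglongrightarrow> ?e n b"
      using elim w_V inI
    proof eventually_elim
      case (elim b)
      have V: "s' m b \<in> V" for m using s'V elim(3) by blast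
      have "norm (norm_V (\<lambda>x. s' n b x - s' m b x) - ?e n b) \<le> ?e m b" for m
        using V.norm_H1_diff_triangle[OF V[of n] elim(2) V[of m]] V.norm_H1_diff_triangle[OF V[of n] V[of m] elim(2)]
          V.norm_H1_minus[OF V[of m] elim(2)] by simp
      then have "(\<lambda>m. norm_V (\<lambda>x. s' n b x - s' m b x) - ?e n b) \<longlonglongrightarrow> 0"
        by (intro Lim_null_comparison[OF always_eventually elim(1)]) auto
      then show ?case by (simp add: LIM_zero_iff)
    qed
  qed simp
  have fm: "finite_measure ?L" by (intro finite_measure_lebesgue_on) auto
  have const: "integrable ?L (\<lambda>b. c)" for c :: real
    by (rule finite_measure.integrable_const[OF fm])
  have eint: "integrable ?L (?e n)" for n
  proof (rule Bochner_Integration.integrable_bound[OF const[of "2 * \<bar>C\<bar> + 1"] emeas])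
    show "AE b in ?L. norm (?e n b) \<le> norm (2 * \<bar>C\<bar> + 1)"
      using ebound[of n] by eventually_elim simp
  qed
  have ea: "?e n absolutely_integrable_on {0..T}" for n
    using eint by (simp add: absolutely_integrable_Icc_iff)
  have "(\<lambda>n. LINT b|?L. ?e n b) \<longlonglongrightarrow> (LINT b|?L. 0 :: real)"
    by (rule integral_dominated_convergence[where w = "\<lambda>b. 2 * \<bar>C\<bar> + 1"]) (use emeas const elim ebound in auto)
  then have e0: "(\<lambda>n. LINT b|?L. ?e n b) \<longlonglongrightarrow> 0" by simp
  have le: "inner_H (w t) (w t) - inner_H (w 0) (w 0) \<le> 2 * integral {0..t} M + 4 * K * (LINT b|?L. ?e n b)" for n
  proof -
    have "integral {0..t} (?e n) \<le> integral {0..T} (?e n)"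
      using t V.norm_H1_nonneg absolutely_integrable_on_subinterval[OF ea, of 0 t n] ea[of n]
      by (intro integral_subset_le set_lebesgue_integral_eq_integral(1)) auto
    also have "\<dots> = integral ?I (?e n)" by (rule integral_open_interval_real)
    also have "\<dots> = (LINT b|?L. ?e n b)"
      by (rule lebesgue_integral_eq_integral[OF eint, symmetric]) simp
    finally have "4 * K * integral {0..t} (?e n) \<le> 4 * K * (LINT b|?L. ?e n b)"
      using K by (intro mult_left_mono) auto
    with energy_estimate_simple[OF s' ea t, of n] show ?thesis by simp
  qed
  have "(\<lambda>n. 2 * integral {0..t} M + 4 * K * (LINT b|?L. ?e n b)) \<longlonglongrightarrow> 2 * integral {0..t} M + 4 * K * 0"
    by (intro tendsto_intros e0)
  then show ?thesis
    using le by (intro LIMSEQ_le_const[of "\<lambda>n. 2 * integral {0..t} M + 4 * K * (LINT b|?L. ?e n b)"]) auto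
qed

end

section \<open>Stability of the state\<close>

text \<open>\<open>N\<close> satisfies only an integral inequality, so the integrating factor is
  applied to its right-hand side, which is differentiable; the product is nonincreasing and starts
  at \<open>F\<close>.\<close>

lemma gronwall_integral:
  fixes N :: "real \<Rightarrow> real"
  assumes c: "continuous_on {0..T} N" and \<kappa>: "0 \<le> \<kappa>"
    and le: "\<And>t. t \<in> {0..T} \<Longrightarrow> N t \<le> F + \<kappa> * integral {0..t} N" and t: "t \<in> {0..T}"
  shows "N t \<le> F * exp (\<kappa> * t)"
proof -
  let ?I = "\<lambda>t. integral {0..t} N"
  let ?\<phi> = "\<lambda>t. exp (- (\<kappa> * t)) * (F + \<kappa> * ?I t)"
  have ct: "continuous_on {0..t} N" by (rule continuous_on_subset[OF c]) (use t in auto)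
  have "?\<phi> t \<le> ?\<phi> 0"
  proof (cases "t = 0")
    case False
    show ?thesis
    proof (rule DERIV_nonpos_imp_decreasing_open[of 0 t ?\<phi>])
      show "0 \<le> t" using t by simp
    next
      fix x assume x: "0 < x" "x < t"
      have "(?I has_real_derivative N x) (at x within {0..t})"
        unfolding has_real_derivative_iff_has_vector_derivative
        by (rule integral_has_vector_derivative[OF ct]) (use x in auto)
      moreover have "at x within {0..t} = at x" by (rule at_within_interior) (use x in auto)
      ultimately have I: "(?I has_real_derivative N x) (at x)" by simp
      have deriv: "(?\<phi> has_real_derivative exp (- (\<kappa> * x)) * (- \<kappa>) * (F + \<kappa> * ?I x) + exp (- (\<kappa> * x)) * (\<kappa> * N x)) (at x)"
        by (auto intro!: derivative_eq_intros I)
      have eq: "exp (- (\<kappa> * x)) * (- \<kappa>) * (F + \<kappa> * ?I x) + exp (- (\<kappa> * x)) * (\<kappa> * N x)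
          = exp (- (\<kappa> * x)) * \<kappa> * (N x - (F + \<kappa> * ?I x))"
        by (simp add: algebra_simps)
      have "exp (- (\<kappa> * x)) * \<kappa> * (N x - (F + \<kappa> * ?I x)) \<le> 0"
        using le[of x] x t \<kappa> by (intro mult_nonneg_nonpos) auto
      with deriv show "\<exists>y. (?\<phi> has_real_derivative y) (at x) \<and> y \<le> 0"
        unfolding eq by (intro exI conjI)
    next
      have "N integrable_on {0..t}" by (rule integrable_continuous_real[OF ct])
      then show "continuous_on {0..t} ?\<phi>"
        by (intro continuous_intros indefinite_integral_continuous_1)
    qed
  qed simp
  then have "exp (- (\<kappa> * t)) * (F + \<kappa> * ?I t) \<le> F" by simp
  then have "exp (\<kappa> * t) * (exp (- (\<kappa> * t)) * (F + \<kappa> * ?I t)) \<le> exp (\<kappa> * t) * F"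
    by (rule mult_left_mono) simp
  then have "F + \<kappa> * ?I t \<le> F * exp (\<kappa> * t)"
    by (simp add: mult.assoc[symmetric] exp_add[symmetric] mult.commute)
  with le[OF t] show ?thesis by simp
qed

text \<open>The cubic term of the difference of the convection terms integrates to zero, so that only a
  norm of \<open>Z\<close> enters the constant. This is what makes the stability estimate below uniform in
  the first of the two solutions.\<close>

lemma burgers_difference_le:
  fixes c \<nu> :: real
  assumes Y: "Y \<in> V" and Z: "Z \<in> V" and \<chi>\<^sub>c: "\<chi>\<^sub>c \<in> H" and \<nu>: "0 < \<nu>"
  defines "D \<equiv> \<lambda>x. Y x - Z x"
  shows "c * inner_H \<chi>\<^sub>c D - (inner_H (\<lambda>x. Y x * dx Y x) D - inner_H (\<lambda>x. Z x * dx Z x) D)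
      - \<nu> * (inner_H (dx Y) (dx D) - inner_H (dx Z) (dx D))
    \<le> 1 / 2 * (c\<^sup>2 * (norm_H \<chi>\<^sub>c)\<^sup>2) + (1 / 2 + (norm_V Z)\<^sup>2 / (2 * \<nu>)) * inner_H D D"
proof -
  have D: "D \<in> V" and ae: "AE x in lebesgue_on UNIV. dx D x = dx Y x - dx Z x"
    unfolding D_def by (rule V.H1_diff[OF Y Z])+
  have H: "Y \<in> H" "Z \<in> H" "D \<in> H" "dx Y \<in> H" "dx Z \<in> H" "dx D \<in> H"
    using Y Z D by (auto intro: H1_L2 weak_deriv_H1)
  have YY: "(\<lambda>x. Y x * dx Y x) \<in> H" and ZZ: "(\<lambda>x. Z x * dx Z x) \<in> H" and DD: "(\<lambda>x. D x * dx D x) \<in> H"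
    and ZD: "(\<lambda>x. Z x * dx D x) \<in> H" and DZ: "(\<lambda>x. D x * dx Z x) \<in> H"
    using V_mult_L2(1) Y Z D H by auto
  have grad: "inner_H (dx Y) (dx D) - inner_H (dx Z) (dx D) = (norm_H (dx D))\<^sup>2"
  proof -
    have "inner_H (dx D) (dx D) = inner_H (\<lambda>x. dx Y x - dx Z x) (dx D)"
      by (rule inner_L2_cong_AE) (use ae H L2_diff[OF H(4,5)] in \<open>auto intro: L2_measurable\<close>)
    then show ?thesis by (simp add: norm_L2_square inner_L2_diff_left H)
  qed
  have "inner_H (\<lambda>x. Y x * dx Y x) D - inner_H (\<lambda>x. Z x * dx Z x) D = inner_H (\<lambda>x. Y x * dx Y x - Z x * dx Z x) D"
    by (rule inner_L2_diff_left[OF YY ZZ H(3), symmetric])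
  \<comment> \<open>Expansion of \<open>Y = D + Z\<close>; the first summand is the cubic term in
    \<open>D\<close> alone.\<close>
  also have "\<dots> = inner_H (\<lambda>x. (D x * dx D x + Z x * dx D x) + D x * dx Z x) D"
  proof (rule inner_L2_cong_AE)
    show "AE x in lebesgue_on UNIV. Y x * dx Y x - Z x * dx Z x = (D x * dx D x + Z x * dx D x) + D x * dx Z x"
      using ae
    proof eventually_elim
      case (elim x)
      show ?case unfolding elim by (simp add: D_def algebra_simps)
    qed
  qed (use L2_measurable[OF L2_diff[OF YY ZZ]] L2_measurable[OF L2_add[OF L2_add[OF DD ZD] DZ]] L2_measurable[OF H(3)] in auto)
  also have "\<dots> = inner_H (\<lambda>x. D x * dx D x) D + inner_H (\<lambda>x. Z x * dx D x) D + inner_H (\<lambda>x. D x * dx Z x) D"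
    by (simp add: inner_L2_add_left L2_add DD ZD DZ H)
  also have "inner_H (\<lambda>x. D x * dx D x) D = 0"
  proof -
    have "inner_H (\<lambda>x. D x * D x) (dx D) = inner_H (\<lambda>x. D x * dx D x) D"
      by (simp add: inner_L2_def mult_ac)
    with V_cubic_identity[OF D D] show ?thesis by simp
  qed
  \<comment> \<open>The cubic identity for \<open>D\<close> and \<open>Z\<close> moves the
    derivative from \<open>Z\<close> to \<open>D\<close>. Then \<open>Z\<close> enters through its
    supremum only, and \<open>dx D\<close> can be absorbed by viscosity.\<close>
  also have "inner_H (\<lambda>x. D x * dx Z x) D = - 2 * inner_H (\<lambda>x. Z x * dx D x) D"
  proof -
    have "inner_H (\<lambda>x. D x * dx D x) Z = inner_H (\<lambda>x. Z x * dx D x) D"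
      "inner_H (\<lambda>x. D x * D x) (dx Z) = inner_H (\<lambda>x. D x * dx Z x) D"
      by (simp_all add: inner_L2_def mult_ac)
    with V_cubic_identity[OF D Z] show ?thesis by simp
  qed
  finally have conv: "inner_H (\<lambda>x. Y x * dx Y x) D - inner_H (\<lambda>x. Z x * dx Z x) D = - inner_H (\<lambda>x. Z x * dx D x) D"
    by simp
  let ?d = "norm_H D" and ?d' = "norm_H (dx D)" and ?z = "norm_V Z"
  have "inner_H (\<lambda>x. Z x * dx D x) D \<le> norm_H (\<lambda>x. Z x * dx D x) * ?d"
    using Cauchy_Schwarz_L2[OF ZD H(3)] by simp
  also have "\<dots> \<le> (sqrt 2 * ?z * ?d') * ?d"
    by (intro mult_right_mono V_mult_L2(2) Z H norm_L2_nonneg)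
  also have "\<dots> \<le> \<nu> * ?d'\<^sup>2 + ?z\<^sup>2 / (2 * \<nu>) * ?d\<^sup>2"
  proof -
    \<comment> \<open>Young's inequality with weights chosen so that the gradient term is exactly
      \<open>\<nu> * ?d'^2\<close> and cancels against the viscous term.\<close>
    have "0 \<le> (2 * \<nu> * ?d' - sqrt 2 * ?z * ?d)\<^sup>2 / (4 * \<nu>)" using \<nu> by simp
    also have "\<dots> = \<nu> * ?d'\<^sup>2 + ?z\<^sup>2 / (2 * \<nu>) * ?d\<^sup>2 - (sqrt 2 * ?z * ?d') * ?d"
      using \<nu> by (simp add: power2_diff power_mult_distrib field_simps power2_eq_square)
    finally show ?thesis by simp
  qed
  finally have 1: "inner_H (\<lambda>x. Z x * dx D x) D \<le> \<nu> * ?d'\<^sup>2 + ?z\<^sup>2 / (2 * \<nu>) * ?d\<^sup>2" .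
  have "c * inner_H \<chi>\<^sub>c D \<le> \<bar>c\<bar> * \<bar>inner_H \<chi>\<^sub>c D\<bar>" by (metis abs_ge_self abs_mult)
  also have "\<dots> \<le> \<bar>c\<bar> * (norm_H \<chi>\<^sub>c * ?d)" by (intro mult_left_mono Cauchy_Schwarz_L2 \<chi>\<^sub>c H) simp
  also have "\<dots> \<le> 1 / 2 * (c\<^sup>2 * (norm_H \<chi>\<^sub>c)\<^sup>2) + 1 / 2 * ?d\<^sup>2"
    using sum_squares_bound[of "\<bar>c\<bar> * norm_H \<chi>\<^sub>c" ?d] by (simp add: power_mult_distrib)
  finally have 2: "c * inner_H \<chi>\<^sub>c D \<le> 1 / 2 * (c\<^sup>2 * (norm_H \<chi>\<^sub>c)\<^sup>2) + 1 / 2 * ?d\<^sup>2" .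
  show ?thesis using 1 2 by (simp add: conv grad norm_L2_square[symmetric] distrib_right)
qed

section \<open>The difference of two states as an evolution in the sense of
  \<open>weak_evolution\<close>\<close>

lemma strongly_measurable_diff:
  assumes "strongly_measurable T V norm_V y" "strongly_measurable T V norm_V z"
  shows "strongly_measurable T V norm_V (\<lambda>t x. y t x - z t x)"
proof -
  let ?L = "lebesgue_on {0<..<T}"
  from assms(1) obtain r where r: "AE t in ?L. y t \<in> V" "\<And>n. simple_function ?L (r n)" "\<And>n. r n ` {0<..<T} \<subseteq> V"
    "AE t in ?L. (\<lambda>n::nat. norm_V (\<lambda>z. r n t z - y t z)) \<longlonglongrightarrow> 0"
    unfolding strongly_measurable_def by auto
  from assms(2) obtain s where s: "AE t in ?L. z t \<in> V" "\<And>n. simple_function ?L (s n)" "\<And>n. s n ` {0<..<T} \<subseteq> V"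
    "AE t in ?L. (\<lambda>n::nat. norm_V (\<lambda>x. s n t x - z t x)) \<longlonglongrightarrow> 0"
    unfolding strongly_measurable_def by auto
  have inI: "AE b in ?L. b \<in> {0<..<T}" by (rule AE_I2) simp
  show ?thesis
    unfolding strongly_measurable_def
  proof (intro conjI exI[of _ "\<lambda>n t x. r n t x - s n t x"] allI)
    show "AE t in ?L. (\<lambda>x. y t x - z t x) \<in> V"
      using r(1) s(1) by eventually_elim (rule V.H1_diff(1))
    show "simple_function ?L (\<lambda>t x. r n t x - s n t x)" for n
      by (rule simple_function_compose2[OF r(2) s(2)])
    show "(\<lambda>t x. r n t x - s n t x) ` {0<..<T} \<subseteq> V" for n
      using r(3) s(3) V.H1_diff(1) by blast
    show "AE t in ?L. (\<lambda>n. norm_V (\<lambda>x. (r n t x - s n t x) - (y t x - z t x))) \<longlonglongrightarrow> 0"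
      using r(1,4) s(1,4) inI
    proof eventually_elim
      case (elim t)
      have V: "r n t \<in> V" "s n t \<in> V" for n using r(3) s(3) elim(5) by blast+
      have "norm_V (\<lambda>x. (r n t x - s n t x) - (y t x - z t x)) \<le> norm_V (\<lambda>x. r n t x - y t x) + norm_V (\<lambda>x. s n t x - z t x)" for n
      proof -
        have "(\<lambda>x. (r n t x - s n t x) - (y t x - z t x)) = (\<lambda>x. (r n t x - y t x) + (z t x - s n t x))" by auto
        then show ?thesis
          using V.norm_H1_triangle[OF V.H1_diff(1)[OF V(1) elim(1)] V.H1_diff(1)[OF elim(3) V(2)], of n n]
            V.norm_H1_minus[OF V(2) elim(3), of n] by simp
      qed
      moreover have "(\<lambda>n. norm_V (\<lambda>x. r n t x - y t x) + norm_V (\<lambda>x. s n t x - z t x)) \<longlonglongrightarrow> 0"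
        using tendsto_add[OF elim(2,4)] by simp
      ultimately show ?case
        by (intro Lim_null_comparison[of "\<lambda>n. norm_V (\<lambda>x. (r n t x - s n t x) - (y t x - z t x))"] always_eventually)
          (auto simp: V.norm_H1_nonneg)
    qed
  qed
qed

lemma continuous_into_H_diff:
  assumes "continuous_into_H T y" "continuous_into_H T z"
  shows "continuous_into_H T (\<lambda>t x. y t x - z t x)"
  unfolding continuous_into_H_def
proof (intro conjI ballI)
  have yH: "y t \<in> H" "z t \<in> H" if "t \<in> {0..T}" for t
    using assms that by (auto simp: continuous_into_H_def)
  then show "(\<lambda>x. y t x - z t x) \<in> H" if "t \<in> {0..T}" for t using that by (intro L2_diff) auto
  fix t assume t: "t \<in> {0..T}"
  have "((\<lambda>s. norm_H (\<lambda>x. y s x - y t x) + norm_H (\<lambda>x. z s x - z t x)) \<longlongrightarrow> 0 + 0) (at t within {0..T})"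
    using assms t by (intro tendsto_add) (auto simp: continuous_into_H_def)
  moreover have "\<forall>\<^sub>F s in at t within {0..T}. norm (norm_H (\<lambda>x. (y s x - z s x) - (y t x - z t x))) \<le> norm_H (\<lambda>x. y s x - y t x) + norm_H (\<lambda>x. z s x - z t x)"
    unfolding eventually_at_filter
  proof (rule always_eventually, safe)
    fix s assume s: "s \<in> {0..T}"
    have "(\<lambda>x. (y s x - z s x) - (y t x - z t x)) = (\<lambda>x. (y s x - y t x) + (z t x - z s x))" by auto
    moreover have "norm_H (\<lambda>x. (y s x - y t x) + (z t x - z s x)) \<le> norm_H (\<lambda>x. y s x - y t x) + norm_H (\<lambda>x. z t x - z s x)"
      by (rule norm_L2_triangle) (intro L2_diff yH s t)+
    moreover have "norm_H (\<lambda>x. z t x - z s x) = norm_H (\<lambda>x. z s x - z t x)" by (rule norm_L2_minus)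
    ultimately show "norm (norm_H (\<lambda>x. (y s x - z s x) - (y t x - z t x))) \<le> norm_H (\<lambda>x. y s x - y t x) + norm_H (\<lambda>x. z s x - z t x)"
      by (simp only: real_norm_def abs_of_nonneg norm_L2_nonneg)
  qed
  ultimately show "((\<lambda>s. norm_H (\<lambda>x. (y s x - z s x) - (y t x - z t x))) \<longlongrightarrow> 0) (at t within {0..T})"
    by (intro Lim_null_comparison[of "\<lambda>s. norm_H (\<lambda>x. (y s x - z s x) - (y t x - z t x))"]) simp_all
qed

text \<open>The equation solved for the time derivative, at one frozen time: \<open>f\<close> is the
  state and the scalar \<open>c\<close> the control value, which acts through the fixed spatial
  profile.\<close>

definition burgers_rhs :: "real \<Rightarrow> (real \<Rightarrow> real) \<Rightarrow> real \<Rightarrow> (real \<Rightarrow> real) \<Rightarrow> (real \<Rightarrow> real) \<Rightarrow> real" where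
  "burgers_rhs \<nu> \<chi>\<^sub>c c f \<phi> = c * inner_H \<chi>\<^sub>c \<phi> - inner_H (\<lambda>x. f x * dx f x) \<phi> - \<nu> * inner_H (dx f) (dx \<phi>)"

lemma burgers_rhs_diff:
  assumes "\<chi>\<^sub>c \<in> H" "f \<in> V" "\<phi> \<in> V" "\<psi> \<in> V"
  shows "burgers_rhs \<nu> \<chi>\<^sub>c c f (\<lambda>x. \<phi> x - \<psi> x) = burgers_rhs \<nu> \<chi>\<^sub>c c f \<phi> - burgers_rhs \<nu> \<chi>\<^sub>c c f \<psi>"
proof -
  have "inner_H (dx f) (dx (\<lambda>x. \<phi> x - \<psi> x)) = inner_H (dx f) (\<lambda>x. dx \<phi> x - dx \<psi> x)"
    by (rule inner_L2_cong_AE)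
      (use V.H1_diff[OF assms(3,4)] assms L2_diff[of "dx \<phi>" UNIV "dx \<psi>"] in \<open>auto intro: L2_measurable weak_deriv_H1\<close>)
  then show ?thesis
    using assms V_mult_L2(1)[OF assms(2) weak_deriv_H1(1)[OF assms(2)]]
    by (simp add: burgers_rhs_def inner_L2_diff_right H1_L2 weak_deriv_H1 right_diff_distrib)
qed

text \<open>Uniform boundedness of the state in \<open>V\<close> enters here: it bounds the
  quadratic convection term by a multiple of \<open>C * C\<close>, so the dual bound does not depend
  on time.\<close>

lemma burgers_rhs_bound:
  assumes "\<chi>\<^sub>c \<in> H" "f \<in> V" "\<phi> \<in> V" "\<bar>c\<bar> \<le> B" "norm_V f \<le> C" "0 < \<nu>"
  shows "\<bar>burgers_rhs \<nu> \<chi>\<^sub>c c f \<phi>\<bar> \<le> (B * norm_H \<chi>\<^sub>c + sqrt 2 * C * C + \<nu> * C) * norm_V \<phi>"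
proof -
  have C: "0 \<le> C" using assms(5) V.norm_H1_nonneg[of f] by linarith
  have n: "norm_H \<phi> \<le> norm_V \<phi>" "norm_H (dx \<phi>) \<le> norm_V \<phi>" "norm_H (dx f) \<le> C"
    using V.norm_L2_le_norm_H1[of \<phi>] V.norm_L2_le_norm_H1[of f] assms(5) by auto
  have nn: "0 \<le> norm_H g" "0 \<le> norm_V g" for g by (rule norm_L2_nonneg V.norm_H1_nonneg)+
  have 1: "\<bar>c * inner_H \<chi>\<^sub>c \<phi>\<bar> \<le> B * norm_H \<chi>\<^sub>c * norm_V \<phi>"
  proof -
    have "\<bar>inner_H \<chi>\<^sub>c \<phi>\<bar> \<le> norm_H \<chi>\<^sub>c * norm_V \<phi>"
      using Cauchy_Schwarz_L2[OF assms(1) H1_L2[OF assms(3)]] mult_left_mono[OF n(1) nn(1)] by (rule order_trans)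
    then have "\<bar>c\<bar> * \<bar>inner_H \<chi>\<^sub>c \<phi>\<bar> \<le> B * (norm_H \<chi>\<^sub>c * norm_V \<phi>)"
      using assms(4) by (intro mult_mono) auto
    then show ?thesis by (simp add: abs_mult mult.assoc)
  qed
  have 2: "\<bar>inner_H (\<lambda>x. f x * dx f x) \<phi>\<bar> \<le> sqrt 2 * C * C * norm_V \<phi>"
  proof -
    note d = weak_deriv_H1(1)[OF assms(2)]
    have "\<bar>inner_H (\<lambda>x. f x * dx f x) \<phi>\<bar> \<le> norm_H (\<lambda>x. f x * dx f x) * norm_H \<phi>"
      by (rule Cauchy_Schwarz_L2[OF V_mult_L2(1)[OF assms(2) d] H1_L2[OF assms(3)]])
    also have "\<dots> \<le> (sqrt 2 * norm_V f * norm_H (dx f)) * norm_V \<phi>"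
      using nn by (intro mult_mono V_mult_L2(2) n assms d) auto
    also have "\<dots> \<le> (sqrt 2 * C * C) * norm_V \<phi>"
      using nn C n assms(5) by (intro mult_right_mono mult_mono) auto
    finally show ?thesis .
  qed
  have 3: "\<bar>\<nu> * inner_H (dx f) (dx \<phi>)\<bar> \<le> \<nu> * C * norm_V \<phi>"
  proof -
    have "\<bar>inner_H (dx f) (dx \<phi>)\<bar> \<le> norm_H (dx f) * norm_H (dx \<phi>)"
      by (intro Cauchy_Schwarz_L2 weak_deriv_H1 assms)
    also have "\<dots> \<le> C * norm_V \<phi>" using nn C n by (intro mult_mono) auto
    finally show ?thesis using assms(6) by (simp add: abs_mult mult.assoc)
  qed
  show ?thesis using 1 2 3 unfolding burgers_rhs_def distrib_right by linarith
qed

lemma dt_W_V: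
  assumes "y \<in> W_V T"
  shows "dt T y \<in> Bochner_L2 T V_dual norm_V_dual" "is_time_deriv T y (dt T y)"
proof -
  have "\<exists>g. g \<in> Bochner_L2 T V_dual norm_V_dual \<and> is_time_deriv T y g"
    using assms by (auto simp: W_V_def)
  then have "dt T y \<in> Bochner_L2 T V_dual norm_V_dual \<and> is_time_deriv T y (dt T y)"
    unfolding dt_def by (rule someI_ex)
  then show "dt T y \<in> Bochner_L2 T V_dual norm_V_dual" "is_time_deriv T y (dt T y)" by auto
qed

lemma discrete_solution_equation:
  assumes "discrete_solution T \<nu> \<chi>\<^sub>c \<zeta> \<epsilon> N X y0 u y \<Phi>" "\<phi> \<in> V"
  shows "AE t in lebesgue_on {0<..<T}. dt T y t \<phi> = burgers_rhs \<nu> \<chi>\<^sub>c (u t) (y t) \<phi>"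
proof -
  have "AE t in lebesgue_on {0<..<T}. dt T y t \<phi> + inner_H (\<lambda>x. y t x * dx (y t) x) \<phi> + \<nu> * inner_H (dx (y t)) (dx \<phi>)
      = inner_H (control_op \<chi>\<^sub>c u t) \<phi>"
    using assms by (simp add: discrete_solution_def)
  moreover have "inner_H (control_op \<chi>\<^sub>c u t) \<phi> = u t * inner_H \<chi>\<^sub>c \<phi>" for t
  proof -
    have "control_op \<chi>\<^sub>c u t = (\<lambda>x. u t * \<chi>\<^sub>c x)" by (simp add: control_op_def fun_eq_iff mult.commute)
    then show ?thesis by (simp add: inner_L2_cmult_left)
  qed
  ultimately show ?thesis
    by (auto simp: burgers_rhs_def elim!: eventually_mono)
qed

text \<open>The bounds \<open>C\<close> on both states and \<open>B\<close> on the controls enter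
  only through the constants of the interpreted locale, and these disappear in
  \<open>energy_estimate\<close>. No bound on \<open>y\<close> survives in the conclusion, so
  \<open>y\<close> may run through a sequence.\<close>

lemma discrete_solution_stability:
  assumes T: "0 < T" and \<nu>: "0 < \<nu>" and \<chi>\<^sub>c: "\<chi>\<^sub>c \<in> H"
    and y: "discrete_solution T \<nu> \<chi>\<^sub>c \<zeta> \<epsilon> N X y0 u y \<Phi>"
    and z: "discrete_solution T \<nu> \<chi>\<^sub>c \<zeta> \<epsilon> N X y0 v z \<Psi>"
    and u: "u \<in> L2 {0<..<T}" "AE t in lebesgue_on {0<..<T}. \<bar>u t\<bar> \<le> B"
    and v: "v \<in> L2 {0<..<T}" "AE t in lebesgue_on {0<..<T}. \<bar>v t\<bar> \<le> B"
    and Cz: "AE t in lebesgue_on {0<..<T}. norm_V (z t) \<le> Cz"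
  shows "(norm_H (\<lambda>x. y T x - z T x))\<^sup>2
    \<le> (norm_H \<chi>\<^sub>c)\<^sup>2 * (norm_L2 {0<..<T} (\<lambda>t. u t - v t))\<^sup>2 * exp ((1 + Cz\<^sup>2 / \<nu>) * T)"
proof -
  let ?L = "lebesgue_on {0<..<T}"
  have yW: "y \<in> W_V T" and zW: "z \<in> W_V T" and yc: "continuous_into_H T y" and zc: "continuous_into_H T z"
    and yL: "y \<in> Bochner_Linf T V norm_V" and zL: "z \<in> Bochner_Linf T V norm_V"
    using y z by (auto simp: discrete_solution_def)
  obtain C1 where C1: "AE t in ?L. norm_V (y t) \<le> C1" using yL by (auto simp: Bochner_Linf_def)
  obtain C2 where C2: "AE t in ?L. norm_V (z t) \<le> C2" using zL by (auto simp: Bochner_Linf_def)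
  \<comment> \<open>The 0 ensures that \<open>?K\<close> is nonnegative.\<close>
  define C where "C = max (max C1 C2) 0"
  have bd: "AE t in ?L. norm_V (y t) \<le> C \<and> norm_V (z t) \<le> C"
    using C1 C2 by eventually_elim (simp add: C_def le_max_iff_disj)
  have ym: "strongly_measurable T V norm_V y" and zm: "strongly_measurable T V norm_V z"
    using yL zL by (auto simp: Bochner_Linf_def)
  have VV: "AE t in ?L. y t \<in> V \<and> z t \<in> V"
    using ym zm by (simp add: strongly_measurable_def)
  let ?w = "\<lambda>t x. y t x - z t x"
  let ?G = "\<lambda>t \<phi>. dt T y t \<phi> - dt T z t \<phi>"
  let ?A = "\<lambda>t \<phi>. burgers_rhs \<nu> \<chi>\<^sub>c (u t) (y t) \<phi> - burgers_rhs \<nu> \<chi>\<^sub>c (v t) (z t) \<phi>"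
  let ?N = "\<lambda>t. inner_H (?w t) (?w t)"
  let ?f = "\<lambda>t. (norm_H \<chi>\<^sub>c)\<^sup>2 * (u t - v t)\<^sup>2"
  let ?M = "\<lambda>t. 1 / 2 * ?f t + (1 / 2 + Cz\<^sup>2 / (2 * \<nu>)) * ?N t"
  \<comment> \<open>Factor 2 because \<open>?A\<close> is a difference of two right-hand sides, each
    within the same bound.\<close>
  let ?K = "2 * (\<bar>B\<bar> * norm_H \<chi>\<^sub>c + sqrt 2 * C * C + \<nu> * C)"
  have wc: "continuous_into_H T ?w" by (rule continuous_into_H_diff[OF yc zc])
  have yH: "y t \<in> H" "z t \<in> H" if "t \<in> {0..T}" for t
    using yc zc that by (auto simp: continuous_into_H_def)
  have Nc: "continuous_on {0..T} ?N" by (rule continuous_into_H_norm[OF wc])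
  have ua: "(\<lambda>t. (u t - v t)\<^sup>2) absolutely_integrable_on {0..T}"
    using L2_square_integrable[OF L2_diff[OF u(1) v(1)]] by (simp add: absolutely_integrable_Icc_iff)
  have fa: "?f absolutely_integrable_on {0..T}" by (intro set_integrable_mult_right ua)
  have Na: "?N absolutely_integrable_on {0..T}" by (rule absolutely_integrable_continuous_real[OF Nc])
  have dty: "(\<lambda>t. dt T q t \<phi>) absolutely_integrable_on {0..T}" if "q \<in> W_V T" "\<phi> \<in> V" for q \<phi>
    using dual_pairing_integrable[OF dt_W_V(1)[OF that(1)] that(2)] by (simp add: absolutely_integrable_Icc_iff)
  interpret weak_evolution T "2 * C" ?K ?w ?G ?A ?M
  proof
    show "0 < T" by (rule T)
    show "0 \<le> ?K" using \<nu> norm_L2_nonneg[of UNIV \<chi>\<^sub>c] by (auto simp: C_def intro!: add_nonneg_nonneg mult_nonneg_nonneg)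
    show "continuous_into_H T ?w" by (rule wc)
    show "strongly_measurable T V norm_V ?w" by (rule strongly_measurable_diff[OF ym zm])
    show "AE t in ?L. norm_V (?w t) \<le> 2 * C"
      using bd VV
    proof eventually_elim
      case (elim t)
      then show ?case
        using V.norm_H1_diff_triangle[of "y t" "\<lambda>x. 0" "z t"] V.H1_zero V.norm_H1_cmult[of "z t" "-1"] by simp
    qed
    show "(\<lambda>t. ?G t \<phi>) absolutely_integrable_on {0..T}" if "\<phi> \<in> V" for \<phi>
      by (intro set_integral_diff dty yW zW that)
    show "inner_H (?w b) \<phi> - inner_H (?w a) \<phi> = integral {a..b} (\<lambda>t. ?G t \<phi>)"
      if \<phi>: "\<phi> \<in> V" and ab: "0 \<le> a" "a \<le> b" "b \<le> T" for \<phi> a b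
    proof -
      have int: "(\<lambda>t. dt T q t \<phi>) integrable_on {a..b}" if "q \<in> W_V T" for q
        using absolutely_integrable_on_subinterval[OF dty[OF that \<phi>], of a b] ab set_lebesgue_integral_eq_integral(1) by auto
      have "integral {a..b} (\<lambda>t. ?G t \<phi>) = integral {a..b} (\<lambda>t. dt T y t \<phi>) - integral {a..b} (\<lambda>t. dt T z t \<phi>)"
        by (rule Henstock_Kurzweil_Integration.integral_diff[OF int[OF yW] int[OF zW]])
      also have "\<dots> = (inner_H (y b) \<phi> - inner_H (y a) \<phi>) - (inner_H (z b) \<phi> - inner_H (z a) \<phi>)"
        using time_deriv_increment[OF T yc dt_W_V(2)[OF yW] dt_W_V(1)[OF yW] \<phi> ab]
          time_deriv_increment[OF T zc dt_W_V(2)[OF zW] dt_W_V(1)[OF zW] \<phi> ab] by simp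
      finally show ?thesis using yH[of a] yH[of b] ab H1_L2[OF \<phi>] by (simp add: inner_L2_diff_left)
    qed
    show "AE t in ?L. ?G t \<phi> = ?A t \<phi>" if "\<phi> \<in> V" for \<phi>
      using discrete_solution_equation[OF y that] discrete_solution_equation[OF z that] by eventually_elim simp
    show "AE t in ?L. \<forall>\<phi>\<in>V. \<bar>?A t \<phi>\<bar> \<le> ?K * norm_V \<phi>"
      using bd VV u(2) v(2)
    proof eventually_elim
      case (elim t)
      show ?case
      proof
        fix \<phi> assume \<phi>: "\<phi> \<in> V"
        let ?k = "(\<bar>B\<bar> * norm_H \<chi>\<^sub>c + sqrt 2 * C * C + \<nu> * C) * norm_V \<phi>"
        have "\<bar>burgers_rhs \<nu> \<chi>\<^sub>c (u t) (y t) \<phi>\<bar> \<le> ?k" "\<bar>burgers_rhs \<nu> \<chi>\<^sub>c (v t) (z t) \<phi>\<bar> \<le> ?k"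
          by (rule burgers_rhs_bound[OF \<chi>\<^sub>c _ \<phi> _ _ \<nu>]; use elim in simp)+
        then have "\<bar>?A t \<phi>\<bar> \<le> 2 * ?k" by linarith
        then show "\<bar>?A t \<phi>\<bar> \<le> ?K * norm_V \<phi>" by (simp only: mult.assoc)
      qed
    qed
    show "AE t in ?L. \<forall>\<phi>\<in>V. \<forall>\<psi>\<in>V. ?A t (\<lambda>x. \<phi> x - \<psi> x) = ?A t \<phi> - ?A t \<psi>"
      using VV by eventually_elim (simp add: burgers_rhs_diff \<chi>\<^sub>c)
    show "?M absolutely_integrable_on {0..T}" by (intro set_integral_add set_integrable_mult_right fa Na)
    show "AE t in ?L. ?A t (?w t) \<le> ?M t"
      using VV Cz
    proof eventually_elim
      case (elim t)
      have "?A t (?w t) \<le> 1 / 2 * ((u t - v t)\<^sup>2 * (norm_H \<chi>\<^sub>c)\<^sup>2) + (1 / 2 + (norm_V (z t))\<^sup>2 / (2 * \<nu>)) * ?N t"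
        using burgers_difference_le[of "y t" "z t" \<chi>\<^sub>c \<nu> "u t - v t"] elim \<chi>\<^sub>c \<nu>
        by (simp add: burgers_rhs_def left_diff_distrib right_diff_distrib algebra_simps)
      also have "\<dots> \<le> ?M t"
      proof -
        have "(norm_V (z t))\<^sup>2 \<le> Cz\<^sup>2" using elim V.norm_H1_nonneg by (intro power_mono) auto
        then have "(1 / 2 + (norm_V (z t))\<^sup>2 / (2 * \<nu>)) * ?N t \<le> (1 / 2 + Cz\<^sup>2 / (2 * \<nu>)) * ?N t"
          using \<nu> by (intro mult_right_mono inner_L2_nonneg add_left_mono divide_right_mono) auto
        then show ?thesis by (simp add: mult.commute)
      qed
      finally show ?case .
    qed
  qed
  let ?F = "(norm_H \<chi>\<^sub>c)\<^sup>2 * (norm_L2 {0<..<T} (\<lambda>t. u t - v t))\<^sup>2" and ?\<kappa> = "1 + Cz\<^sup>2 / \<nu>"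
  \<comment> \<open>Both solutions take the same initial value against every element of
    \<open>H\<close>; the test function is their difference.\<close>
  have N0: "?N 0 = 0"
  proof -
    have H0: "?w 0 \<in> H" using yH[of 0] T by (intro L2_diff) auto
    have "inner_H (y 0) (?w 0) = inner_H (z 0) (?w 0)"
      using y z H0 by (simp add: discrete_solution_def)
    then show ?thesis using yH[of 0] T H0 by (simp add: inner_L2_diff_left)
  qed
  have "?N t \<le> ?F + ?\<kappa> * integral {0..t} ?N" if t: "t \<in> {0..T}" for t
  proof -
    have sub: "q absolutely_integrable_on {0..t}" if "q absolutely_integrable_on {0..T}" for q :: "real \<Rightarrow> real"
      by (rule absolutely_integrable_on_subinterval[OF that]) (use t in auto)
    have i: "q integrable_on {0..t}" if "q absolutely_integrable_on {0..T}" for q :: "real \<Rightarrow> real"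
      using sub[OF that] set_lebesgue_integral_eq_integral(1) by blast
    have "?N t \<le> 2 * integral {0..t} ?M" using energy_estimate[OF t] N0 by simp
    also have "integral {0..t} ?M = integral {0..t} (\<lambda>t. 1 / 2 * ?f t) + integral {0..t} (\<lambda>t. (1 / 2 + Cz\<^sup>2 / (2 * \<nu>)) * ?N t)"
      by (rule Henstock_Kurzweil_Integration.integral_add) (intro i set_integrable_mult_right fa Na)+
    also have "\<dots> = 1 / 2 * integral {0..t} ?f + (1 / 2 + Cz\<^sup>2 / (2 * \<nu>)) * integral {0..t} ?N"
      by (simp only: Henstock_Kurzweil_Integration.integral_mult_right)
    \<comment> \<open>\<open>?\<kappa>\<close> is twice the coefficient of \<open>?N\<close> in
      \<open>?M\<close>.\<close>
    also have "2 * \<dots> = integral {0..t} ?f + ?\<kappa> * integral {0..t} ?N"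
      using \<nu> by (simp add: field_simps)
    also have "integral {0..t} ?f \<le> integral {0..T} ?f"
      using t fa set_lebesgue_integral_eq_integral(1)[OF fa] by (intro integral_subset_le i) auto
    also have "integral {0..T} ?f = (norm_H \<chi>\<^sub>c)\<^sup>2 * integral {0<..<T} (\<lambda>t. (u t - v t)\<^sup>2)"
      by (simp only: Henstock_Kurzweil_Integration.integral_mult_right integral_open_interval_real)
    also have "integral {0<..<T} (\<lambda>t. (u t - v t)\<^sup>2) = (LINT t|?L. (u t - v t)\<^sup>2)"
      by (rule lebesgue_integral_eq_integral[symmetric]) (use L2_square_integrable[OF L2_diff[OF u(1) v(1)]] in auto)
    also have "\<dots> = (norm_L2 {0<..<T} (\<lambda>t. u t - v t))\<^sup>2"
      unfolding norm_L2_square unfolding inner_L2_def power2_eq_square ..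
    finally show ?thesis by simp
  qed
  then have "?N T \<le> ?F * exp (?\<kappa> * T)"
    using T \<nu> by (intro gronwall_integral[OF Nc]) auto
  then show ?thesis by (simp add: norm_L2_square)
qed

section \<open>Compactness and lower semicontinuity for the controls\<close>

text \<open>Fatou's lemma applied to the squares; it also shows that the limit is square
  integrable.\<close>

lemma L2_norm_le_of_AE_limit:
  fixes f :: "nat \<Rightarrow> real \<Rightarrow> real"
  assumes f: "\<And>k. f k \<in> L2 S" and g: "g \<in> borel_measurable (lebesgue_on S)"
    and lim: "AE x in lebesgue_on S. (\<lambda>k. f k x) \<longlonglongrightarrow> g x"
    and le: "\<forall>\<^sub>F k in sequentially. norm_L2 S (f k) \<le> e" and e: "0 \<le> e"
  shows "g \<in> L2 S" "norm_L2 S g \<le> e"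
proof -
  let ?L = "lebesgue_on S"
  have "(\<integral>\<^sup>+x. ennreal ((g x)\<^sup>2) \<partial>?L) = (\<integral>\<^sup>+x. liminf (\<lambda>k. ennreal ((f k x)\<^sup>2)) \<partial>?L)"
  proof (rule nn_integral_cong_AE)
    show "AE x in ?L. ennreal ((g x)\<^sup>2) = liminf (\<lambda>k. ennreal ((f k x)\<^sup>2))"
      using lim
    proof eventually_elim
      case (elim x)
      have "(\<lambda>k. ennreal ((f k x)\<^sup>2)) \<longlonglongrightarrow> ennreal ((g x)\<^sup>2)"
        by (intro tendsto_ennrealI tendsto_power elim)
      then show ?case by (rule lim_imp_Liminf[OF trivial_limit_sequentially, symmetric])
    qed
  qed
  also have "\<dots> \<le> liminf (\<lambda>k. \<integral>\<^sup>+x. ennreal ((f k x)\<^sup>2) \<partial>?L)"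
    using f by (intro nn_integral_liminf) (auto simp: L2_def)
  also have "\<dots> \<le> ennreal (e\<^sup>2)"
  proof (rule Liminf_le)
    show "\<forall>\<^sub>F k in sequentially. (\<integral>\<^sup>+x. ennreal ((f k x)\<^sup>2) \<partial>?L) \<le> ennreal (e\<^sup>2)"
      using le
    proof eventually_elim
      case (elim k)
      have "(\<integral>\<^sup>+x. ennreal ((f k x)\<^sup>2) \<partial>?L) = ennreal ((norm_L2 S (f k))\<^sup>2)"
        unfolding norm_L2_square inner_L2_def power2_eq_square[symmetric]
        by (rule nn_integral_eq_integral[OF L2_square_integrable[OF f]]) simp
      also have "\<dots> \<le> ennreal (e\<^sup>2)"
        by (intro ennreal_leI power_mono elim norm_L2_nonneg)
      finally show ?case .
    qed
  qed simp
  finally have fin: "(\<integral>\<^sup>+x. ennreal ((g x)\<^sup>2) \<partial>?L) \<le> ennreal (e\<^sup>2)" .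
  have int: "integrable ?L (\<lambda>x. (g x)\<^sup>2)"
  proof (rule integrableI_bounded)
    show "(\<lambda>x. (g x)\<^sup>2) \<in> borel_measurable ?L" using g by simp
    show "(\<integral>\<^sup>+x. ennreal (norm ((g x)\<^sup>2)) \<partial>?L) < \<infinity>"
      using le_less_trans[OF fin ennreal_less_top] by simp
  qed
  then show gL: "g \<in> L2 S" using g by (intro L2I)
  have "(norm_L2 S g)\<^sup>2 = (\<integral>x. (g x)\<^sup>2 \<partial>?L)"
    unfolding norm_L2_square unfolding inner_L2_def power2_eq_square ..
  then have "ennreal ((norm_L2 S g)\<^sup>2) \<le> ennreal (e\<^sup>2)"
    using fin nn_integral_eq_integral[OF int] by simp
  then have "(norm_L2 S g)\<^sup>2 \<le> e\<^sup>2" by simp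
  then show "norm_L2 S g \<le> e" using e by (rule power2_le_imp_le)
qed

text \<open>Riesz-Fischer: along a subsequence with increments below \<open>(1 / 2) ^ k\<close> the
  series of increments converges absolutely almost everywhere, and Fatou's lemma identifies the
  pointwise limit as the limit in norm. Finite measure lets the L2 bounds control the integrals of
  the increments.\<close>

lemma L2_complete:
  fixes f :: "nat \<Rightarrow> real \<Rightarrow> real"
  assumes S: "S \<in> lmeasurable" and f: "\<And>n. f n \<in> L2 S"
    and Cauchy: "\<And>e. 0 < e \<Longrightarrow> \<exists>N. \<forall>m\<ge>N. \<forall>n\<ge>N. norm_L2 S (\<lambda>x. f m x - f n x) < e"
  shows "\<exists>g\<in>L2 S. (\<lambda>n. norm_L2 S (\<lambda>x. f n x - g x)) \<longlonglongrightarrow> 0"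
proof -
  let ?L = "lebesgue_on S"
  have SL: "S \<in> sets lebesgue" using S by (rule fmeasurableD)
  have "\<forall>k. \<exists>N. \<forall>m\<ge>N. \<forall>n\<ge>N. norm_L2 S (\<lambda>x. f m x - f n x) < (1 / 2) ^ k"
    by (intro allI Cauchy) simp
  then obtain N where N: "\<And>k m n. m \<ge> N k \<Longrightarrow> n \<ge> N k \<Longrightarrow> norm_L2 S (\<lambda>x. f m x - f n x) < (1 / 2) ^ k"
    by metis
  \<comment> \<open>Both \<open>r k\<close> and \<open>r (Suc k)\<close> lie beyond the threshold
    \<open>N k\<close>, and the summand \<open>k\<close> makes \<open>r\<close> unbounded.\<close>
  define r where "r k = k + (\<Sum>i\<le>k. N i)" for k
  have rN: "N k \<le> r k" "N k \<le> r (Suc k)" "k \<le> r k" for k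
    using member_le_sum[of k "{..k}" N] by (simp_all add: r_def)
  define d where "d k x = f (r (Suc k)) x - f (r k) x" for k x
  have dL: "d k \<in> L2 S" for k unfolding d_def by (intro L2_diff f)
  have dint: "(\<integral>x. \<bar>d k x\<bar> \<partial>?L) \<le> sqrt (measure lebesgue S) * (1 / 2) ^ k" for k
  proof -
    have "norm_L2 S (d k) \<le> (1 / 2) ^ k" unfolding d_def using N[of k "r (Suc k)" "r k"] rN by simp
    then have "sqrt (measure lebesgue S) * norm_L2 S (d k) \<le> sqrt (measure lebesgue S) * (1 / 2) ^ k"
      by (intro mult_left_mono) auto
    with integral_le_norm_L2(2)[OF S dL] show ?thesis by (rule order_trans)
  qed
  have "(\<integral>\<^sup>+x. (\<Sum>k. ennreal \<bar>d k x\<bar>) \<partial>?L) = (\<Sum>k. \<integral>\<^sup>+x. ennreal \<bar>d k x\<bar> \<partial>?L)"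
    using L2_measurable[OF dL] by (intro nn_integral_suminf) auto
  also have "\<dots> = (\<Sum>k. ennreal (\<integral>x. \<bar>d k x\<bar> \<partial>?L))"
    by (intro suminf_cong nn_integral_eq_integral integrable_abs integral_le_norm_L2(1)[OF S dL]) simp
  also have "\<dots> \<le> (\<Sum>k. ennreal (sqrt (measure lebesgue S) * (1 / 2) ^ k))"
    by (intro suminf_le ennreal_leI dint) auto
  also have "\<dots> = ennreal (\<Sum>k. sqrt (measure lebesgue S) * (1 / 2) ^ k)"
    by (intro suminf_ennreal2 summable_mult summable_geometric) auto
  also have "\<dots> < \<infinity>" by simp
  finally have "AE x in ?L. (\<Sum>k. ennreal \<bar>d k x\<bar>) \<noteq> \<infinity>"
    using L2_measurable[OF dL] by (intro nn_integral_PInf_AE) auto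
  then have conv: "AE x in ?L. convergent (\<lambda>k. f (r k) x)"
  proof eventually_elim
    case (elim x)
    have "summable (\<lambda>k. \<bar>d k x\<bar>)" by (rule summable_suminf_not_top) (use elim in auto)
    then have "summable (\<lambda>k. d k x)" by (rule summable_rabs_cancel)
    then have "convergent (\<lambda>n. \<Sum>k<n. d k x)" by (rule summable_iff_convergent[THEN iffD1])
    moreover have "(\<Sum>k<n. d k x) = f (r n) x - f (r 0) x" for n
      unfolding d_def by (rule sum_lessThan_telescope)
    ultimately have "convergent (\<lambda>n. f (r n) x - f (r 0) x)" by simp
    then show ?case by (simp add: convergent_diff_const_right_iff)
  qed
  define g where "g x = lim (\<lambda>k. f (r k) x)" for x
  have gm: "g \<in> borel_measurable ?L"
    unfolding g_def by (rule borel_measurable_lim_metric) (use f in \<open>auto simp: L2_def\<close>)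
  have lim: "AE x in ?L. (\<lambda>k. f (r k) x) \<longlonglongrightarrow> g x"
    using conv by eventually_elim (simp add: g_def convergent_LIMSEQ_iff)
  have tail: "(\<lambda>x. f m x - g x) \<in> L2 S \<and> norm_L2 S (\<lambda>x. f m x - g x) \<le> (1 / 2) ^ k" if m: "m \<ge> N k" for m k
  proof -
    have "\<forall>\<^sub>F j in sequentially. norm_L2 S (\<lambda>x. f m x - f (r j) x) \<le> (1 / 2) ^ k"
    proof (rule eventually_sequentiallyI)
      fix j assume "N k \<le> j"
      then have "N k \<le> r j" using rN(3)[of j] by linarith
      then show "norm_L2 S (\<lambda>x. f m x - f (r j) x) \<le> (1 / 2) ^ k" using N[OF m, of "r j"] by simp
    qed
    moreover have "AE x in ?L. (\<lambda>j. f m x - f (r j) x) \<longlonglongrightarrow> f m x - g x"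
      using lim by eventually_elim (intro tendsto_intros)
    moreover have "(\<lambda>x. f m x - g x) \<in> borel_measurable ?L"
      by (rule borel_measurable_diff[OF L2_measurable[OF f] gm])
    ultimately show ?thesis
      using L2_norm_le_of_AE_limit[of "\<lambda>j x. f m x - f (r j) x" S "\<lambda>x. f m x - g x" "(1 / 2) ^ k"] L2_diff[OF f f] by simp
  qed
  have "(\<lambda>x. f (N 0) x - (f (N 0) x - g x)) \<in> L2 S" by (rule L2_diff[OF f conjunct1[OF tail[of 0 "N 0"]]]) simp
  then have "g \<in> L2 S" by simp
  moreover have "(\<lambda>n. norm_L2 S (\<lambda>x. f n x - g x)) \<longlonglongrightarrow> 0"
  proof (rule LIMSEQ_I)
    fix e :: real assume "0 < e"
    then obtain k where k: "(1 / 2) ^ k < e" using real_arch_pow_inv[of e "1 / 2"] by auto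
    show "\<exists>no. \<forall>n\<ge>no. norm (norm_L2 S (\<lambda>x. f n x - g x) - 0) < e"
    proof (intro exI[of _ "N k"] allI impI)
      fix n assume "N k \<le> n"
      then show "norm (norm_L2 S (\<lambda>x. f n x - g x) - 0) < e"
        using tail[of k n] k norm_L2_nonneg[of S] by simp
    qed
  qed
  ultimately show ?thesis by blast
qed

lemma parallelogram_L2:
  assumes "f \<in> L2 S" "g \<in> L2 S"
  shows "(norm_L2 S (\<lambda>x. f x - g x))\<^sup>2 = 2 * (norm_L2 S f)\<^sup>2 + 2 * (norm_L2 S g)\<^sup>2 - (norm_L2 S (\<lambda>x. f x + g x))\<^sup>2"
  by (simp add: norm_L2_square inner_L2_diff_diff[OF assms] inner_L2_add_add[OF assms])

text \<open>Weak sequential closedness of a ball, without weak convergence: minimal-norm elements among the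
  weak derivatives of functions ever closer to \<open>U\<close> form a Cauchy sequence by the parallelogram law.\<close>

lemma (in open_interval) weak_deriv_norm_le_of_L2_limit:
  fixes u :: "nat \<Rightarrow> real \<Rightarrow> real"
  assumes S: "S \<in> lmeasurable" and u: "\<And>n. u n \<in> H1 S" and U: "U \<in> L2 S"
    and lim: "(\<lambda>n. norm_L2 S (\<lambda>x. u n x - U x)) \<longlonglongrightarrow> 0"
    and bound: "\<forall>\<^sub>F n in sequentially. norm_L2 S (weak_deriv S (u n)) \<le> \<rho>"
  shows "U \<in> H1 S" "norm_L2 S (weak_deriv S U) \<le> \<rho>"
proof -
  let ?\<epsilon> = "\<lambda>n. inverse (real (Suc n))"
  \<comment> \<open>Convex sets that shrink as \<open>n\<close> grows; along them the infimum
    \<open>d n\<close> of the norms increases and stays below \<open>\<rho>\<close>.\<close>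
  define C where "C n = {g \<in> L2 S. \<exists>v\<in>L2 S. is_weak_deriv S v g \<and> norm_L2 S (\<lambda>x. v x - U x) \<le> ?\<epsilon> n}" for n
  define d where "d n = Inf (norm_L2 S ` C n)" for n
  have bdd: "bdd_below (norm_L2 S ` C n)" for n
    by (rule bdd_belowI2[of _ 0]) (rule norm_L2_nonneg)
  have ex: "\<exists>g\<in>C n. norm_L2 S g \<le> \<rho>" for n
  proof -
    have "\<forall>\<^sub>F k in sequentially. norm_L2 S (\<lambda>x. u k x - U x) < ?\<epsilon> n"
      by (rule order_tendstoD(2)[OF lim]) simp
    with bound have "\<forall>\<^sub>F k in sequentially. norm_L2 S (\<lambda>x. u k x - U x) < ?\<epsilon> n \<and> norm_L2 S (weak_deriv S (u k)) \<le> \<rho>"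
      by eventually_elim simp
    then obtain k where k: "norm_L2 S (\<lambda>x. u k x - U x) < ?\<epsilon> n" "norm_L2 S (weak_deriv S (u k)) \<le> \<rho>"
      by (metis (mono_tags, lifting) eventually_happens trivial_limit_sequentially)
    have "weak_deriv S (u k) \<in> C n"
      unfolding C_def using k(1) weak_deriv_H1[OF u, of k] H1_L2[OF u, of k] by (auto intro!: bexI[of _ "u k"])
    then show ?thesis using k(2) by blast
  qed
  have d_le: "d n \<le> norm_L2 S g" if "g \<in> C n" for n g
    unfolding d_def using that bdd by (intro cINF_lower)
  have d\<rho>: "d n \<le> \<rho>" for n using ex[of n] d_le by (meson order_trans)
  have d0: "0 \<le> d n" for n
    unfolding d_def using ex[of n] by (intro cINF_greatest norm_L2_nonneg) auto
  have \<epsilon>_mono: "?\<epsilon> m \<le> ?\<epsilon> n" if "n \<le> m" for m n using that by (simp add: field_simps)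
  have C_mono: "C m \<subseteq> C n" if "n \<le> m" for m n
    unfolding C_def using \<epsilon>_mono[OF that] by (blast intro: order_trans)
  have d_mono: "d n \<le> d m" if "n \<le> m" for m n
    unfolding d_def[of m] using ex[of m] C_mono[OF that] by (intro cINF_greatest) (auto intro: d_le)
  have "\<exists>g\<in>C n. norm_L2 S g < d n + ?\<epsilon> n" for n
  proof -
    have "Inf (norm_L2 S ` C n) < d n + ?\<epsilon> n" by (simp add: d_def)
    moreover have "norm_L2 S ` C n \<noteq> {}" using ex[of n] by auto
    ultimately obtain c where "c \<in> norm_L2 S ` C n" "c < d n + ?\<epsilon> n"
      using cInf_lessD by metis
    then show ?thesis by blast
  qed
  then have "\<forall>n. \<exists>g. g \<in> C n \<and> norm_L2 S g < d n + ?\<epsilon> n" by blast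
  from choice[OF this] obtain \<gamma> where \<gamma>: "\<And>n. \<gamma> n \<in> C n" "\<And>n. norm_L2 S (\<gamma> n) < d n + ?\<epsilon> n"
    by blast
  have "\<exists>v\<in>L2 S. is_weak_deriv S v (\<gamma> n) \<and> norm_L2 S (\<lambda>x. v x - U x) \<le> ?\<epsilon> n" for n
    using \<gamma>(1)[of n] by (auto simp: C_def)
  then obtain v where v: "\<And>n. v n \<in> L2 S" "\<And>n. is_weak_deriv S (v n) (\<gamma> n)" "\<And>n. norm_L2 S (\<lambda>x. v n x - U x) \<le> ?\<epsilon> n"
    by metis
  have \<gamma>L: "\<gamma> n \<in> L2 S" for n using \<gamma>(1)[of n] by (simp add: C_def)
  have "incseq d" using d_mono by (auto simp: incseq_def)
  then obtain \<delta> where \<delta>: "d \<longlonglongrightarrow> \<delta>" "\<And>n. d n \<le> \<delta>"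
    using incseq_convergent[of d \<rho>] d\<rho> by auto
  have \<epsilon>0: "?\<epsilon> \<longlonglongrightarrow> 0" by (rule LIMSEQ_inverse_real_of_nat)
  \<comment> \<open>Midpoints stay in \<open>C n\<close>, so their norm cannot fall below the
    infimum; this is the lower bound that the parallelogram law needs.\<close>
  have mid: "d n \<le> norm_L2 S (\<lambda>x. 1 / 2 * (\<gamma> n x + \<gamma> m x))" if "n \<le> m" for n m
  proof (rule d_le)
    have 1: "is_weak_deriv S (\<lambda>x. 1 / 2 * (v n x + v m x)) (\<lambda>x. 1 / 2 * (\<gamma> n x + \<gamma> m x))"
      by (intro is_weak_deriv_cmult is_weak_deriv_add v \<gamma>L)
    have 2: "(\<lambda>x. 1 / 2 * (v n x + v m x)) \<in> L2 S" "(\<lambda>x. 1 / 2 * (\<gamma> n x + \<gamma> m x)) \<in> L2 S"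
      by (intro L2_cmult L2_add v \<gamma>L)+
    have "norm_L2 S (\<lambda>x. 1 / 2 * (v n x + v m x) - U x) = norm_L2 S (\<lambda>x. 1 / 2 * ((v n x - U x) + (v m x - U x)))"
      by (rule arg_cong[of _ _ "norm_L2 S"]) (auto simp: field_simps)
    also have "\<dots> \<le> 1 / 2 * (norm_L2 S (\<lambda>x. v n x - U x) + norm_L2 S (\<lambda>x. v m x - U x))"
      using norm_L2_triangle[OF L2_diff[OF v(1) U] L2_diff[OF v(1) U], of n m] by (subst norm_L2_cmult) simp
    also have "\<dots> \<le> 1 / 2 * (?\<epsilon> n + ?\<epsilon> n)"
      by (intro mult_left_mono add_mono v(3) order_trans[OF v(3) \<epsilon>_mono[OF that]]) simp
    also have "\<dots> = ?\<epsilon> n" by simp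
    finally show "(\<lambda>x. 1 / 2 * (\<gamma> n x + \<gamma> m x)) \<in> C n"
      unfolding C_def using 1 2 by blast
  qed
  \<comment> \<open>Parallelogram law with both norms at most
    \<open>\<delta> + ?\<epsilon> n\<close> and the norm of the sum at least
    \<open>2 * d n\<close>.\<close>
  define \<tau> where "\<tau> n = 4 * ((\<delta> + ?\<epsilon> n)\<^sup>2 - (d n)\<^sup>2)" for n
  have \<tau>0: "\<tau> \<longlonglongrightarrow> 0"
  proof -
    have "\<tau> \<longlonglongrightarrow> 4 * ((\<delta> + 0)\<^sup>2 - \<delta>\<^sup>2)" unfolding \<tau>_def by (intro tendsto_intros \<delta> \<epsilon>0)
    then show ?thesis by simp
  qed
  have close: "(norm_L2 S (\<lambda>x. \<gamma> n x - \<gamma> m x))\<^sup>2 \<le> \<tau> n" if "n \<le> m" for n m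
  proof -
    have sq: "(norm_L2 S (\<gamma> k))\<^sup>2 \<le> (\<delta> + ?\<epsilon> n)\<^sup>2" if "n \<le> k" for k
      using \<gamma>(2)[of k] \<delta>(2)[of k] \<epsilon>_mono[OF that] by (intro power_mono norm_L2_nonneg) linarith
    have "norm_L2 S (\<lambda>x. \<gamma> n x + \<gamma> m x) = 2 * norm_L2 S (\<lambda>x. 1 / 2 * (\<gamma> n x + \<gamma> m x))"
      by (subst norm_L2_cmult) simp
    then have "2 * d n \<le> norm_L2 S (\<lambda>x. \<gamma> n x + \<gamma> m x)" using mid[OF that] by simp
    then have "(2 * d n)\<^sup>2 \<le> (norm_L2 S (\<lambda>x. \<gamma> n x + \<gamma> m x))\<^sup>2" by (rule power_mono) (simp add: d0)
    with sq[of n] sq[OF that] show ?thesis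
      unfolding parallelogram_L2[OF \<gamma>L \<gamma>L] \<tau>_def by (simp add: power_mult_distrib)
  qed
  have "\<exists>g\<in>L2 S. (\<lambda>n. norm_L2 S (\<lambda>x. \<gamma> n x - g x)) \<longlonglongrightarrow> 0"
  proof (rule L2_complete[OF S \<gamma>L])
    fix e :: real assume e: "0 < e"
    then have "\<forall>\<^sub>F n in sequentially. \<tau> n < e\<^sup>2" by (intro order_tendstoD(2)[OF \<tau>0]) simp
    then obtain N where N: "\<And>n. N \<le> n \<Longrightarrow> \<tau> n < e\<^sup>2" by (auto simp: eventually_sequentially)
    have *: "norm_L2 S (\<lambda>x. \<gamma> n x - \<gamma> m x) < e" if "N \<le> n" "n \<le> m" for n m
      using close[OF that(2)] N[OF that(1)] e by (intro power2_less_imp_less[of _ e]) auto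
    show "\<exists>N. \<forall>m\<ge>N. \<forall>n\<ge>N. norm_L2 S (\<lambda>x. \<gamma> m x - \<gamma> n x) < e"
    proof (intro exI[of _ N] allI impI)
      fix m n assume "N \<le> m" "N \<le> n"
      then show "norm_L2 S (\<lambda>x. \<gamma> m x - \<gamma> n x) < e"
        using *[of m n] *[of n m] norm_L2_minus[of S "\<gamma> m" "\<gamma> n"] by (cases "m \<le> n") auto
    qed
  qed
  then obtain g where g: "g \<in> L2 S" "(\<lambda>n. norm_L2 S (\<lambda>x. \<gamma> n x - g x)) \<longlonglongrightarrow> 0" by blast
  have vU: "(\<lambda>n. norm_L2 S (\<lambda>x. v n x - U x)) \<longlonglongrightarrow> 0"
    by (rule Lim_null_comparison[OF always_eventually \<epsilon>0]) (use v(3) norm_L2_nonneg in simp)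
  have wd: "is_weak_deriv S U g"
    unfolding is_weak_deriv_inner
  proof
    fix \<phi> assume \<phi>: "\<phi> \<in> Cc_inf S"
    note \<phi>L = Cc_inf_L2[OF \<phi> open_S interval_S]
    have "(\<lambda>n. inner_L2 S (v n) (deriv \<phi>)) \<longlonglongrightarrow> inner_L2 S U (deriv \<phi>)"
      by (rule tendsto_inner_L2[OF v(1) U vU \<phi>L(2)])
    moreover have "(\<lambda>n. - inner_L2 S (\<gamma> n) \<phi>) \<longlonglongrightarrow> - inner_L2 S g \<phi>"
      by (rule tendsto_minus[OF tendsto_inner_L2[OF \<gamma>L g \<phi>L(1)]])
    moreover have "inner_L2 S (v n) (deriv \<phi>) = - inner_L2 S (\<gamma> n) \<phi>" for n
      using v(2) \<phi> by (simp add: is_weak_deriv_inner)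
    ultimately show "inner_L2 S U (deriv \<phi>) = - inner_L2 S g \<phi>"
      using LIMSEQ_unique by simp
  qed
  show UH: "U \<in> H1 S" using U g(1) wd by (auto simp: H1_def)
  have "norm_L2 S (weak_deriv S U) = norm_L2 S g"
    by (rule norm_L2_cong_AE[OF weak_deriv_AE_eq[OF UH g(1) wd]]) (intro L2_measurable weak_deriv_H1 UH g)+
  also have "\<dots> \<le> \<rho> + 0"
  proof (rule LIMSEQ_le)
    show "(\<lambda>n. norm_L2 S (\<gamma> n)) \<longlonglongrightarrow> norm_L2 S g" by (rule tendsto_norm_L2[OF \<gamma>L g])
    show "(\<lambda>n. \<rho> + ?\<epsilon> n) \<longlonglongrightarrow> \<rho> + 0" by (intro tendsto_intros \<epsilon>0)
    show "\<exists>N. \<forall>n\<ge>N. norm_L2 S (\<gamma> n) \<le> \<rho> + ?\<epsilon> n"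
      using \<gamma>(2) d\<rho> by (meson add_right_mono less_eq_real_def order_trans)
  qed
  finally show "norm_L2 S (weak_deriv S U) \<le> \<rho>" by simp
qed

section \<open>Hoelder bounds and compactness for the controls\<close>

lemma L2_subset:
  assumes "A \<subseteq> B" "A \<in> sets lebesgue" "B \<in> sets lebesgue" "f \<in> L2 B"
  shows "f \<in> L2 A" "norm_L2 A f \<le> norm_L2 B f"
proof -
  have iB: "integrable lebesgue (\<lambda>x. indicat_real B x *\<^sub>R (f x)\<^sup>2)"
    using L2_square_integrable[OF assms(4)] assms(3) by (simp add: integrable_restrict_space)
  have eq: "indicat_real A x *\<^sub>R indicat_real B x *\<^sub>R (f x)\<^sup>2 = indicat_real A x *\<^sub>R (f x)\<^sup>2" for x
    using assms(1) by (auto simp: indicator_def)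
  have iA: "integrable lebesgue (\<lambda>x. indicat_real A x *\<^sub>R (f x)\<^sup>2)"
    using integrable_mult_indicator[OF assms(2) iB] unfolding eq .
  show "f \<in> L2 A"
  proof (rule L2I)
    show "f \<in> borel_measurable (lebesgue_on A)"
      using L2_measurable[OF assms(4)] assms(1) by (rule measurable_restrict_mono)
    show "integrable (lebesgue_on A) (\<lambda>x. (f x)\<^sup>2)" using iA assms(2) by (simp add: integrable_restrict_space)
  qed
  have "inner_L2 A f f = (LINT x|lebesgue. indicat_real A x *\<^sub>R (f x)\<^sup>2)"
    using assms(2) by (simp add: inner_L2_def integral_restrict_space power2_eq_square)
  also have "\<dots> \<le> (LINT x|lebesgue. indicat_real B x *\<^sub>R (f x)\<^sup>2)"
    by (rule integral_mono[OF iA iB]) (use assms(1) in \<open>auto simp: indicator_def\<close>)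
  also have "\<dots> = inner_L2 B f f"
    using assms(3) by (simp add: inner_L2_def integral_restrict_space power2_eq_square)
  finally show "norm_L2 A f \<le> norm_L2 B f" by (simp add: norm_L2_def)
qed

lemma abs_integral_le_sqrt_norm_L2:
  assumes "0 \<le> s" "s \<le> t" "t \<le> T" "g \<in> L2 {0<..<T}"
  shows "\<bar>integral {s..t} g\<bar> \<le> sqrt (t - s) * norm_L2 {0<..<T} g"
proof -
  have sub: "{s<..<t} \<subseteq> {0<..<T}" using assms by auto
  have lm: "{s<..<t} \<in> lmeasurable" by simp
  note g = L2_subset[OF sub _ _ assms(4)]
  have gL: "g \<in> L2 {s<..<t}" by (rule g) auto
  have "\<bar>integral {s..t} g\<bar> = \<bar>LINT x|lebesgue_on {s<..<t}. g x\<bar>"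
    using lebesgue_integral_eq_integral[OF integral_le_norm_L2(1)[OF lm gL]] by (simp add: integral_open_interval_real)
  also have "\<dots> \<le> (LINT x|lebesgue_on {s<..<t}. \<bar>g x\<bar>)" by (rule integral_abs_bound)
  also have "\<dots> \<le> sqrt (measure lebesgue {s<..<t}) * norm_L2 {s<..<t} g" by (rule integral_le_norm_L2(2)[OF lm gL])
  also have "\<dots> \<le> sqrt (t - s) * norm_L2 {0<..<T} g"
    using assms(2) g(2) by (intro mult_mono norm_L2_nonneg) auto
  finally show ?thesis .
qed

text \<open>The increments are integrals of the weak derivative, and Cauchy-Schwarz makes them
  Hoelder continuous of exponent 1/2 up to the end points.\<close>

lemma H1_continuous_representative:
  assumes T: "0 < T" and u: "u \<in> H1 {0<..<T}"
  obtains E where "continuous_on {0..T} E" "AE t in lebesgue_on {0<..<T}. u t = E t"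
    "\<And>s t. s \<in> {0..T} \<Longrightarrow> t \<in> {0..T} \<Longrightarrow> \<bar>E t - E s\<bar> \<le> sqrt \<bar>t - s\<bar> * norm_L2 {0<..<T} (weak_deriv {0<..<T} u)"
proof -
  let ?I = "{0<..<T}" and ?g = "weak_deriv {0<..<T} u"
  interpret I: open_interval ?I by unfold_locales (auto simp: is_interval_1)
  have gL: "?g \<in> L2 ?I" by (rule weak_deriv_H1[OF u])
  have ga: "?g absolutely_integrable_on {0..T}"
    using integral_le_norm_L2(1)[OF _ gL] by (simp add: absolutely_integrable_Icc_iff)
  obtain F where F: "is_primitive ?I F ?g" "AE t in lebesgue_on ?I. u t = F t"
    by (rule I.H1_representation[OF u])
  obtain E where E: "continuous_on {0..T} E" "\<And>t. t \<in> ?I \<Longrightarrow> E t = F t"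
    "\<And>s t. 0 \<le> s \<Longrightarrow> s \<le> t \<Longrightarrow> t \<le> T \<Longrightarrow> E t - E s = integral {s..t} ?g"
    using primitive_extends_to_Icc[OF T ga F(1)] by blast
  have inI: "AE t in lebesgue_on ?I. t \<in> ?I" by (rule AE_I2) simp
  show ?thesis
  proof (rule that[of E])
    show "continuous_on {0..T} E" by (rule E(1))
    show "AE t in lebesgue_on ?I. u t = E t" using F(2) inI by eventually_elim (simp add: E(2))
    have *: "\<bar>E t - E s\<bar> \<le> sqrt \<bar>t - s\<bar> * norm_L2 ?I ?g" if "0 \<le> s" "s \<le> t" "t \<le> T" for s t
      using abs_integral_le_sqrt_norm_L2[OF that gL] E(3)[OF that] that by simp
    show "\<bar>E t - E s\<bar> \<le> sqrt \<bar>t - s\<bar> * norm_L2 ?I ?g" if "s \<in> {0..T}" "t \<in> {0..T}" for s t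
      using *[of s t] *[of t s] that by (cases "s \<le> t") (auto simp: abs_minus_commute)
  qed
qed

text \<open>The Hoelder bound gives equicontinuity, and the control constraints give the uniform
  bound, which derivatives alone could not. Uniform convergence of the continuous representatives
  implies convergence in L2 on the bounded interval, and the constraints pass to the pointwise
  limit.\<close>

lemma H1_bounded_compact_L2:
  fixes u :: "nat \<Rightarrow> real \<Rightarrow> real"
  assumes T: "0 < T" and u: "\<And>n. u n \<in> U_ad T ul uu"
    and R: "\<And>n. norm_L2 {0<..<T} (weak_deriv {0<..<T} (u n)) \<le> R"
  obtains U r where "strict_mono (r :: nat \<Rightarrow> nat)" "U \<in> L2 {0<..<T}"
    "(\<lambda>n. norm_L2 {0<..<T} (\<lambda>t. u (r n) t - U t)) \<longlonglongrightarrow> 0"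
    "AE t in lebesgue_on {0<..<T}. ul \<le> U t \<and> U t \<le> uu"
proof -
  let ?I = "{0<..<T}"
  let ?L = "lebesgue_on ?I"
  define B where "B = max \<bar>ul\<bar> \<bar>uu\<bar>"
  have uH: "u n \<in> H1 ?I" and ub: "AE t in ?L. ul \<le> u n t \<and> u n t \<le> uu" for n
    using u[of n] by (auto simp: U_ad_def)
  have R0: "0 \<le> R" using R[of 0] norm_L2_nonneg by (rule order_trans[rotated])
  have "\<exists>E. continuous_on {0..T} E \<and> (AE t in ?L. u n t = E t) \<and>
      (\<forall>s\<in>{0..T}. \<forall>t\<in>{0..T}. \<bar>E t - E s\<bar> \<le> sqrt \<bar>t - s\<bar> * R)" for n
  proof -
    obtain E where E: "continuous_on {0..T} E" "AE t in ?L. u n t = E t"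
      "\<And>s t. s \<in> {0..T} \<Longrightarrow> t \<in> {0..T} \<Longrightarrow> \<bar>E t - E s\<bar> \<le> sqrt \<bar>t - s\<bar> * norm_L2 ?I (weak_deriv ?I (u n))"
      by (rule H1_continuous_representative[OF T uH[of n]], rule that) blast+
    have "\<bar>E t - E s\<bar> \<le> sqrt \<bar>t - s\<bar> * R" if "s \<in> {0..T}" "t \<in> {0..T}" for s t
    proof -
      have "sqrt \<bar>t - s\<bar> * norm_L2 ?I (weak_deriv ?I (u n)) \<le> sqrt \<bar>t - s\<bar> * R"
        by (intro mult_left_mono R) simp
      with E(3)[OF that] show ?thesis by (rule order_trans)
    qed
    with E(1,2) show ?thesis by blast
  qed
  then obtain E where E: "\<And>n. continuous_on {0..T} (E n)" "\<And>n. AE t in ?L. u n t = E n t"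
    and hoelder: "\<And>n s t. s \<in> {0..T} \<Longrightarrow> t \<in> {0..T} \<Longrightarrow> \<bar>E n t - E n s\<bar> \<le> sqrt \<bar>t - s\<bar> * R"
    by metis
  have mid: "\<bar>E n (T / 2)\<bar> \<le> B" for n
  proof -
    \<comment> \<open>The excess over \<open>B\<close> is continuous and vanishes almost everywhere,
      hence everywhere inside. One point is enough; the Hoelder bound covers the others, end points
      included.\<close>
    have "max (\<bar>E n (T / 2)\<bar> - B) 0 = 0"
    proof (rule AE_zero_continuous[of ?I "\<lambda>t. max (\<bar>E n t\<bar> - B) 0"])
      show "continuous_on ?I (\<lambda>t. max (\<bar>E n t\<bar> - B) 0)"
        by (intro continuous_intros continuous_on_subset[OF E(1)]) auto
      show "AE t in ?L. max (\<bar>E n t\<bar> - B) 0 = 0"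
        using E(2)[of n] ub[of n] by eventually_elim (auto simp: B_def)
    qed (use T in auto)
    then show ?thesis by (simp add: max_def split: if_splits)
  qed
  have bound: "norm (E n t) \<le> B + sqrt T * R" if "t \<in> {0..T}" for n t
  proof -
    have "\<bar>E n t - E n (T / 2)\<bar> \<le> sqrt \<bar>t - T / 2\<bar> * R" by (rule hoelder) (use that T in auto)
    also have "\<dots> \<le> sqrt T * R" using that R0 by (intro mult_right_mono real_sqrt_le_mono) auto
    finally show ?thesis using mid[of n] by simp
  qed
  have equi: "\<exists>d. 0 < d \<and> (\<forall>n y. y \<in> {0..T} \<and> norm (x - y) < d \<longrightarrow> norm (E n x - E n y) < e)"
    if x: "x \<in> {0..T}" and e: "0 < e" for x e
  \<comment> \<open>Inverse of the Hoelder modulus; \<open>R + 1\<close> keeps the quotient defined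
    for \<open>R = 0\<close> and the final inequality strict.\<close>
  proof (intro exI[of _ "(e / (R + 1))\<^sup>2"] conjI allI impI)
    show "0 < (e / (R + 1))\<^sup>2" using e R0 by simp
    fix n y assume y: "y \<in> {0..T} \<and> norm (x - y) < (e / (R + 1))\<^sup>2"
    have "sqrt \<bar>x - y\<bar> \<le> e / (R + 1)"
      using y e R0 by (intro real_le_lsqrt) auto
    then have "sqrt \<bar>x - y\<bar> * R \<le> e / (R + 1) * R" using R0 by (rule mult_right_mono)
    also have "\<dots> < e" using e R0 by (simp add: field_simps)
    finally show "norm (E n x - E n y) < e" using hoelder[of y x n] x y by simp
  qed
  obtain U r where U: "continuous_on {0..T} U" "strict_mono (r :: nat \<Rightarrow> nat)"
    "\<And>e. 0 < e \<Longrightarrow> \<exists>N. \<forall>n t. n \<ge> N \<and> t \<in> {0..T} \<longrightarrow> norm (E (r n) t - U t) < e"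
    using Arzela_Ascoli[of "{0..T}" E "B + sqrt T * R"] bound equi by (auto simp del: real_norm_def)
  have lm: "?I \<in> lmeasurable" by simp
  have inI: "AE t in ?L. t \<in> ?I" by (rule AE_I2) simp
  have Um: "U \<in> borel_measurable ?L"
    by (rule continuous_imp_measurable_on_sets_lebesgue[OF continuous_on_subset[OF U(1)]]) auto
  have "AE t in ?L. \<forall>n. u n t = E n t \<and> ul \<le> u n t \<and> u n t \<le> uu"
    using E(2) ub by (simp add: AE_all_countable)
  then have bounds: "AE t in ?L. ul \<le> U t \<and> U t \<le> uu"
    using inI
  proof eventually_elim
    case (elim t)
    have "(\<lambda>n. E (r n) t) \<longlonglongrightarrow> U t"
    proof (rule LIMSEQ_I)
      fix e :: real assume "0 < e"
      then show "\<exists>no. \<forall>n\<ge>no. norm (E (r n) t - U t) < e"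
        using U(3)[of e] elim(2) by (meson atLeastAtMost_iff greaterThanLessThan_iff less_imp_le)
    qed
    moreover have "ul \<le> E (r n) t" "E (r n) t \<le> uu" for n using elim(1) by metis+
    ultimately show ?case by (auto intro: LIMSEQ_le_const LIMSEQ_le_const2)
  qed
  have UL: "U \<in> L2 ?I"
  proof (rule L2_bounded[OF lm Um])
    show "AE t in ?L. \<bar>U t\<bar> \<le> B" using bounds by eventually_elim (auto simp: B_def)
  qed
  have conv: "(\<lambda>n. norm_L2 ?I (\<lambda>t. u (r n) t - U t)) \<longlonglongrightarrow> 0"
  proof (rule LIMSEQ_I)
    fix e :: real assume e: "0 < e"
    \<comment> \<open>A supremum bound costs a factor \<open>sqrt T\<close> in L2; the 2 makes the
      final inequality strict.\<close>
    define e' where "e' = e / (2 * sqrt T)"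
    have e': "0 < e'" using e T by (simp add: e'_def)
    obtain N where N: "\<And>n t. n \<ge> N \<Longrightarrow> t \<in> {0..T} \<Longrightarrow> norm (E (r n) t - U t) < e'"
      using U(3)[OF e'] by blast
    show "\<exists>no. \<forall>n\<ge>no. norm (norm_L2 ?I (\<lambda>t. u (r n) t - U t) - 0) < e"
    proof (intro exI[of _ N] allI impI)
      fix n assume n: "N \<le> n"
      have "norm_L2 ?I (\<lambda>t. u (r n) t - U t) \<le> e' * sqrt (measure lebesgue ?I)"
      proof (rule norm_L2_bounded[OF lm])
        show "(\<lambda>t. u (r n) t - U t) \<in> borel_measurable ?L"
          by (intro L2_measurable L2_diff H1_L2 uH UL)
        show "AE t in ?L. \<bar>u (r n) t - U t\<bar> \<le> e'"
          using E(2)[of "r n"] inI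
        proof eventually_elim
          case (elim t)
          then show ?case using N[OF n, of t] by simp
        qed
      qed (use e' in simp)
      also have "\<dots> < e" using e T by (simp add: e'_def)
      finally show "norm (norm_L2 ?I (\<lambda>t. u (r n) t - U t) - 0) < e"
        using norm_L2_nonneg by simp
    qed
  qed
  show ?thesis by (rule that[OF U(2) UL conv bounds])
qed

text \<open>Provides a competitor, so that the infimum of the cost is not taken over the empty
  set.\<close>

lemma U_ad_const:
  assumes "0 < T" "ul \<le> uu"
  shows "(\<lambda>t. ul) \<in> U_ad T ul uu"
proof -
  interpret I: open_interval "{0<..<T}" by unfold_locales (auto simp: is_interval_1)
  have "is_primitive {0<..<T} (\<lambda>t. ul) (\<lambda>t. 0)" by (auto simp: is_primitive_def locally_integrable_def)
  then have "is_weak_deriv {0<..<T} (\<lambda>t. ul) (\<lambda>t. 0)"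
    by (rule is_weak_deriv_primitive[OF I.open_S I.interval_S])
  moreover have "(\<lambda>t. ul) \<in> L2 {0<..<T}" by (rule L2_bounded[of _ _ "\<bar>ul\<bar>"]) auto
  ultimately show ?thesis using L2_zero assms(2) by (auto simp: U_ad_def H1_def)
qed

section \<open>Passage to the limit along a minimising sequence\<close>

theorem theorem4p5:
  fixes T \<nu> \<sigma> ul uu \<epsilon> :: real
    and \<chi>\<^sub>c yd \<zeta> y0 :: "real \<Rightarrow> real"
    and r N :: nat
    and X h :: "nat \<Rightarrow> real"
  assumes "T > 0" and "\<nu> > 0" and "\<sigma> > 0" and "ul \<le> uu"
    and "\<chi>\<^sub>c \<in> Cc_inf UNIV"
    and "yd \<in> H" and "compact (ess_support yd)"
    and "smoothing_kernel r \<zeta>" and "0 < \<epsilon>" and "\<epsilon> \<le> 1"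
    and "y0 \<in> V_bdd"
    and "initial_points N X h y0"
    and "\<And>u. u \<in> U_ad T ul uu \<Longrightarrow> unique_discrete_solution T \<nu> \<chi>\<^sub>c \<zeta> \<epsilon> N X y0 u"
  shows "\<exists>u y \<Phi>. optimal_solution T \<nu> \<sigma> \<chi>\<^sub>c yd ul uu \<zeta> \<epsilon> N X y0 u y \<Phi>"
proof -
  let ?I = "{0<..<T}"
  let ?sol = "discrete_solution T \<nu> \<chi>\<^sub>c \<zeta> \<epsilon> N X y0"
  note T = assms(1) and \<sigma> = assms(3)
  interpret I: open_interval ?I by unfold_locales (auto simp: is_interval_1)
  have lm: "?I \<in> lmeasurable" by simp
  have \<chi>\<^sub>c: "\<chi>\<^sub>c \<in> H" by (rule Cc_inf_L2(1)[OF assms(5)]) auto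
  have sol_ex: "\<exists>y \<Phi>. ?sol u y \<Phi>" if "u \<in> U_ad T ul uu" for u
    using assms(13)[OF that] by (auto simp: unique_discrete_solution_def)
  define J where "J = {cost T \<sigma> yd y u | u y \<Phi>. u \<in> U_ad T ul uu \<and> ?sol u y \<Phi>}"
  have J0: "0 \<le> c" if "c \<in> J" for c
    using that \<sigma> by (auto simp: J_def cost_def)
  have "J \<noteq> {}" using U_ad_const[OF T assms(4)] sol_ex by (force simp: J_def)
  have bdd: "bdd_below J" using J0 by (rule bdd_belowI[of J 0])
  define j where "j = Inf J"
  have "\<exists>u y \<Phi>. u \<in> U_ad T ul uu \<and> ?sol u y \<Phi> \<and> cost T \<sigma> yd y u < j + inverse (real (Suc n))" for n
  proof -
    have "Inf J < j + inverse (real (Suc n))" by (simp add: j_def)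
    with cInf_lessD[OF \<open>J \<noteq> {}\<close>] show ?thesis by (fastforce simp: J_def)
  qed
  then obtain u y \<Phi> where u: "\<And>n. u n \<in> U_ad T ul uu" and sol: "\<And>n. ?sol (u n) (y n) (\<Phi> n)"
    and cost_less: "\<And>n. cost T \<sigma> yd (y n) (u n) < j + inverse (real (Suc n))"
    by metis
  have j_le: "j \<le> cost T \<sigma> yd z v" if "v \<in> U_ad T ul uu" "?sol v z \<Psi>" for v z \<Psi>
    unfolding j_def by (rule cInf_lower[OF _ bdd]) (use that in \<open>auto simp: J_def\<close>)
  have cost_lim: "(\<lambda>n. cost T \<sigma> yd (y n) (u n)) \<longlonglongrightarrow> j"
  proof (rule tendsto_sandwich[of "\<lambda>n. j" _ _ "\<lambda>n. j + inverse (real (Suc n))"])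
    show "(\<lambda>n. j + inverse (real (Suc n))) \<longlonglongrightarrow> j"
      using tendsto_add[OF tendsto_const LIMSEQ_inverse_real_of_nat, of j] by simp
  qed (use j_le[OF u sol] cost_less in \<open>auto intro!: always_eventually less_imp_le\<close>)
  have uH: "u n \<in> H1 ?I" and ub: "AE t in lebesgue_on ?I. ul \<le> u n t \<and> u n t \<le> uu" for n
    using u[of n] by (auto simp: U_ad_def)
  \<comment> \<open>The regularising term of the cost controls the derivative; the 1 is the largest
    value of \<open>inverse (real (Suc n))\<close>.\<close>
  have R: "norm_L2 ?I (weak_deriv ?I (u n)) \<le> sqrt (2 / \<sigma> * (j + 1))" for n
  proof -
    have "\<sigma> / 2 * (norm_L2 ?I (weak_deriv ?I (u n)))\<^sup>2 \<le> cost T \<sigma> yd (y n) (u n)"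
      using \<sigma> by (simp add: cost_def I.norm_H1_square distrib_left)
    also have "\<dots> \<le> j + 1" using cost_less[of n] by (simp add: inverse_le_1_iff order_trans[OF less_imp_le])
    finally have "(norm_L2 ?I (weak_deriv ?I (u n)))\<^sup>2 \<le> 2 / \<sigma> * (j + 1)" using \<sigma> by (simp add: field_simps)
    then show ?thesis by (rule real_le_rsqrt)
  qed
  obtain U r where r: "strict_mono (r :: nat \<Rightarrow> nat)" and UL: "U \<in> L2 ?I"
    and conv: "(\<lambda>n. norm_L2 ?I (\<lambda>t. u (r n) t - U t)) \<longlonglongrightarrow> 0"
    and Ub: "AE t in lebesgue_on ?I. ul \<le> U t \<and> U t \<le> uu"
    using H1_bounded_compact_L2[where u = u, OF T u R] by blast
  have "U \<in> H1 ?I"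
    by (rule I.weak_deriv_norm_le_of_L2_limit(1)[OF lm uH UL conv always_eventually]) (use R in blast)
  then have U: "U \<in> U_ad T ul uu" using Ub by (simp add: U_ad_def)
  \<comment> \<open>The comparison state is fixed once and for all, so its bound \<open>Cz\<close>
    gives one stability constant for the whole sequence.\<close>
  obtain z \<Psi> where z: "?sol U z \<Psi>" using sol_ex[OF U] by blast
  obtain Cz where Cz: "AE t in lebesgue_on ?I. norm_V (z t) \<le> Cz"
    using z by (auto simp: discrete_solution_def Bochner_Linf_def)
  have zT: "z T \<in> H" "y n T \<in> H" for n
    using z sol[of n] T by (auto simp: discrete_solution_def continuous_into_H_def)
  let ?B = "max \<bar>ul\<bar> \<bar>uu\<bar>" and ?c = "(norm_H \<chi>\<^sub>c)\<^sup>2 * exp ((1 + Cz\<^sup>2 / \<nu>) * T)"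
  have "(norm_H (\<lambda>x. y (r n) T x - z T x))\<^sup>2 \<le> ?c * (norm_L2 ?I (\<lambda>t. u (r n) t - U t))\<^sup>2" for n
  proof -
    have "AE t in lebesgue_on ?I. \<bar>u (r n) t\<bar> \<le> ?B" "AE t in lebesgue_on ?I. \<bar>U t\<bar> \<le> ?B"
      using ub[of "r n"] Ub by (eventually_elim, auto)+
    from discrete_solution_stability[OF T assms(2) \<chi>\<^sub>c sol z H1_L2[OF uH] this(1) UL this(2) Cz]
    show ?thesis by (simp add: mult_ac)
  qed
  moreover have "(\<lambda>n. ?c * (norm_L2 ?I (\<lambda>t. u (r n) t - U t))\<^sup>2) \<longlonglongrightarrow> ?c * 0\<^sup>2"
    by (intro tendsto_intros conv)
  ultimately have "(\<lambda>n. (norm_H (\<lambda>x. y (r n) T x - z T x))\<^sup>2) \<longlonglongrightarrow> 0"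
    by (intro Lim_null_comparison[of "\<lambda>n. (norm_H (\<lambda>x. y (r n) T x - z T x))\<^sup>2", OF always_eventually]) auto
  then have "(\<lambda>n. sqrt ((norm_H (\<lambda>x. y (r n) T x - z T x))\<^sup>2)) \<longlonglongrightarrow> sqrt 0" by (rule tendsto_real_sqrt)
  then have state: "(\<lambda>n. norm_H (\<lambda>x. y (r n) T x - z T x)) \<longlonglongrightarrow> 0" by (simp add: norm_L2_nonneg)
  let ?a = "\<lambda>w. norm_H (\<lambda>x. w T x - yd x)"
  have a_lim: "(\<lambda>n. ?a (y (r n))) \<longlonglongrightarrow> ?a z"
    by (rule tendsto_norm_L2) (use state zT assms(6) in \<open>auto intro!: L2_diff\<close>)
  have b_lim: "(\<lambda>n. norm_L2 ?I (u (r n))) \<longlonglongrightarrow> norm_L2 ?I U"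
    by (rule tendsto_norm_L2[OF H1_L2[OF uH] UL conv])
  \<comment> \<open>The cost solved for the squared norm of the weak derivative, so that convergence
    of the cost, of the final states and of the controls in L2 yields convergence of the derivative
    norms.\<close>
  let ?q = "\<lambda>c a b. 2 / \<sigma> * (c - 1 / 2 * a\<^sup>2) - b\<^sup>2"
  have deriv_sq: "(norm_L2 ?I (weak_deriv ?I v))\<^sup>2 = ?q (cost T \<sigma> yd w v) (?a w) (norm_L2 ?I v)" for v w
    using \<sigma> by (simp add: cost_def I.norm_H1_square field_simps)
  let ?l = "?q j (?a z) (norm_L2 ?I U)"
  have d2_lim: "(\<lambda>n. (norm_L2 ?I (weak_deriv ?I (u (r n))))\<^sup>2) \<longlonglongrightarrow> ?l"
    unfolding deriv_sq[of "u (r n)" "y (r n)" for n]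
    by (intro tendsto_intros a_lim b_lim LIMSEQ_subseq_LIMSEQ[OF cost_lim r, unfolded o_def])
  have l0: "0 \<le> ?l" by (rule LIMSEQ_le_const[OF d2_lim]) simp
  from tendsto_real_sqrt[OF d2_lim] have d_lim: "(\<lambda>n. norm_L2 ?I (weak_deriv ?I (u (r n)))) \<longlonglongrightarrow> sqrt ?l" by (simp add: norm_L2_nonneg)
  have "norm_L2 ?I (weak_deriv ?I U) \<le> sqrt ?l"
  \<comment> \<open>The closedness lemma asks for an eventual bound, but the norms only converge to
    \<open>sqrt ?l\<close>; hence the slack \<open>e\<close>.\<close>
  proof (rule field_le_epsilon)
    fix e :: real assume "0 < e"
    then have "\<forall>\<^sub>F n in sequentially. norm_L2 ?I (weak_deriv ?I (u (r n))) < sqrt ?l + e"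
      by (intro order_tendstoD(2)[OF d_lim]) simp
    then have "\<forall>\<^sub>F n in sequentially. norm_L2 ?I (weak_deriv ?I (u (r n))) \<le> sqrt ?l + e"
      by eventually_elim simp
    then show "norm_L2 ?I (weak_deriv ?I U) \<le> sqrt ?l + e"
      by (rule I.weak_deriv_norm_le_of_L2_limit(2)[OF lm uH UL conv])
  qed
  then have "(norm_L2 ?I (weak_deriv ?I U))\<^sup>2 \<le> (sqrt ?l)\<^sup>2" by (rule power_mono[OF _ norm_L2_nonneg])
  then have "?q (cost T \<sigma> yd z U) (?a z) (norm_L2 ?I U) \<le> ?l" using l0 deriv_sq[of U z] by simp
  \<comment> \<open>\<open>?q\<close> is strictly increasing in its first argument, and the other
    two arguments agree.\<close>
  then have "cost T \<sigma> yd z U \<le> j" using \<sigma> by (simp add: divide_right_mono field_simps)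
  then have "optimal_solution T \<nu> \<sigma> \<chi>\<^sub>c yd ul uu \<zeta> \<epsilon> N X y0 U z \<Psi>"
    unfolding optimal_solution_def using U z j_le by (meson order_trans)
  then show ?thesis by blast
qed

end
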